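(* Let $G$ be an abelian group, and let $A,B \subset G$ be two subsets with $|A| = |B| = N$. Let $K \geq 1$ and $\varepsilon \in (0,1/2)$. Then there exists $\delta = \delta(K,\varepsilon) > 0$ such that the following holds: if $\Gamma \subset A \times B$ is a subset with $|\Gamma| \geq (1-\delta)N^2$ and $|A+_{\Gamma}B| \leq KN$, where $A+_{\Gamma}B = \{a+b : (a,b)\in\Gamma\}$, then there exist subsets $A'\subset A$ and $B' \subset B$ such that \[ |A'| \geq (1-\varepsilon)N, \ \ |B'| \geq (1-\varepsilon)N, \ \ \hbox{and} \ \ |A'+B'| \leq |A+_{\Gamma}B| + \varepsilon N. \] Moreover, if $G = \mathbb F_p^n$ with $p$ fixed, then one may take $\delta = (\varepsilon/K)^{O_p(1)}$ in this statement.
   Context: For $\Gamma \subset A \times B$, the restricted sumset is $A+_{\Gamma}B = \{a+b : (a,b)\in\Gamma\}$. The notation $O_p(1)$ denotes a quantity bounded by a constant depending only on $p$. *)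

theory Defs
  imports Complex_Main "HOL-Algebra.Product_Groups" "HOL-Computational_Algebra.Primes"
begin

text \<open>
  Abelian groups are structures of HOL-Algebra, hence written multiplicatively: \<open>a + b\<close>
  is \<open>a \<otimes>\<^bsub>G\<^esub> b\<close> and the full sumset \<open>A + B\<close> is \<open>A <#>\<^bsub>G\<^esub> B\<close>.
\<close>

definition restricted_sumset :: "('a, 'b) monoid_scheme \<Rightarrow> ('a \<times> 'a) set \<Rightarrow> 'a set" where
  "restricted_sumset G \<Gamma> = {a \<otimes>\<^bsub>G\<^esub> b | a b. (a, b) \<in> \<Gamma>}"

text \<open>Finiteness is stated explicitly because \<open>card\<close> of an infinite set is \<open>0\<close>.\<close>

definition almost_all_sums ::
    "('a, 'b) monoid_scheme \<Rightarrow> real \<Rightarrow> real \<Rightarrow> real \<Rightarrow> bool" where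
  "almost_all_sums G K \<epsilon> \<delta> \<longleftrightarrow>
     (\<forall>(N::nat) A B \<Gamma>.
        A \<subseteq> carrier G \<longrightarrow> B \<subseteq> carrier G \<longrightarrow> finite A \<longrightarrow> finite B \<longrightarrow>
        card A = N \<longrightarrow> card B = N \<longrightarrow>
        \<Gamma> \<subseteq> A \<times> B \<longrightarrow>
        real (card \<Gamma>) \<ge> (1 - \<delta>) * (real N)\<^sup>2 \<longrightarrow>
        real (card (restricted_sumset G \<Gamma>)) \<le> K * real N \<longrightarrow>
        (\<exists>A' B'. A' \<subseteq> A \<and> B' \<subseteq> B \<and>
           real (card A') \<ge> (1 - \<epsilon>) * real N \<and>
           real (card B') \<ge> (1 - \<epsilon>) * real N \<and>
           real (card (A' <#>\<^bsub>G\<^esub> B')) \<le> real (card (restricted_sumset G \<Gamma>)) + \<epsilon> * real N))"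

text \<open>
  The number \<open>\<delta>(K,\<epsilon>)\<close> may depend on \<open>K\<close> and \<open>\<epsilon>\<close> only, so it has to be
  the same for groups over all types. HOL cannot quantify over types inside a formula: in
  \<open>\<exists>\<delta>. \<forall>G :: 'a monoid. \<dots>\<close> the witness could depend on the type \<open>'a\<close>. The witness is
  therefore named by a constant whose type contains no type variable. It is chosen to work
  for all abelian groups with carrier in \<open>nat\<close> (up to isomorphism, all countable ones),
  if such a number exists. Neither its positivity nor its validity over any type, \<open>nat\<close>
  included, is built in: the existence of a valid choice has to be proved.
\<close>

definition delta_sums :: "real \<Rightarrow> real \<Rightarrow> real" where
  "delta_sums K \<epsilon> =
     (SOME \<delta>. \<delta> > 0 \<and> (\<forall>G :: nat monoid. comm_group G \<longrightarrow> almost_all_sums G K \<epsilon> \<delta>))"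

definition Fp_power :: "nat \<Rightarrow> nat \<Rightarrow> (nat \<Rightarrow> int) monoid" where
  "Fp_power p n = product_group {..<n} (\<lambda>_. integer_mod_group p)"

lemma comm_group_Fp_power: "comm_group (Fp_power p n)"
proof (rule group.group_comm_groupI)
  show "group (Fp_power p n)"
    by (simp add: Fp_power_def)
qed (auto simp: Fp_power_def add.commute)

end

(* Idea. Keep only the vertices A1, B1 of almost full degree in Gamma. Every difference of two
   elements of A1 is a difference c - c' with c, c' in C = A +_Gamma B in at least N/2 ways, so
   A1 - A1 has size O(K^2 N). The bad pairs are those (a, b) in A1 x B1 with a + b not in C; there
   are at most delta N^2 of them, and it suffices to find few elements a, b and a + b that meet all
   bad pairs.

   General group: join x in A1 - A1, y in A1 and z in C when y - x lies in A1, z - y in B1 and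
   z - x outside C. A triangle is a bad pair (a, b) with a choice of y, so there are few triangles.
   Every bad pair gives at least N/2 edge-disjoint triangles (y - a, y, y + b), so after triangle
   removal one of a, b, a + b labels at least N/8 of the removed edges, and few elements do that.
   Only sums in two variables enter, so no Freiman model is needed here.

   F_p^n: Pluennecke's inequality bounds (A1 + B1) - (A1 + B1) polynomially, so a linear map to
   F_p^m with p^m = O_p(K^12 N) preserves the relation a + b = c. There the argument of Fox and Lovasz
   applies: remove vertices of large degree at scales p^k; at each scale a random affine subspace of
   codimension k isolates a constant proportion of the surviving solutions, and the isolated solutions
   form a tricoloured sum-free set, which is small by the slice rank method. *)

theory Submission
  imports
    Defs
    "HOL-Library.Indicator_Function"
    "HOL-Library.Countable_Set"
    "HOL-Number_Theory.Residues"
    "HOL-Algebra.Generated_Groups"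
begin

section \<open>The triangle removal lemma\<close>

text \<open>The regularity lemma behind triangle removal loses a tower of exponentials, so it cannot
  give a \<open>\<delta>\<close> polynomial in \<open>\<epsilon> / K\<close>. Over the prime field
  it is replaced by the slice rank bound, whose saving \<open>(\<rho> / p) ^ q\<close> is measured
  against the whole space. The saving is worth something only if that space is not much larger than
  the sets: hence the linear map to a small space, and hence the bound on a double difference set,
  on which the map has to be injective. In both cases the density parameter has the form
  \<open>\<tau>\<^sup>2\<close>, because Markov's inequality then discards at most
  \<open>\<tau> * N\<close> elements on either side. A further obstacle is logical. Removal is
  proved for one vertex type at a time, so its constant could vary with the type. Only the group
  generated by \<open>A \<union> B\<close> matters, and it is countable; a copy of it inside
  \<open>nat\<close> carries the one constant chosen over \<open>nat\<close> to every other
  type.\<close>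

definition cond_avg :: "'b set \<Rightarrow> ('b \<Rightarrow> 'c) \<Rightarrow> ('b \<Rightarrow> real) \<Rightarrow> 'b \<Rightarrow> real" where
  "cond_avg \<Omega> \<kappa> f w = (\<Sum>v | v \<in> \<Omega> \<and> \<kappa> v = \<kappa> w. f v) / card {v \<in> \<Omega>. \<kappa> v = \<kappa> w}"

lemma cond_avg_cong: "\<kappa> v = \<kappa> w \<Longrightarrow> cond_avg \<Omega> \<kappa> f v = cond_avg \<Omega> \<kappa> f w"
  by (simp add: cond_avg_def)

text \<open>\<open>cond_avg\<close> is the conditional expectation given \<open>\<kappa>\<close> for
  counting measure, and this is its defining property: pairing with a function constant on the
  fibres does not notice the averaging.\<close>

lemma sum_cond_avg:
  assumes fin: "finite \<Omega>"
    and h: "\<And>v w. \<lbrakk>v \<in> \<Omega>; w \<in> \<Omega>; \<kappa> v = \<kappa> w\<rbrakk> \<Longrightarrow> h v = h w"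
  shows "(\<Sum>w\<in>\<Omega>. cond_avg \<Omega> \<kappa> f w * h w) = (\<Sum>w\<in>\<Omega>. f w * h w)"
proof -
  have "(\<Sum>w | w \<in> \<Omega> \<and> \<kappa> w = \<kappa> u. cond_avg \<Omega> \<kappa> f w * h w)
      = (\<Sum>w | w \<in> \<Omega> \<and> \<kappa> w = \<kappa> u. f w * h w)" if u: "u \<in> \<Omega>" for u
  proof -
    let ?S = "{w \<in> \<Omega>. \<kappa> w = \<kappa> u}"
    have S: "finite ?S" "card ?S > 0"
      using fin u by (auto simp: card_gt_0_iff)
    have "(\<Sum>w\<in>?S. cond_avg \<Omega> \<kappa> f w * h w) = (\<Sum>w\<in>?S. cond_avg \<Omega> \<kappa> f u * h u)"
      by (rule sum.cong[OF refl], rule arg_cong2[of _ _ _ _ "(*)"])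
        (use u in \<open>auto intro!: h cond_avg_cong\<close>)
    also have "\<dots> = (\<Sum>w\<in>?S. f w) * h u"
    proof -
      have "n * (s / n * r) = s * r" if "0 < n" for n s r :: real using that by simp
      from this[of "card ?S"] S(2) show ?thesis
        by (simp only: cond_avg_def sum_constant of_nat_0_less_iff)
    qed
    also have "\<dots> = (\<Sum>w\<in>?S. f w * h w)"
      unfolding sum_distrib_right
      by (rule sum.cong[OF refl], rule arg_cong2[of _ _ _ _ "(*)"]) (use u in \<open>auto intro!: h\<close>)
    finally show ?thesis .
  qed
  note fibre = this
  show ?thesis
    unfolding sum.image_gen[OF fin, of "\<lambda>w. cond_avg \<Omega> \<kappa> f w * h w" \<kappa>]
      sum.image_gen[OF fin, of "\<lambda>w. f w * h w" \<kappa>]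
    by (rule sum.cong[OF refl]) (auto simp: fibre)
qed

lemma cond_avg_bounds:
  assumes "\<And>v. 0 \<le> f v \<and> f v \<le> 1"
  shows "0 \<le> cond_avg \<Omega> \<kappa> f w \<and> cond_avg \<Omega> \<kappa> f w \<le> 1"
proof -
  let ?S = "{v \<in> \<Omega>. \<kappa> v = \<kappa> w}"
  have "sum f ?S \<le> (\<Sum>v\<in>?S. 1)" "0 \<le> sum f ?S"
    using assms by (auto intro!: sum_mono sum_nonneg simp del: sum_constant)
  then have "0 \<le> sum f ?S / n \<and> sum f ?S / n \<le> 1" if "n = card ?S" for n :: real
    using that by (cases "n = 0") (auto simp: divide_le_eq_1)
  then show ?thesis by (simp add: cond_avg_def)
qed

definition energy :: "'b set \<Rightarrow> ('b \<Rightarrow> 'c) \<Rightarrow> ('b \<Rightarrow> real) \<Rightarrow> real" where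
  "energy \<Omega> \<kappa> f = (\<Sum>w\<in>\<Omega>. (cond_avg \<Omega> \<kappa> f w)\<^sup>2)"

text \<open>Pythagoras: by the previous identity the finer average minus the coarser one is
  orthogonal to the coarser one.\<close>

lemma energy_refine:
  assumes fin: "finite \<Omega>"
    and refine: "\<And>v w. \<lbrakk>v \<in> \<Omega>; w \<in> \<Omega>; \<kappa>' v = \<kappa>' w\<rbrakk> \<Longrightarrow> \<kappa> v = \<kappa> w"
  shows "energy \<Omega> \<kappa>' f = energy \<Omega> \<kappa> f
    + (\<Sum>w\<in>\<Omega>. (cond_avg \<Omega> \<kappa>' f w - cond_avg \<Omega> \<kappa> f w)\<^sup>2)"
proof -
  have "(\<Sum>w\<in>\<Omega>. cond_avg \<Omega> \<kappa>' f w * cond_avg \<Omega> \<kappa> f w) = (\<Sum>w\<in>\<Omega>. f w * cond_avg \<Omega> \<kappa> f w)"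
    by (rule sum_cond_avg[OF fin]) (use refine in \<open>auto intro: cond_avg_cong\<close>)
  also have "\<dots> = energy \<Omega> \<kappa> f"
    unfolding energy_def power2_eq_square
    by (rule sum_cond_avg[OF fin, symmetric]) (auto intro: cond_avg_cong)
  finally show ?thesis
    by (simp add: energy_def power2_diff sum.distrib sum_subtractf sum_distrib_left[symmetric]
      mult.assoc)
qed

lemma energy_nonneg: "0 \<le> energy \<Omega> \<kappa> f"
  by (simp add: energy_def sum_nonneg)

lemma energy_le_card:
  assumes "\<And>v. 0 \<le> f v \<and> f v \<le> 1"
  shows "energy \<Omega> \<kappa> f \<le> card \<Omega>"
proof -
  have "energy \<Omega> \<kappa> f \<le> (\<Sum>w\<in>\<Omega>. 1)"
    unfolding energy_def
    by (rule sum_mono) (use cond_avg_bounds[of f, OF assms] in \<open>auto intro: power_le_one\<close>)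
  then show ?thesis by simp
qed

text \<open>A partition is given by a finite family \<open>F\<close> of sets: its parts are the atoms of the algebra
  generated by \<open>F\<close>. Refining means enlarging \<open>F\<close>, and all partitions have labels of one type.\<close>

definition atom_label :: "'v set set \<Rightarrow> 'v \<Rightarrow> 'v set set" where
  "atom_label F x = {S \<in> F. x \<in> S}"

definition atom :: "'v set \<Rightarrow> 'v set set \<Rightarrow> 'v \<Rightarrow> 'v set" where
  "atom V F x = {u \<in> V. atom_label F u = atom_label F x}"

definition edge_density :: "'v set \<Rightarrow> 'v set set \<Rightarrow> ('v \<times> 'v) set \<Rightarrow> 'v \<times> 'v \<Rightarrow> real" where
  "edge_density V F E = cond_avg (V \<times> V) (map_prod (atom_label F) (atom_label F)) (indicator E)"

text \<open>Irregular pairs of parts are counted by the pairs of vertices they contain.\<close>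

definition irregular :: "real \<Rightarrow> 'v set \<Rightarrow> 'v set set \<Rightarrow> ('v \<times> 'v) set \<Rightarrow> ('v \<times> 'v) set" where
  "irregular \<eta> V F E = {(x, y) \<in> V \<times> V. \<exists>A B. A \<subseteq> atom V F x \<and> B \<subseteq> atom V F y \<and>
     \<eta> * real (card (atom V F x)) \<le> card A \<and> \<eta> * real (card (atom V F y)) \<le> card B \<and>
     \<eta> * real (card A * card B) < \<bar>card (E \<inter> A \<times> B) - edge_density V F E (x, y) * (card A * card B)\<bar>}"

lemma regularD:
  fixes \<eta> :: real
  assumes "(x, y) \<notin> irregular \<eta> V F E" "x \<in> V" "y \<in> V" "A \<subseteq> atom V F x" "B \<subseteq> atom V F y"
    "\<eta> * card (atom V F x) \<le> card A" "\<eta> * card (atom V F y) \<le> card B"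
  shows "\<bar>card (E \<inter> A \<times> B) - edge_density V F E (x, y) * (card A * card B)\<bar>
    \<le> \<eta> * (card A * card B)"
proof (rule ccontr)
  assume "\<not> ?thesis"
  then have "\<eta> * (card A * card B)
    < \<bar>card (E \<inter> A \<times> B) - edge_density V F E (x, y) * (card A * card B)\<bar>"
    by (simp only: not_le)
  then have "(x, y) \<in> irregular \<eta> V F E"
    unfolding irregular_def mem_Collect_eq prod.case
    by (intro conjI exI[of _ A] exI[of _ B]) (use assms in \<open>simp_all\<close>)
  then show False using assms by simp
qed

lemma atom_cong: "atom_label F x = atom_label F y \<Longrightarrow> atom V F x = atom V F y"
  by (simp add: atom_def)

lemma atom_label_image:
  assumes "finite F"
  shows "finite (atom_label F ` V)" "card (atom_label F ` V) \<le> 2 ^ card F"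
proof -
  have sub: "atom_label F ` V \<subseteq> Pow F" by (auto simp: atom_label_def)
  show "finite (atom_label F ` V)" using finite_subset[OF sub] assms by simp
  show "card (atom_label F ` V) \<le> 2 ^ card F"
    using card_mono[OF _ sub] assms by (simp add: card_Pow)
qed

section \<open>Szemeredi's regularity lemma by energy increment\<close>

lemma sum_squares_ge:
  fixes g :: "'b \<Rightarrow> real" and c :: real
  assumes "finite S" and gt: "c * card S \<le> \<bar>sum g S\<bar>" and "0 \<le> c"
  shows "c\<^sup>2 * card S \<le> (\<Sum>w\<in>S. (g w)\<^sup>2)"
proof -
  define s where "s = (if sum g S \<ge> 0 then c else - c)"
  have "0 \<le> (\<Sum>w\<in>S. (g w - s)\<^sup>2)" by (simp add: sum_nonneg)
  also have "\<dots> = (\<Sum>w\<in>S. (g w)\<^sup>2) - 2 * s * sum g S + s\<^sup>2 * card S"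
    by (simp add: power2_diff sum.distrib sum_subtractf sum_distrib_left sum_distrib_right mult_ac)
  finally have "2 * (s * sum g S) \<le> (\<Sum>w\<in>S. (g w)\<^sup>2) + s\<^sup>2 * card S" by simp
  moreover have "c * \<bar>sum g S\<bar> = s * sum g S" "s\<^sup>2 = c\<^sup>2" by (auto simp: s_def)
  moreover have "c * (c * card S) \<le> c * \<bar>sum g S\<bar>"
    using gt \<open>0 \<le> c\<close> by (rule mult_left_mono)
  ultimately show ?thesis by (simp add: power2_eq_square)
qed

lemma card_eq_sum_indicator:
  assumes "finite \<Omega>" "S \<subseteq> \<Omega>"
  shows "real (card S) = (\<Sum>w\<in>\<Omega>. indicator S w)"
proof -
  have "(\<Sum>w\<in>\<Omega>. indicator S w :: real) = (\<Sum>w\<in>S. 1)"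
    using assms by (intro sum.mono_neutral_cong_right) auto
  then show ?thesis by simp
qed

text \<open>A witness of irregularity is added for every irregular pair of parts. It fills at least
  the proportion \<open>\<eta>\<^sup>2\<close> of the pair and its density is off by
  \<open>\<eta>\<close>, so by Cauchy-Schwarz the pair gains \<open>\<eta> ^ 4\<close> times its
  size; the irregular pairs together exceed \<open>\<eta> * (card V)\<^sup>2\<close>. Two new sets
  for each pair of labels account for the growth of the family.\<close>

lemma energy_increment:
  fixes V :: "'v set" and \<eta> :: real
  assumes V: "finite V" and F: "finite F" and \<eta>: "0 < \<eta>"
    and irr: "\<eta> * (card V)\<^sup>2 < card (irregular \<eta> V F E)"
  obtains F' where "finite F'" "F \<subseteq> F'" "card F' \<le> card F + 2 * (2 ^ card F)\<^sup>2"
    "\<And>F''. F' \<subseteq> F'' \<Longrightarrow>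
      energy (V \<times> V) (map_prod (atom_label F) (atom_label F)) (indicator E) + \<eta> ^ 5 * (card V)\<^sup>2
      \<le> energy (V \<times> V) (map_prod (atom_label F'') (atom_label F'')) (indicator E)"
proof -
  define \<kappa> where "\<kappa> = map_prod (atom_label F) (atom_label F)"
  define I where "I = irregular \<eta> V F E"
  define f0 where "f0 = edge_density V F E"
  define P where "P w A B \<longleftrightarrow> A \<subseteq> atom V F (fst w) \<and> B \<subseteq> atom V F (snd w) \<and>
     \<eta> * card (atom V F (fst w)) \<le> card A \<and> \<eta> * card (atom V F (snd w)) \<le> card B \<and>
     \<eta> * (card A * card B) < \<bar>card (E \<inter> A \<times> B) - f0 w * (card A * card B)\<bar>" for w A B
  have P_cong: "P v = P w" if "\<kappa> v = \<kappa> w" for v w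
  proof -
    have "atom V F (fst v) = atom V F (fst w)" "atom V F (snd v) = atom V F (snd w)"
      using that by (auto simp: \<kappa>_def map_prod_def split_beta intro!: atom_cong[of F])
    moreover have "f0 v = f0 w"
      unfolding f0_def edge_density_def by (rule cond_avg_cong) (use that in \<open>simp add: \<kappa>_def\<close>)
    ultimately show ?thesis by (auto simp: P_def fun_eq_iff)
  qed
  have I_def': "I = {w \<in> V \<times> V. \<exists>A B. P w A B}"
    unfolding I_def irregular_def P_def f0_def by (simp add: set_eq_iff)
  have finI: "finite I" unfolding I_def' using V by auto
  \<comment> \<open>The choice depends only on the pair of labels, so the number of new sets is
    bounded independently of \<open>V\<close>; \<open>P_cong\<close> makes the witness valid on the
    whole cell.\<close>
  define wit where "wit c = (SOME AB. \<exists>w\<in>V \<times> V. \<kappa> w = c \<and> P w (fst AB) (snd AB))" for c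
  have wit: "P w (fst (wit (\<kappa> w))) (snd (wit (\<kappa> w)))" if "w \<in> I" for w
  proof -
    have "\<exists>AB. \<exists>w'\<in>V \<times> V. \<kappa> w' = \<kappa> w \<and> P w' (fst AB) (snd AB)" using that by (fastforce simp: I_def')
    from someI_ex[OF this] obtain w' where "\<kappa> w' = \<kappa> w" "P w' (fst (wit (\<kappa> w))) (snd (wit (\<kappa> w)))"
      unfolding wit_def by blast
    then show ?thesis using P_cong[of w' w] by simp
  qed
  define F' where "F' = F \<union> (fst \<circ> wit) ` \<kappa> ` (V \<times> V) \<union> (snd \<circ> wit) ` \<kappa> ` (V \<times> V)"
  have kim: "\<kappa> ` (V \<times> V) \<subseteq> atom_label F ` V \<times> atom_label F ` V" by (auto simp: \<kappa>_def)
  have cardk: "card (\<kappa> ` (V \<times> V)) \<le> (2 ^ card F)\<^sup>2"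
  proof -
    have "card (\<kappa> ` (V \<times> V)) \<le> card (atom_label F ` V) * card (atom_label F ` V)"
      using card_mono[OF _ kim] atom_label_image[OF F] by (simp add: card_cartesian_product)
    also have "\<dots> \<le> 2 ^ card F * 2 ^ card F"
      using atom_label_image[OF F] by (intro mult_mono) auto
    finally show ?thesis by (simp add: power2_eq_square)
  qed
  have "finite F'" using F V by (simp add: F'_def)
  moreover have "F \<subseteq> F'" by (auto simp: F'_def)
  moreover have "card F' \<le> card F + 2 * (2 ^ card F)\<^sup>2"
  proof -
    have "card ((g \<circ> wit) ` \<kappa> ` (V \<times> V)) \<le> (2 ^ card F)\<^sup>2" for g :: "'v set \<times> 'v set \<Rightarrow> 'v set"
      using card_image_le[of "\<kappa> ` (V \<times> V)" "g \<circ> wit"] cardk V by simp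
    from this[of fst] this[of snd] show ?thesis
      unfolding F'_def
      by (intro order_trans[OF card_Un_le] order_trans[OF add_mono[OF card_Un_le order_refl]]) simp
  qed
  moreover have "energy (V \<times> V) \<kappa> (indicator E) + \<eta> ^ 5 * (card V)\<^sup>2
      \<le> energy (V \<times> V) (map_prod (atom_label F'') (atom_label F'')) (indicator E)"
    if F'': "F' \<subseteq> F''" for F''
  proof -
    define \<kappa>' where "\<kappa>' = map_prod (atom_label F'') (atom_label F'')"
    define f1 where "f1 = cond_avg (V \<times> V) \<kappa>' (indicator E)"
    have lab: "atom_label F x = atom_label F y" if "atom_label F'' x = atom_label F'' y" for x y
      using that F'' \<open>F \<subseteq> F'\<close> by (auto simp: atom_label_def set_eq_iff)
    have "energy (V \<times> V) \<kappa>' (indicator E) = energy (V \<times> V) \<kappa> (indicator E)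
      + (\<Sum>w\<in>V \<times> V. (f1 w - f0 w)\<^sup>2)"
      unfolding f1_def f0_def edge_density_def \<kappa>_def[symmetric]
      by (rule energy_refine) (use V in \<open>auto simp: \<kappa>_def \<kappa>'_def intro!: lab\<close>)
    moreover have "\<eta> ^ 4 * card I \<le> (\<Sum>w\<in>I. (f1 w - f0 w)\<^sup>2)"
    proof -
      have "\<eta> ^ 4 * card {w \<in> I. \<kappa> w = \<kappa> u} \<le> (\<Sum>w | w \<in> I \<and> \<kappa> w = \<kappa> u. (f1 w - f0 w)\<^sup>2)"
        if u: "u \<in> I" for u
      proof -
        obtain x y where xy: "u = (x, y)" by force
        obtain A B where AB: "wit (\<kappa> u) = (A, B)" by force
        have P: "P u A B" using wit[OF u] AB by simp
        have fib: "{w \<in> I. \<kappa> w = \<kappa> u} = atom V F x \<times> atom V F y"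
        proof -
          have "w \<in> I" if "w \<in> V \<times> V" "\<kappa> w = \<kappa> u" for w
            using that P P_cong[OF that(2)] by (auto simp: I_def')
          then show ?thesis unfolding I_def' by (auto simp: xy \<kappa>_def atom_def)
        qed
        have sub: "A \<subseteq> atom V F x" "B \<subseteq> atom V F y"
          and big: "\<eta> * card (atom V F x) \<le> card A" "\<eta> * card (atom V F y) \<le> card B"
          and dev: "\<eta> * (card A * card B) < \<bar>card (E \<inter> A \<times> B) - f0 u * (card A * card B)\<bar>"
          using P by (auto simp: P_def xy)
        have fin: "finite (atom V F x)" "finite (atom V F y)" "finite A" "finite B"
          using V sub by (auto simp: atom_def intro: finite_subset[of _ V])
        have AV: "A \<times> B \<subseteq> V \<times> V" using sub by (auto simp: atom_def)
        have mem: "A \<in> F''" "B \<in> F''"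
        proof -
          have "\<kappa> u \<in> \<kappa> ` (V \<times> V)" using u by (auto simp: I_def')
          then have "A \<in> F'" "B \<in> F'" unfolding F'_def using AB
            by (metis UnCI comp_apply fst_conv image_eqI, metis UnCI comp_apply snd_conv image_eqI)
          then show "A \<in> F''" "B \<in> F''" using F'' by auto
        qed
        \<comment> \<open>\<open>A\<close> and \<open>B\<close> belong to \<open>F''\<close>, so
          \<open>A \<times> B\<close> is a union of cells of \<open>\<kappa>'\<close> and averaging
          preserves its number of edges.\<close>
        have "(\<Sum>w\<in>V \<times> V. f1 w * indicator (A \<times> B) w) = (\<Sum>w\<in>V \<times> V. indicator E w * indicator (A \<times> B) w)"
          unfolding f1_def
          by (rule sum_cond_avg)
            (use V mem in \<open>auto simp: \<kappa>'_def atom_label_def set_eq_iff indicator_def\<close>)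
        also have "\<dots> = (\<Sum>w\<in>V \<times> V. indicator (E \<inter> A \<times> B) w)"
          by (rule sum.cong) (auto simp: indicator_def)
        also have "\<dots> = card (E \<inter> A \<times> B)"
          using V AV by (intro card_eq_sum_indicator[symmetric]) auto
        also have "(\<Sum>w\<in>V \<times> V. f1 w * indicator (A \<times> B) w) = sum f1 (A \<times> B)"
          using V AV by (intro sum.mono_neutral_cong_right) auto
        finally have s1: "sum f1 (A \<times> B) = card (E \<inter> A \<times> B)" .
        have "sum f0 (A \<times> B) = (\<Sum>w\<in>A \<times> B. f0 u)"
          unfolding f0_def edge_density_def
          by (intro sum.cong cond_avg_cong)
            (use sub in \<open>auto simp: xy atom_def subset_iff simp del: split_paired_All\<close>)
        then have s0: "sum f0 (A \<times> B) = f0 u * (card A * card B)"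
          by (simp add: card_cartesian_product)
        have "\<eta>\<^sup>2 * card (A \<times> B) \<le> (\<Sum>w\<in>A \<times> B. (f1 w - f0 w)\<^sup>2)"
          by (rule sum_squares_ge) (use fin dev \<eta> s0 s1 in
              \<open>auto simp: sum_subtractf card_cartesian_product\<close>)
        also have "\<dots> \<le> (\<Sum>w\<in>{w \<in> I. \<kappa> w = \<kappa> u}. (f1 w - f0 w)\<^sup>2)"
          unfolding fib by (rule sum_mono2) (use fin sub in auto)
        finally have "\<eta>\<^sup>2 * card (A \<times> B) \<le> (\<Sum>w\<in>{w \<in> I. \<kappa> w = \<kappa> u}. (f1 w - f0 w)\<^sup>2)" .
        moreover have "\<eta> ^ 4 * card {w \<in> I. \<kappa> w = \<kappa> u}
            = \<eta>\<^sup>2 * ((\<eta> * card (atom V F x)) * (\<eta> * card (atom V F y)))"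
          unfolding fib by (simp add: card_cartesian_product eval_nat_numeral)
        moreover have "\<dots> \<le> \<eta>\<^sup>2 * (real (card A) * card B)"
          using big \<eta> by (intro mult_left_mono mult_mono) auto
        ultimately show ?thesis by (simp add: card_cartesian_product)
      qed
      then have "(\<Sum>c\<in>\<kappa> ` I. \<eta> ^ 4 * card {w \<in> I. \<kappa> w = c})
        \<le> (\<Sum>c\<in>\<kappa> ` I. \<Sum>w | w \<in> I \<and> \<kappa> w = c. (f1 w - f0 w)\<^sup>2)"
        by (intro sum_mono) auto
      also have "\<dots> = (\<Sum>w\<in>I. (f1 w - f0 w)\<^sup>2)"
        by (rule sum.image_gen[OF finI, symmetric])
      also have "(\<Sum>c\<in>\<kappa> ` I. \<eta> ^ 4 * card {w \<in> I. \<kappa> w = c}) = (\<Sum>w\<in>I. \<eta> ^ 4)"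
        using sum.image_gen[OF finI, of "\<lambda>_. \<eta> ^ 4" \<kappa>] by (simp add: mult.commute)
      finally show ?thesis by (simp add: mult.commute)
    qed
    moreover have "(\<Sum>w\<in>I. (f1 w - f0 w)\<^sup>2) \<le> (\<Sum>w\<in>V \<times> V. (f1 w - f0 w)\<^sup>2)"
      using V by (intro sum_mono2) (auto simp: I_def')
    moreover have "\<eta> ^ 4 * (\<eta> * (card V)\<^sup>2) \<le> \<eta> ^ 4 * card I"
      using irr \<eta> by (intro mult_left_mono) (auto simp: I_def)
    ultimately show ?thesis by (simp add: \<kappa>'_def eval_nat_numeral mult.assoc)
  qed
  ultimately show ?thesis using that[of F'] by (simp add: \<kappa>_def)
qed

text \<open>Three edge sets are regularised at once with the sum of their energies as potential. It
  is at most \<open>3 * (card V)\<^sup>2\<close>, and a refinement caused by one of them raises it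
  by \<open>\<eta> ^ 5 * (card V)\<^sup>2\<close> without lowering the other two. So fewer than
  \<open>J\<close> refinements occur, and the family stays below an iterate of \<open>g\<close> that
  depends on \<open>\<eta>\<close> alone.\<close>

lemma regularity:
  fixes \<eta> :: real
  assumes \<eta>: "0 < \<eta>"
  obtains M :: nat where
    "\<And>(V :: 'v set) (E :: nat \<Rightarrow> ('v \<times> 'v) set). finite V \<Longrightarrow>
      \<exists>F. finite F \<and> card F \<le> M \<and> (\<forall>i<3::nat. card (irregular \<eta> V F (E i)) \<le> \<eta> * (card V)\<^sup>2)"
proof -
  define g where "g m = m + 2 * (2 ^ m)\<^sup>2" for m :: nat
  have g_mono: "m \<le> m' \<Longrightarrow> g m \<le> g m'" for m m'
    unfolding g_def by (intro add_mono mult_left_mono power_mono power_increasing) auto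
  obtain J :: nat where J: "3 / \<eta> ^ 5 < J" using reals_Archimedean2 by blast
  have J': "3 < J * \<eta> ^ 5" using J \<eta> by (simp add: divide_less_eq)
  have "\<exists>F. finite F \<and> card F \<le> (g ^^ J) 0 \<and> (\<forall>i<3::nat. card (irregular \<eta> V F (E i)) \<le> \<eta> * (card V)\<^sup>2)"
    if V: "finite V" for V :: "'v set" and E :: "nat \<Rightarrow> ('v \<times> 'v) set"
  proof (rule ccontr)
    assume contra: "\<not> ?thesis"
    define en where "en F i = energy (V \<times> V) (map_prod (atom_label F) (atom_label F))
      (indicator (E i))" for F i
    have up: "(g ^^ j) 0 \<le> (g ^^ J) 0" if "j \<le> J" for j
    proof -
      have "(g ^^ j) 0 \<le> (g ^^ (j + d)) 0" for d
        by (induction d) (auto simp: g_def intro: le_trans trans_le_add1)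
      from this[of "J - j"] show ?thesis using that by simp
    qed
    have "\<exists>F. finite F \<and> card F \<le> (g ^^ j) 0 \<and> j * \<eta> ^ 5 * (card V)\<^sup>2 \<le> (\<Sum>i<3. en F i)"
      if "j \<le> J" for j using that
    proof (induction j)
      case 0 then show ?case by (intro exI[of _ "{}"]) (auto simp: en_def energy_nonneg sum_nonneg)
    next
      case (Suc j)
      then obtain F where F: "finite F" "card F \<le> (g ^^ j) 0"
        and e: "j * \<eta> ^ 5 * (card V)\<^sup>2 \<le> (\<Sum>i<3. en F i)" by auto
      have "card F \<le> (g ^^ J) 0" using F up[of j] Suc.prems by simp
      then obtain i where i: "i < 3" "\<eta> * (card V)\<^sup>2 < card (irregular \<eta> V F (E i))"
        using contra F by (auto simp: not_le)
      obtain F' where F': "finite F'" "F \<subseteq> F'" "card F' \<le> card F + 2 * (2 ^ card F)\<^sup>2"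
        and inc: "\<And>F''. F' \<subseteq> F'' \<Longrightarrow> en F i + \<eta> ^ 5 * (card V)\<^sup>2 \<le> en F'' i"
        using energy_increment[OF V F(1) \<eta> i(2), folded en_def] by blast
      have mono: "en F k \<le> en F' k" for k
      proof -
        have lab: "atom_label F x = atom_label F y" if "atom_label F' x = atom_label F' y" for x y
          using that F'(2) by (auto simp: atom_label_def set_eq_iff)
        show ?thesis unfolding en_def
          by (subst energy_refine[of _ "map_prod (atom_label F') (atom_label F')"
                "map_prod (atom_label F) (atom_label F)"])
            (use V in \<open>auto intro!: sum_nonneg lab\<close>)
      qed
      have "(\<Sum>k<3. en F k + (if k = i then \<eta> ^ 5 * (card V)\<^sup>2 else 0)) \<le> (\<Sum>k<3. en F' k)"
        by (rule sum_mono) (use mono inc[of F'] in auto)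
      then have "(\<Sum>k<3. en F k) + \<eta> ^ 5 * (card V)\<^sup>2 \<le> (\<Sum>k<3. en F' k)"
        using i(1) by (simp add: sum.distrib)
      moreover have "card F' \<le> (g ^^ Suc j) 0"
        using F'(3) g_mono[OF F(2)] by (simp add: g_def)
      ultimately show ?case using F'(1) e by (intro exI[of _ F']) (auto simp: algebra_simps)
    qed
    from this[of J] obtain F where F: "finite F" "card F \<le> (g ^^ J) 0"
      "J * \<eta> ^ 5 * (card V)\<^sup>2 \<le> (\<Sum>i<3. en F i)" by auto
    have "en F i \<le> real ((card V)\<^sup>2)" for i
      unfolding en_def by (rule order_trans[OF energy_le_card])
        (auto simp: indicator_def card_cartesian_product power2_eq_square)
    then have "(\<Sum>i<3. en F i) \<le> (\<Sum>i<3::nat. real ((card V)\<^sup>2))" by (intro sum_mono) auto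
    then have "J * \<eta> ^ 5 * (card V)\<^sup>2 \<le> 3 * (card V)\<^sup>2" using F(3) by simp
    moreover have "card V > 0"
    proof (rule ccontr)
      assume "\<not> 0 < card V"
      then have "V = {}" using V by auto
      then show False using contra by (auto simp: irregular_def)
    qed
    ultimately show False using J' by simp
  qed
  then show ?thesis using that by blast
qed

text \<open>At most \<open>\<eta> * card U\<close> vertices of \<open>U\<close> have too few
  neighbours in \<open>W\<close>, since together they would form a large sparse box, and likewise
  for \<open>S\<close>. As \<open>\<eta> \<le> 1/4\<close>, half of \<open>U\<close> remains, and
  each vertex there has two large neighbourhoods with at least
  \<open>\<eta> ^ 3 * (card W * card S)\<close> edges between them.\<close>

lemma triangle_counting:
  fixes U W S :: "'v set" and \<eta> :: real
  assumes fin: "finite U" "finite W" "finite S" and ne: "U \<noteq> {}" "W \<noteq> {}" "S \<noteq> {}"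
    and \<eta>: "0 < \<eta>" "\<eta> \<le> 1/4"
    and d0: "\<And>A B. \<lbrakk>A \<subseteq> U; B \<subseteq> W; \<eta> * card U \<le> card A; \<eta> * card W \<le> card B\<rbrakk>
      \<Longrightarrow> \<eta> * (card A * card B) \<le> card (E0 \<inter> A \<times> B)"
    and d1: "\<And>A B. \<lbrakk>A \<subseteq> W; B \<subseteq> S; \<eta> * card W \<le> card A; \<eta> * card S \<le> card B\<rbrakk>
      \<Longrightarrow> \<eta> * (card A * card B) \<le> card (E1 \<inter> A \<times> B)"
    and d2: "\<And>A B. \<lbrakk>A \<subseteq> U; B \<subseteq> S; \<eta> * card U \<le> card A; \<eta> * card S \<le> card B\<rbrakk>
      \<Longrightarrow> \<eta> * (card A * card B) \<le> card (E2 \<inter> A \<times> B)"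
  shows "\<eta> ^ 3 / 2 * (card U * card W * card S)
    \<le> card {(x, y, z). x \<in> U \<and> y \<in> W \<and> z \<in> S \<and> (x, y) \<in> E0 \<and> (y, z) \<in> E1 \<and> (x, z) \<in> E2}"
proof -
  have bad: "card {u \<in> U. card (E `` {u} \<inter> R) < \<eta> * card R} \<le> \<eta> * card U" (is "real (card ?Bad) \<le> _")
    if R: "finite R" "R \<noteq> {}"
      and d: "\<And>A B. \<lbrakk>A \<subseteq> U; B \<subseteq> R; \<eta> * card U \<le> card A; \<eta> * card R \<le> card B\<rbrakk>
      \<Longrightarrow> \<eta> * (card A * card B) \<le> card (E \<inter> A \<times> B)" for E and R :: "'v set"
  proof (rule ccontr)
    assume "\<not> ?thesis"
    then have c: "\<eta> * card U < card ?Bad" by simp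
    have "0 < \<eta> * card U" using \<eta> ne fin by (simp add: card_gt_0_iff)
    with c have "0 < real (card ?Bad)" by linarith
    then have "?Bad \<noteq> {}" by force
    have "E \<inter> ?Bad \<times> R = Sigma ?Bad (\<lambda>u. E `` {u} \<inter> R)" by auto
    then have "card (E \<inter> ?Bad \<times> R) = (\<Sum>u\<in>?Bad. card (E `` {u} \<inter> R))"
      using fin R by simp
    also have "real \<dots> < (\<Sum>u\<in>?Bad. \<eta> * card R)"
      unfolding of_nat_sum by (rule sum_strict_mono) (use fin \<open>?Bad \<noteq> {}\<close> in auto)
    finally have "card (E \<inter> ?Bad \<times> R) < \<eta> * (card ?Bad * card R)" by (simp add: mult_ac)
    moreover have "\<eta> * card R \<le> card R" using \<eta> by (simp add: mult_left_le_one_le)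
    ultimately show False using d[of ?Bad R] c by auto
  qed
  define B0 where "B0 = {u \<in> U. card (E0 `` {u} \<inter> W) < \<eta> * card W}"
  define B2 where "B2 = {u \<in> U. card (E2 `` {u} \<inter> S) < \<eta> * card S}"
  define T where "T = {(x, y, z). x \<in> U \<and> y \<in> W \<and> z \<in> S \<and> (x, y) \<in> E0 \<and> (y, z) \<in> E1 \<and> (x, z) \<in> E2}"
  define t where "t x = E1 \<inter> (E0 `` {x} \<inter> W) \<times> (E2 `` {x} \<inter> S)" for x
  have fint: "finite (t x)" for x unfolding t_def using fin by auto
  have b: "card B0 \<le> \<eta> * card U" "card B2 \<le> \<eta> * card U"
    unfolding B0_def B2_def using bad[OF fin(2) ne(2) d0] bad[OF fin(3) ne(3) d2] by blast+
  have "card U - card B0 - card B2 \<le> card (U - (B0 \<union> B2))"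
    using diff_card_le_card_Diff[of "B0 \<union> B2" U] card_Un_le[of B0 B2] fin
    by (force simp: B0_def B2_def)
  then have "card U \<le> real (card (U - (B0 \<union> B2))) + card B0 + card B2" by linarith
  moreover have "\<eta> * card U \<le> 1/4 * card U" using \<eta> by (intro mult_right_mono) auto
  ultimately have good: "card U / 2 \<le> card (U - (B0 \<union> B2))" using b by linarith
  have each: "\<eta> ^ 3 * (card W * card S) \<le> card (t x)" if "x \<in> U - (B0 \<union> B2)" for x
  proof -
    have c: "\<eta> * card W \<le> card (E0 `` {x} \<inter> W)" "\<eta> * card S \<le> card (E2 `` {x} \<inter> S)"
      using that by (auto simp: B0_def B2_def)
    have "\<eta> * ((\<eta> * card W) * (\<eta> * card S)) \<le> \<eta> * (real (card (E0 `` {x} \<inter> W)) * card (E2 `` {x} \<inter> S))"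
      using c \<eta> by (intro mult_left_mono mult_mono) auto
    also have "\<dots> \<le> card (t x)" unfolding t_def using d1[OF _ _ c] by simp
    finally show ?thesis by (simp add: eval_nat_numeral mult_ac)
  qed
  have T: "T = Sigma U t" by (auto simp: T_def t_def)
  have "\<eta> ^ 3 / 2 * (card U * card W * card S) = (card U / 2) * (\<eta> ^ 3 * (card W * card S))" by simp
  also have "\<dots> \<le> card (U - (B0 \<union> B2)) * (\<eta> ^ 3 * (card W * card S))"
    using good \<eta> by (intro mult_right_mono) auto
  also have "\<dots> = (\<Sum>x\<in>U - (B0 \<union> B2). \<eta> ^ 3 * (card W * card S))" by simp
  also have "\<dots> \<le> (\<Sum>x\<in>U - (B0 \<union> B2). real (card (t x)))" by (rule sum_mono) (use each in auto)
  also have "\<dots> \<le> (\<Sum>x\<in>U. real (card (t x)))" by (rule sum_mono2) (use fin in auto)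
  also have "\<dots> = card T" unfolding T using fin fint by simp
  finally show ?thesis unfolding T_def .
qed

section \<open>Triangle removal from regularity and counting\<close>

definition triangle_removable :: "real \<Rightarrow> real \<Rightarrow> 'v set \<Rightarrow> bool" where
  "triangle_removable \<epsilon> \<delta> V \<longleftrightarrow> (\<forall>E0 E1 E2. E0 \<subseteq> V \<times> V \<longrightarrow> E1 \<subseteq> V \<times> V \<longrightarrow> E2 \<subseteq> V \<times> V \<longrightarrow>
     card {(x, y, z). (x, y) \<in> E0 \<and> (y, z) \<in> E1 \<and> (x, z) \<in> E2} \<le> \<delta> * real (card V ^ 3) \<longrightarrow>
     (\<exists>F0 F1 F2. F0 \<subseteq> E0 \<and> F1 \<subseteq> E1 \<and> F2 \<subseteq> E2 \<and> card F0 \<le> \<epsilon> * real ((card V)\<^sup>2) \<and>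
       card F1 \<le> \<epsilon> * real ((card V)\<^sup>2) \<and> card F2 \<le> \<epsilon> * real ((card V)\<^sup>2) \<and>
       (\<forall>x y z. (x, y) \<in> E0 \<longrightarrow> (y, z) \<in> E1 \<longrightarrow> (x, z) \<in> E2 \<longrightarrow>
          (x, y) \<in> F0 \<or> (y, z) \<in> F1 \<or> (x, z) \<in> F2)))"

text \<open>An edge is deleted if the density between its parts is below \<open>2 * \<eta>\<close>,
  if the pair of parts is irregular, or if an endpoint lies in a tiny part. A surviving triangle
  sits on three regular pairs whose large boxes all have density at least \<open>\<eta>\<close>, and
  counting there produces more triangles than were allowed.\<close>

theorem triangle_removal:
  fixes \<epsilon> :: real
  assumes "0 < \<epsilon>"
  obtains \<delta> where "0 < \<delta>" "\<And>V :: 'v set. finite V \<Longrightarrow> triangle_removable \<epsilon> \<delta> V"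
proof -
  \<comment> \<open>The three reasons for deletion cost \<open>2 * \<eta>\<close>,
    \<open>\<eta>\<close> and \<open>2 * \<eta>\<close> times \<open>(card V)\<^sup>2\<close>;
    \<open>1/4\<close> is what \<open>triangle_counting\<close> asks for.\<close>
  define \<eta> where "\<eta> = min (\<epsilon> / 5) (1/4)"
  have \<eta>: "0 < \<eta>" "\<eta> \<le> 1/4" "5 * \<eta> \<le> \<epsilon>" using assms by (auto simp: \<eta>_def)
  obtain M :: nat where M: "\<And>(V :: 'v set) E. finite V \<Longrightarrow>
      \<exists>F. finite F \<and> card F \<le> M \<and> (\<forall>i<3::nat. card (irregular \<eta> V F (E i)) \<le> \<eta> * (card V)\<^sup>2)"
    using regularity[OF \<eta>(1)] by metis
  \<comment> \<open>There are at most \<open>2 ^ M\<close> parts, so the tiny ones hold at most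
    \<open>\<eta> * card V\<close> vertices together.\<close>
  define \<gamma> where "\<gamma> = \<eta> / 2 ^ M"
  have \<gamma>: "0 < \<gamma>" using \<eta> by (simp add: \<gamma>_def)
  \<comment> \<open>Half of what \<open>triangle_counting\<close> yields for parts of size
    \<open>\<gamma> * card V\<close>, so that the contradiction is strict.\<close>
  define \<delta> where "\<delta> = \<eta> ^ 3 / 2 * \<gamma> ^ 3 / 2"
  have "0 < \<delta>" using \<eta> \<gamma> by (simp add: \<delta>_def)
  moreover have "\<exists>F0 F1 F2. F0 \<subseteq> E0 \<and> F1 \<subseteq> E1 \<and> F2 \<subseteq> E2 \<and> card F0 \<le> \<epsilon> * (card V)\<^sup>2 \<and>
       card F1 \<le> \<epsilon> * (card V)\<^sup>2 \<and> card F2 \<le> \<epsilon> * (card V)\<^sup>2 \<and>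
       (\<forall>x y z. (x, y) \<in> E0 \<longrightarrow> (y, z) \<in> E1 \<longrightarrow> (x, z) \<in> E2 \<longrightarrow>
          (x, y) \<in> F0 \<or> (y, z) \<in> F1 \<or> (x, z) \<in> F2)"
    if V: "finite V" and E: "E0 \<subseteq> V \<times> V" "E1 \<subseteq> V \<times> V" "E2 \<subseteq> V \<times> V"
      and few: "card {(x, y, z). (x, y) \<in> E0 \<and> (y, z) \<in> E1 \<and> (x, z) \<in> E2} \<le> \<delta> * card V ^ 3"
    for V :: "'v set" and E0 E1 E2
  proof -
    define EE where "EE i = (if i = 0 then E0 else if i = 1 then E1 else E2)" for i :: nat
    obtain F where F: "finite F" "card F \<le> M"
      and reg: "\<forall>i<3. card (irregular \<eta> V F (EE i)) \<le> \<eta> * (card V)\<^sup>2" using M[OF V] by blast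
    have EV: "EE i \<subseteq> V \<times> V" for i using E by (simp add: EE_def)
    define tiny where "tiny = {x \<in> V. card (atom V F x) < \<gamma> * card V}"
    define del where "del i = {w \<in> EE i. edge_density V F (EE i) w < 2 * \<eta>} \<union>
      (irregular \<eta> V F (EE i) \<inter> EE i) \<union> ((tiny \<times> V \<union> V \<times> tiny) \<inter> EE i)" for i
    have tinyc: "card tiny \<le> \<eta> * card V"
    proof -
      have ft: "finite tiny" using V by (simp add: tiny_def)
      have "real (card tiny) = (\<Sum>x\<in>tiny. 1)" by simp
      also have "\<dots> = (\<Sum>c\<in>atom_label F ` tiny. \<Sum>x | x \<in> tiny \<and> atom_label F x = c. 1)"
        by (rule sum.image_gen[OF ft])
      also have "\<dots> \<le> (\<Sum>c\<in>atom_label F ` tiny. \<gamma> * card V)"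
      proof (rule sum_mono)
        fix c assume "c \<in> atom_label F ` tiny"
        then obtain x where x: "x \<in> tiny" "c = atom_label F x" by auto
        have "card {u \<in> tiny. atom_label F u = c} \<le> card (atom V F x)"
          using V x by (intro card_mono) (auto simp: atom_def tiny_def)
        then show "(\<Sum>u | u \<in> tiny \<and> atom_label F u = c. 1) \<le> \<gamma> * card V"
          using x by (auto simp: tiny_def)
      qed
      also have "\<dots> = card (atom_label F ` tiny) * (\<gamma> * card V)" by simp
      also have "\<dots> \<le> 2 ^ M * (\<gamma> * card V)"
      proof (rule mult_right_mono)
        have "card (atom_label F ` tiny) \<le> 2 ^ card F" using atom_label_image[OF F(1)] by blast
        also have "\<dots> \<le> 2 ^ M" using F(2) by (intro power_increasing) auto
        finally show "real (card (atom_label F ` tiny)) \<le> 2 ^ M"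
          by (metis of_nat_le_iff of_nat_numeral of_nat_power)
      qed (use \<gamma> in auto)
      also have "\<dots> = \<eta> * card V" by (simp add: \<gamma>_def)
      finally show ?thesis .
    qed
    have delc: "card (del i) \<le> \<epsilon> * (card V)\<^sup>2" if "i < 3" for i
    proof -
      let ?d = "edge_density V F (EE i)"
      let ?L = "{w \<in> EE i. ?d w < 2 * \<eta>}"
      let ?h = "\<lambda>w. if ?d w < 2 * \<eta> then 1 else 0 :: real"
      have "real (card ?L) = (\<Sum>w\<in>V \<times> V. indicator ?L w)"
        using V EV[of i] by (intro card_eq_sum_indicator) auto
      also have "\<dots> = (\<Sum>w\<in>V \<times> V. indicator (EE i) w * ?h w)"
        by (rule sum.cong) (auto simp: indicator_def)
      \<comment> \<open>Low density is a property of the cell, so the indicator of the edges may be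
        replaced by its average, which is below \<open>2 * \<eta>\<close> wherever \<open>?h\<close>
        is nonzero.\<close>
      also have "\<dots> = (\<Sum>w\<in>V \<times> V. ?d w * ?h w)"
        unfolding edge_density_def by (rule sum_cond_avg[symmetric])
          (use V in \<open>auto simp: cond_avg_def\<close>)
      also have "\<dots> \<le> (\<Sum>w\<in>V \<times> V. 2 * \<eta>)" by (rule sum_mono) (use \<eta> in auto)
      also have "\<dots> = 2 * \<eta> * (card V)\<^sup>2" by (simp add: card_cartesian_product power2_eq_square)
      finally have L: "card ?L \<le> 2 * \<eta> * (card V)\<^sup>2" .
      have "card (irregular \<eta> V F (EE i) \<inter> EE i) \<le> card (irregular \<eta> V F (EE i))"
        using V by (intro card_mono) (auto simp: irregular_def intro: finite_subset[of _ "V \<times> V"])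
      then have I: "card (irregular \<eta> V F (EE i) \<inter> EE i) \<le> \<eta> * (card V)\<^sup>2"
        using reg that by force
      have "card ((tiny \<times> V \<union> V \<times> tiny) \<inter> EE i) \<le> card (tiny \<times> V \<union> V \<times> tiny)"
        using V by (intro card_mono) (auto simp: tiny_def)
      also have "\<dots> \<le> 2 * (card tiny * card V)"
        by (rule order_trans[OF card_Un_le]) (simp add: card_cartesian_product)
      finally have "card ((tiny \<times> V \<union> V \<times> tiny) \<inter> EE i) \<le> 2 * (real (card tiny) * card V)"
        by (metis of_nat_le_iff of_nat_mult of_nat_numeral)
      also have "\<dots> \<le> 2 * ((\<eta> * card V) * card V)"
        using tinyc by (intro mult_left_mono mult_right_mono) auto
      finally have T: "card ((tiny \<times> V \<union> V \<times> tiny) \<inter> EE i) \<le> 2 * \<eta> * (card V)\<^sup>2"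
        by (simp add: power2_eq_square)
      have "card (del i) \<le> card ?L + card (irregular \<eta> V F (EE i) \<inter> EE i)
          + card ((tiny \<times> V \<union> V \<times> tiny) \<inter> EE i)"
        unfolding del_def by (rule order_trans[OF card_Un_le]) (simp add: card_Un_le)
      then have "card (del i) \<le> 5 * \<eta> * (card V)\<^sup>2" using L I T by simp
      also have "\<dots> \<le> \<epsilon> * (card V)\<^sup>2" using \<eta> by (intro mult_right_mono) auto
      finally show ?thesis .
    qed
    have "(x, y) \<in> del 0 \<or> (y, z) \<in> del 1 \<or> (x, z) \<in> del 2"
      if t: "(x, y) \<in> E0" "(y, z) \<in> E1" "(x, z) \<in> E2" for x y z
    proof (rule ccontr)
      assume nd: "\<not> ?thesis"
      have xyz: "x \<in> V" "y \<in> V" "z \<in> V" using t E by auto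
      have dense: "\<eta> * (card A * card B) \<le> card (EE i \<inter> A \<times> B)"
        if uw: "(u, w) \<in> EE i" "(u, w) \<notin> del i" and s: "A \<subseteq> atom V F u" "B \<subseteq> atom V F w"
          "\<eta> * card (atom V F u) \<le> card A" "\<eta> * card (atom V F w) \<le> card B" for i u w A B
      proof -
        have d: "2 * \<eta> \<le> edge_density V F (EE i) (u, w)" and "(u, w) \<notin> irregular \<eta> V F (EE i)"
          using uw by (auto simp: del_def)
        then have "\<bar>card (EE i \<inter> A \<times> B) - edge_density V F (EE i) (u, w) * (card A * card B)\<bar>
          \<le> \<eta> * (card A * card B)"
          using s uw(1) EV[of i] by (intro regularD) auto
        moreover have "2 * \<eta> * (card A * card B) \<le> edge_density V F (EE i) (u, w) * (card A * card B)"
          using d by (intro mult_right_mono) auto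
        ultimately show ?thesis by linarith
      qed
      have large: "\<gamma> * card V \<le> card (atom V F u)" if "u \<in> {x, y, z}" for u
      proof -
        have "x \<notin> tiny" "y \<notin> tiny" "z \<notin> tiny"
          using nd t xyz by (auto simp: del_def EE_def)
        then show ?thesis using that xyz by (auto simp: tiny_def not_less)
      qed
      have self: "u \<in> V \<Longrightarrow> atom V F u \<noteq> {}" "finite (atom V F u)" for u
        using V by (auto simp: atom_def)
      let ?T = "{(x, y, z). (x, y) \<in> E0 \<and> (y, z) \<in> E1 \<and> (x, z) \<in> E2}"
      have finT: "finite ?T" by (rule finite_subset[of _ "V \<times> V \<times> V"]) (use E V in auto)
      have "\<eta> ^ 3 / 2 * (card (atom V F x) * card (atom V F y) * card (atom V F z))
        \<le> card {(x', y', z'). x' \<in> atom V F x \<and> y' \<in> atom V F y \<and> z' \<in> atom V F z \<and>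
            (x', y') \<in> E0 \<and> (y', z') \<in> E1 \<and> (x', z') \<in> E2}"
        using dense[of x y 0] dense[of y z 1] dense[of x z 2] t nd xyz
        by (intro triangle_counting self \<eta>) (simp_all add: EE_def)
      also have "\<dots> \<le> card ?T"
        unfolding of_nat_le_iff by (rule card_mono[OF finT]) auto
      also have "\<dots> \<le> \<delta> * card V ^ 3" by (rule few)
      finally have "\<eta> ^ 3 / 2 * (real (card (atom V F x)) * card (atom V F y) * card (atom V F z))
        \<le> \<delta> * card V ^ 3" by simp
      moreover have "\<eta> ^ 3 / 2 * ((\<gamma> * card V) * (\<gamma> * card V) * (\<gamma> * card V))
        \<le> \<eta> ^ 3 / 2 * (real (card (atom V F x)) * card (atom V F y) * card (atom V F z))"
        using large \<gamma> \<eta> by (intro mult_left_mono mult_mono) auto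
      moreover have "\<eta> ^ 3 / 2 * ((\<gamma> * card V) * (\<gamma> * card V) * (\<gamma> * card V)) = 2 * \<delta> * card V ^ 3"
        by (simp add: \<delta>_def eval_nat_numeral)
      moreover have "0 < \<delta> * card V ^ 3" using xyz V \<open>0 < \<delta>\<close>
        by (intro mult_pos_pos zero_less_power) (auto simp: card_gt_0_iff)
      ultimately show False by linarith
    qed
    moreover have "del 0 \<subseteq> E0" "del 1 \<subseteq> E1" "del 2 \<subseteq> E2" by (auto simp: del_def EE_def)
    ultimately show ?thesis using delc[of 0] delc[of 1] delc[of 2]
      by (intro exI[of _ "del 0"] exI[of _ "del 1"] exI[of _ "del 2"]) auto
  qed
  ultimately show ?thesis
    by (intro that[of \<delta>]) (simp_all add: triangle_removable_def)
qed

section \<open>Tricoloured sum-free sets\<close>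

text \<open>There is no type of residues modulo \<open>p\<close> for a variable \<open>p\<close>; linear algebra over the prime
  field is done with integers modulo \<open>p\<close>, and dimension arguments by the pigeonhole principle.\<close>

lemma modular_system_nontrivial_solution:
  fixes p :: nat and c :: "'r \<Rightarrow> 's \<Rightarrow> int"
  assumes p: "1 < p" and fin: "finite R" "finite S" and lt: "card R < card S"
  shows "\<exists>u. (\<exists>s\<in>S. \<not> int p dvd u s) \<and> (\<forall>r\<in>R. int p dvd (\<Sum>s\<in>S. c r s * u s))"
proof -
  let ?U = "S \<rightarrow>\<^sub>E {0..<int p}" and ?W = "R \<rightarrow>\<^sub>E {0..<int p}"
  define ev where "ev u = (\<lambda>r\<in>R. (\<Sum>s\<in>S. c r s * u s) mod int p)" for u
  have "ev ` ?U \<subseteq> ?W" using p by (auto simp: ev_def PiE_def)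
  then have "card (ev ` ?U) \<le> card ?W"
    using fin by (intro card_mono finite_PiE) auto
  also have "\<dots> < card ?U"
    using fin p lt by (simp add: card_funcsetE power_strict_increasing)
  finally have "\<not> inj_on ev ?U" by (rule pigeonhole)
  then obtain u v where uv: "u \<in> ?U" "v \<in> ?U" "u \<noteq> v" "ev u = ev v"
    by (auto simp: inj_on_def)
  show ?thesis
  proof (intro exI[of _ "\<lambda>s. u s - v s"] conjI ballI)
    obtain s where s: "s \<in> S" "u s \<noteq> v s"
      using uv(1-3) by (metis PiE_ext)
    then have "u s mod int p \<noteq> v s mod int p"
      using uv(1,2) by (auto simp: PiE_iff)
    then show "\<exists>s\<in>S. \<not> int p dvd u s - v s"
      using s(1) by (auto simp: mod_eq_dvd_iff)
    fix r assume r: "r \<in> R"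
    have "(\<Sum>s\<in>S. c r s * u s) mod int p = (\<Sum>s\<in>S. c r s * v s) mod int p"
      using fun_cong[OF uv(4), of r] r by (simp add: ev_def)
    then show "int p dvd (\<Sum>s\<in>S. c r s * (u s - v s))"
      by (simp add: mod_eq_dvd_iff right_diff_distrib sum_subtractf)
  qed
qed

text \<open>As long as the support of a solution is too small, the coordinates outside it outnumber
  the equations, so a nonzero solution lives there. Adding it keeps all old nonzero entries and
  creates a new one.\<close>

lemma modular_system_large_support:
  fixes p :: nat and c :: "'r \<Rightarrow> 's \<Rightarrow> int"
  assumes p: "1 < p" and fin: "finite R" "finite S" and k: "k + card R \<le> card S"
  shows "\<exists>u. k \<le> card {s \<in> S. \<not> int p dvd u s} \<and> (\<forall>r\<in>R. int p dvd (\<Sum>s\<in>S. c r s * u s))"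
  using k
proof (induction k)
  case 0
  then show ?case by (intro exI[of _ "\<lambda>_. 0"]) auto
next
  case (Suc k)
  then obtain u where u: "k \<le> card {s \<in> S. \<not> int p dvd u s}"
    "\<forall>r\<in>R. int p dvd (\<Sum>s\<in>S. c r s * u s)" by auto
  let ?T = "{s \<in> S. \<not> int p dvd u s}"
  show ?case
  proof (cases "Suc k \<le> card ?T")
    case True
    then show ?thesis using u by blast
  next
    case False
    have "card R < card (S - ?T)"
      using False Suc.prems fin by (subst card_Diff_subset) auto
    then obtain v where v: "\<exists>s\<in>S - ?T. \<not> int p dvd v s"
      "\<And>r. r \<in> R \<Longrightarrow> int p dvd (\<Sum>s\<in>S - ?T. c r s * v s)"
      using modular_system_nontrivial_solution[OF p, of R "S - ?T" c] fin by blast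
    define w where "w s = u s + (if s \<in> ?T then 0 else v s)" for s
    obtain s0 where s0: "s0 \<in> S" "s0 \<notin> ?T" "\<not> int p dvd v s0" using v(1) by blast
    have "insert s0 ?T \<subseteq> {s \<in> S. \<not> int p dvd w s}"
      using s0 by (auto simp: w_def dvd_add_right_iff)
    then have "card (insert s0 ?T) \<le> card {s \<in> S. \<not> int p dvd w s}"
      using fin by (intro card_mono) auto
    moreover have "card (insert s0 ?T) = Suc (card ?T)" using s0(2) fin by (intro card_insert_disjoint) auto
    ultimately have "Suc k \<le> card {s \<in> S. \<not> int p dvd w s}" using u(1) by linarith
    moreover have "int p dvd (\<Sum>s\<in>S. c r s * w s)" if "r \<in> R" for r
    proof -
      have "(\<Sum>s\<in>S. c r s * w s)
        = (\<Sum>s\<in>S. c r s * u s) + (\<Sum>s\<in>S. c r s * (if s \<in> ?T then 0 else v s))"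
        by (simp add: w_def distrib_left sum.distrib)
      also have "(\<Sum>s\<in>S. c r s * (if s \<in> ?T then 0 else v s)) = (\<Sum>s\<in>S - ?T. c r s * v s)"
        using fin by (intro sum.mono_neutral_cong_right) auto
      finally show ?thesis using u(2) v(2)[OF that] that by (simp add: dvd_add)
    qed
    ultimately show ?thesis by blast
  qed
qed

text \<open>The diagonal tensor has full slice rank. Summing the first index against a vector
  \<open>h\<close> that is orthogonal to every \<open>f1 r\<close> and has a large support
  \<open>T\<close> kills the slices of \<open>R1\<close>. What remains is the diagonal matrix with
  entries \<open>h k\<close>, of rank \<open>card T\<close> on \<open>T\<close>, written with only
  \<open>card R2 + card R3\<close> terms of rank one.\<close>

lemma slice_rank_diagonal:
  fixes p :: nat and f1 f2 f3 :: "'r \<Rightarrow> 's \<Rightarrow> int" and g1 g2 g3 :: "'r \<Rightarrow> 's \<Rightarrow> 's \<Rightarrow> int"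
  assumes p: "Factorial_Ring.prime p" and fin: "finite S" "finite R1" "finite R2" "finite R3"
    and dec: "\<And>i j k. \<lbrakk>i \<in> S; j \<in> S; k \<in> S\<rbrakk> \<Longrightarrow>
      [of_bool (i = j \<and> j = k) = (\<Sum>r\<in>R1. f1 r i * g1 r j k) + (\<Sum>r\<in>R2. f2 r j * g2 r i k)
        + (\<Sum>r\<in>R3. f3 r k * g3 r i j)] (mod int p)"
  shows "card S \<le> card R1 + card R2 + card R3"
proof (rule ccontr)
  assume big: "\<not> ?thesis"
  have p1: "1 < p" using p prime_gt_1_nat by blast
  have "(card S - card R1) + card R1 \<le> card S" using big by simp
  from modular_system_large_support[OF p1 fin(2,1) this, of f1]
  obtain h where h: "card S - card R1 \<le> card {s \<in> S. \<not> int p dvd h s}"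
    "\<And>r. r \<in> R1 \<Longrightarrow> int p dvd (\<Sum>i\<in>S. f1 r i * h i)" by blast
  define T where "T = {s \<in> S. \<not> int p dvd h s}"
  have finT: "finite T" using fin by (simp add: T_def)
  \<comment> \<open>After contraction with \<open>h\<close> every slice of \<open>R2\<close> or
    \<open>R3\<close> is a product of a function of \<open>j\<close> and a function of
    \<open>k\<close>; the rows of \<open>c\<close> are these functions of \<open>j\<close>. A common
    zero \<open>u\<close> of them satisfies \<open>h k * u k = 0\<close> modulo \<open>p\<close> for
    all \<open>k\<close> in \<open>T\<close>.\<close>
  define c where "c r j = (case r of Inl r \<Rightarrow> f2 r j | Inr r \<Rightarrow> (\<Sum>i\<in>S. h i * g3 r i j))" for r j
  have "card (R2 <+> R3) < card T"
    using big h(1) fin by (simp add: card_Plus T_def)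
  from modular_system_nontrivial_solution[OF p1 finite_Plus[OF fin(3,4)] finT this, of c]
  obtain u where u: "\<exists>s\<in>T. \<not> int p dvd u s"
    "\<And>r. r \<in> R2 <+> R3 \<Longrightarrow> int p dvd (\<Sum>s\<in>T. c r s * u s)" by blast
  have u2: "int p dvd (\<Sum>j\<in>T. f2 r j * u j)" if "r \<in> R2" for r
    using u(2)[of "Inl r"] that by (auto simp: c_def)
  have u3: "int p dvd (\<Sum>j\<in>T. (\<Sum>i\<in>S. h i * g3 r i j) * u j)" if "r \<in> R3" for r
    using u(2)[of "Inr r"] that by (auto simp: c_def)
  have "int p dvd u k" if k: "k \<in> T" for k
  proof -
    have kS: "k \<in> S" using k by (simp add: T_def)
    let ?A = "\<lambda>i j. \<Sum>r\<in>R1. f1 r i * g1 r j k" and ?B = "\<lambda>i j. \<Sum>r\<in>R2. f2 r j * g2 r i k"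
      and ?C = "\<lambda>i j. \<Sum>r\<in>R3. f3 r k * g3 r i j"
    have "[(\<Sum>j\<in>T. \<Sum>i\<in>S. h i * u j * of_bool (i = j \<and> j = k))
        = (\<Sum>j\<in>T. \<Sum>i\<in>S. h i * u j * (?A i j + ?B i j + ?C i j))] (mod int p)"
      using kS by (intro cong_sum cong_mult cong_refl dec) (auto simp: T_def)
    moreover have "(\<Sum>j\<in>T. \<Sum>i\<in>S. h i * u j * of_bool (i = j \<and> j = k)) = h k * u k"
    proof -
      have "(\<Sum>j\<in>T. \<Sum>i\<in>S. h i * u j * of_bool (i = j \<and> j = k))
        = (\<Sum>j\<in>T. \<Sum>i\<in>S. if i = j then (if j = k then h i * u j else 0) else 0)"
        by (intro sum.cong) auto
      also have "\<dots> = (\<Sum>j\<in>T. if j = k then h j * u j else 0)"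
        by (intro sum.cong) (auto simp: T_def fin)
      finally show ?thesis using k finT by simp
    qed
    moreover have "int p dvd (\<Sum>j\<in>T. \<Sum>i\<in>S. h i * u j * ?A i j)"
    proof -
      have "(\<Sum>j\<in>T. \<Sum>i\<in>S. h i * u j * ?A i j)
        = (\<Sum>j\<in>T. \<Sum>i\<in>S. \<Sum>r\<in>R1. u j * g1 r j k * (f1 r i * h i))"
        by (simp add: sum_distrib_left mult_ac)
      also have "\<dots> = (\<Sum>j\<in>T. \<Sum>r\<in>R1. u j * g1 r j k * (\<Sum>i\<in>S. f1 r i * h i))"
        by (subst sum.swap) (simp add: sum_distrib_left)
      finally show ?thesis by (simp only:) (intro dvd_sum dvd_mult h(2))
    qed
    moreover have "int p dvd (\<Sum>j\<in>T. \<Sum>i\<in>S. h i * u j * ?B i j)"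
    proof -
      have "(\<Sum>j\<in>T. \<Sum>i\<in>S. h i * u j * ?B i j)
        = (\<Sum>i\<in>S. \<Sum>j\<in>T. \<Sum>r\<in>R2. h i * g2 r i k * (f2 r j * u j))"
        by (subst sum.swap) (simp add: sum_distrib_left mult_ac)
      also have "\<dots> = (\<Sum>i\<in>S. \<Sum>r\<in>R2. h i * g2 r i k * (\<Sum>j\<in>T. f2 r j * u j))"
        by (subst sum.swap) (simp add: sum_distrib_left)
      finally show ?thesis by (simp only:) (intro dvd_sum dvd_mult u2)
    qed
    moreover have "int p dvd (\<Sum>j\<in>T. \<Sum>i\<in>S. h i * u j * ?C i j)"
    proof -
      have "(\<Sum>j\<in>T. \<Sum>i\<in>S. h i * u j * ?C i j)
        = (\<Sum>j\<in>T. \<Sum>i\<in>S. \<Sum>r\<in>R3. f3 r k * (h i * g3 r i j * u j))"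
        by (simp add: sum_distrib_left mult_ac)
      also have "\<dots> = (\<Sum>j\<in>T. \<Sum>r\<in>R3. f3 r k * ((\<Sum>i\<in>S. h i * g3 r i j) * u j))"
        by (subst sum.swap) (simp add: sum_distrib_left sum_distrib_right)
      also have "\<dots> = (\<Sum>r\<in>R3. f3 r k * (\<Sum>j\<in>T. (\<Sum>i\<in>S. h i * g3 r i j) * u j))"
        by (subst sum.swap) (simp add: sum_distrib_left)
      finally show ?thesis by (simp only:) (intro dvd_sum dvd_mult u3)
    qed
    ultimately have "int p dvd h k * u k"
      by (simp add: distrib_left sum.distrib cong_dvd_iff dvd_add)
    moreover have "Factorial_Ring.prime (int p)" using p by simp
    ultimately show ?thesis using k by (simp add: T_def prime_dvd_mult_iff)
  qed
  then show False using u(1) by blast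
qed

section \<open>Monomials of low degree and the slice rank bound\<close>

definition low_degree :: "nat \<Rightarrow> nat \<Rightarrow> (nat \<Rightarrow> nat) set" where
  "low_degree d n = {\<alpha> \<in> {..<n} \<rightarrow>\<^sub>E {..d}. 3 * (\<Sum>l<n. \<alpha> l) \<le> n * d}"

lemma finite_low_degree: "finite (low_degree d n)"
  by (simp add: low_degree_def finite_PiE)

text \<open>The set consists of the exponent vectors of degree at most a third of the maximum
  \<open>n * d\<close>. They are exponentially rare among all \<open>(d + 1) ^ n\<close> by a
  Chernoff bound: weighting \<open>\<alpha>\<close> by \<open>s\<close> to three times its degree,
  with \<open>s < 1\<close>, bounds their number by the \<open>n\<close>-th power of the quotient of
  \<open>\<Sum>j\<le>d. s ^ (3 * j)\<close> by \<open>s ^ d\<close>.\<close>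

lemma low_degree_bound:
  assumes d: "0 < d"
  obtains \<rho> :: real where "0 < \<rho>" "\<rho> < d + 1" "\<And>n. card (low_degree d n) \<le> \<rho> ^ n"
proof -
  \<comment> \<open>\<open>g\<close> is negative exactly where that quotient is below
    \<open>d + 1\<close>, for positive \<open>s\<close>. It vanishes at 1, and its derivative there
    is \<open>3 * d * (d + 1) / 2 - d * (d + 1) > 0\<close>, because the average exponent
    \<open>d / 2\<close> exceeds \<open>d / 3\<close>; so some \<open>s\<close> slightly below 1
    works.\<close>
  define g where "g s = (\<Sum>j\<le>d. s ^ (3 * j)) - (d + 1) * s ^ d" for s :: real
  have "(g has_real_derivative (\<Sum>j\<le>d. real (3 * j) * 1 ^ (3 * j - 1)) - (d + 1) * (real d * 1 ^ (d - 1))) (at 1)"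
    unfolding g_def by (auto intro!: derivative_eq_intros simp: mult_ac)
  moreover have "(\<Sum>j\<le>d. real (3 * j)) = 3 * (d * (d + 1) / 2)"
    by (induction d) (auto simp: field_simps)
  then have "(\<Sum>j\<le>d. real (3 * j) * 1 ^ (3 * j - 1)) - (d + 1) * (real d * 1 ^ (d - 1)) = d * (d + 1) / 2"
    by (simp add: field_simps)
  ultimately have "DERIV g 1 :> d * (d + 1) / 2" by (simp only:)
  moreover have "0 < real (d * (d + 1)) / 2" using d by (simp add: add_pos_pos)
  ultimately have "\<exists>e>0. \<forall>h>0. h < e \<longrightarrow> g (1 - h) < g 1" by (rule DERIV_pos_inc_left)
  then obtain e where e: "0 < e" "\<And>h. \<lbrakk>0 < h; h < e\<rbrakk> \<Longrightarrow> g (1 - h) < g 1"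
    by auto
  define s where "s = 1 - min (e / 2) (1/2)"
  have s: "0 < s" "s < 1" using e(1) by (auto simp: s_def)
  have "g s < g 1" unfolding s_def using e by (intro e(2)) auto
  also have "g 1 = 0" by (simp add: g_def)
  finally have gs: "(\<Sum>j\<le>d. s ^ (3 * j)) < (d + 1) * s ^ d" by (simp add: g_def)
  define \<rho> where "\<rho> = (\<Sum>j\<le>d. s ^ (3 * j)) / s ^ d"
  have "0 < (\<Sum>j\<le>d. s ^ (3 * j))" using s by (intro sum_pos) auto
  then have "0 < \<rho>" using s by (simp add: \<rho>_def)
  moreover have "\<rho> < d + 1" using gs s by (simp add: \<rho>_def divide_less_eq)
  moreover have "card (low_degree d n) \<le> \<rho> ^ n" for n
  proof -
    have "card (low_degree d n) * s ^ (n * d) = (\<Sum>\<alpha>\<in>low_degree d n. s ^ (n * d))" by simp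
    also have "\<dots> \<le> (\<Sum>\<alpha>\<in>low_degree d n. \<Prod>l<n. s ^ (3 * \<alpha> l))"
    proof (rule sum_mono)
      fix \<alpha> assume "\<alpha> \<in> low_degree d n"
      then have "s ^ (n * d) \<le> s ^ (3 * (\<Sum>l<n. \<alpha> l))"
        using s by (intro power_decreasing) (auto simp: low_degree_def)
      then show "s ^ (n * d) \<le> (\<Prod>l<n. s ^ (3 * \<alpha> l))"
        by (simp add: power_sum[symmetric] sum_distrib_left)
    qed
    also have "\<dots> \<le> (\<Sum>\<alpha>\<in>{..<n} \<rightarrow>\<^sub>E {..d}. \<Prod>l<n. s ^ (3 * \<alpha> l))"
    proof (rule sum_mono2)
      show "0 \<le> (\<Prod>l<n. s ^ (3 * \<alpha> l))" for \<alpha> using s by (intro prod_nonneg) auto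
    qed (simp_all add: low_degree_def finite_PiE)
    also have "\<dots> = (\<Prod>l<n. \<Sum>j\<le>d. s ^ (3 * j))"
      by (rule prod_sum_PiE[symmetric]) auto
    also have "\<dots> = (\<Sum>j\<le>d. s ^ (3 * j)) ^ n" by simp
    finally show ?thesis using s by (simp add: \<rho>_def power_divide le_divide_eq power_mult[symmetric] mult.commute)
  qed
  ultimately show ?thesis by (intro that[of \<rho>]) simp_all
qed

lemma trinomial_expansion:
  obtains \<kappa> :: "nat \<times> nat \<times> nat \<Rightarrow> int" where
    "\<And>x y z :: int. 1 - (x + y - z) ^ d
      = (\<Sum>(a, b, c) | a + b + c \<le> d. \<kappa> (a, b, c) * (x ^ a * (y ^ b * z ^ c)))"
proof
  let ?Q = "{(a, b, c). a + b + c \<le> d}"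
  define \<kappa> :: "nat \<times> nat \<times> nat \<Rightarrow> int" where "\<kappa> = (\<lambda>(a, b, c). of_bool ((a, b, c) = (0, 0, 0))
    - (if a + b + c = d then int (d choose a) * int ((d - a) choose b) * (-1) ^ c else 0))"
  fix x y z :: int
  have finQ: "finite ?Q"
    by (rule finite_subset[of _ "{..d} \<times> {..d} \<times> {..d}"]) auto
  have "(x + y - z) ^ d = (x + (y + - z)) ^ d" by (simp only: diff_conv_add_uminus add.assoc)
  also have "\<dots> = (\<Sum>a\<le>d. int (d choose a) * x ^ a * (y + - z) ^ (d - a))"
    by (subst binomial_ring) simp
  also have "\<dots> = (\<Sum>a\<le>d. \<Sum>b\<le>d - a. int (d choose a) * int ((d - a) choose b) * (-1) ^ (d - a - b)
      * (x ^ a * (y ^ b * z ^ (d - a - b))))"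
    by (subst binomial_ring) (simp add: sum_distrib_left power_minus[of z] mult_ac)
  also have "\<dots> = (\<Sum>(a, b)\<in>Sigma {..d} (\<lambda>a. {..d - a}). int (d choose a) * int ((d - a) choose b)
      * (-1) ^ (d - a - b) * (x ^ a * (y ^ b * z ^ (d - a - b))))"
    by (rule sum.Sigma) auto
  also have "\<dots> = (\<Sum>(a, b, c) | a + b + c = d. int (d choose a) * int ((d - a) choose b)
      * (-1) ^ c * (x ^ a * (y ^ b * z ^ c)))"
    by (rule sum.reindex_bij_witness[of _ "\<lambda>(a, b, c). (a, b)" "\<lambda>(a, b). (a, b, d - a - b)"]) auto
  also have "\<dots> = (\<Sum>(a, b, c)\<in>?Q. (if a + b + c = d then int (d choose a) * int ((d - a) choose b)
      * (-1) ^ c else 0) * (x ^ a * (y ^ b * z ^ c)))"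
    using finQ by (intro sum.mono_neutral_cong_left) (auto split: if_splits)
  finally have 1: "(x + y - z) ^ d = \<dots>" .
  have "(\<Sum>(a, b, c)\<in>?Q. of_bool ((a, b, c) = (0, 0, 0)) * (x ^ a * (y ^ b * z ^ c)))
      = (\<Sum>t\<in>?Q. if t = (0, 0, 0) then 1 else 0)"
    by (intro sum.cong) auto
  also have "\<dots> = 1" using finQ by simp
  finally have 2: "1 = (\<Sum>(a, b, c)\<in>?Q. of_bool ((a, b, c) = (0, 0, 0)) * (x ^ a * (y ^ b * z ^ c)))" ..
  show "1 - (x + y - z) ^ d = (\<Sum>(a, b, c)\<in>?Q. \<kappa> (a, b, c) * (x ^ a * (y ^ b * z ^ c)))"
    by (subst 1, subst 2, unfold sum_subtractf[symmetric])
      (auto intro!: sum.cong simp: \<kappa>_def left_diff_distrib)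
qed

lemma fermat_theorem_int:
  fixes p :: nat and a :: int
  assumes p: "Factorial_Ring.prime p" and a: "\<not> int p dvd a"
  shows "[a ^ (p - 1) = 1] (mod int p)"
proof -
  define b where "b = nat (a mod int p)"
  have "0 < p" using p prime_gt_0_nat by blast
  then have b: "int b = a mod int p" by (simp add: b_def)
  then have "[int b = a] (mod int p)" by (simp add: cong_def)
  moreover from this have "\<not> p dvd b"
    using a by (metis cong_dvd_iff cong_sym int_dvd_int_iff)
  then have "[b ^ (p - 1) = 1] (mod p)" by (rule fermat_theorem[OF p])
  then have "[int b ^ (p - 1) = 1] (mod int p)"
    using cong_int_iff[of "b ^ (p - 1)" 1 p] by simp
  ultimately show ?thesis by (meson cong_pow cong_sym cong_trans)
qed

text \<open>By Fermat's theorem the product over \<open>l\<close> of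
  \<open>1 - (x i l + y j l - z k l) ^ (p - 1)\<close> is the indicator of a solution, here the
  diagonal tensor. In each monomial the degrees in the three groups of variables add up to at most
  \<open>n * (p - 1)\<close>, so one of them is at most a third of this. Collecting monomials by
  their first such factor gives three families of slices, each indexed by
  \<open>low_degree (p - 1) n\<close>.\<close>

theorem tricolored_sum_free_bound:
  fixes p :: nat and x y z :: "'s \<Rightarrow> nat \<Rightarrow> int"
  assumes p: "Factorial_Ring.prime p" and S: "finite S"
    and sf: "\<And>i j k. \<lbrakk>i \<in> S; j \<in> S; k \<in> S\<rbrakk> \<Longrightarrow>
      (\<forall>l<n. [x i l + y j l = z k l] (mod int p)) \<longleftrightarrow> i = j \<and> j = k"
  shows "card S \<le> 3 * card (low_degree (p - 1) n)"
proof -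
  define d where "d = p - 1"
  have d: "0 < d" using prime_gt_1_nat[OF p] by (simp add: d_def)
  obtain \<kappa> :: "nat \<times> nat \<times> nat \<Rightarrow> int" where \<kappa>: "\<And>x y z :: int. 1 - (x + y - z) ^ d
      = (\<Sum>(a, b, c) | a + b + c \<le> d. \<kappa> (a, b, c) * (x ^ a * (y ^ b * z ^ c)))"
    using trinomial_expansion[of d] by blast
  define Q where "Q = {(a, b, c). a + b + c \<le> d}"
  have finQ: "finite Q"
    unfolding Q_def by (rule finite_subset[of _ "{..d} \<times> {..d} \<times> {..d}"]) auto
  \<comment> \<open>One exponent triple per coordinate selects one monomial of the expanded product;
    \<open>A \<tau>\<close>, \<open>B \<tau>\<close>, \<open>C \<tau>\<close> are its exponent
    vectors in the three groups of variables.\<close>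
  define \<Theta> where "\<Theta> = {..<n} \<rightarrow>\<^sub>E Q"
  have fin\<Theta>: "finite \<Theta>" using finQ by (simp add: \<Theta>_def finite_PiE)
  define A B C where "A \<tau> = (\<lambda>l\<in>{..<n}. fst (\<tau> l))" and "B \<tau> = (\<lambda>l\<in>{..<n}. fst (snd (\<tau> l)))"
    and "C \<tau> = (\<lambda>l\<in>{..<n}. snd (snd (\<tau> l)))" for \<tau> :: "nat \<Rightarrow> nat \<times> nat \<times> nat"
  define m where "m v \<alpha> = (\<Prod>l<n. v l ^ \<alpha> l)" for v :: "nat \<Rightarrow> int" and \<alpha> :: "nat \<Rightarrow> nat"
  define K where "K \<tau> = (\<Prod>l<n. \<kappa> (\<tau> l))" for \<tau>
  let ?L = "low_degree d n"
  define \<Theta>1 where "\<Theta>1 = {\<tau> \<in> \<Theta>. A \<tau> \<in> ?L}"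
  define \<Theta>2 where "\<Theta>2 = {\<tau> \<in> \<Theta>. A \<tau> \<notin> ?L \<and> B \<tau> \<in> ?L}"
  define \<Theta>3 where "\<Theta>3 = {\<tau> \<in> \<Theta>. A \<tau> \<notin> ?L \<and> B \<tau> \<notin> ?L}"
  have \<Theta>: "\<Theta> = \<Theta>1 \<union> (\<Theta>2 \<union> \<Theta>3)" "\<Theta>1 \<inter> (\<Theta>2 \<union> \<Theta>3) = {}" "\<Theta>2 \<inter> \<Theta>3 = {}"
    by (auto simp: \<Theta>1_def \<Theta>2_def \<Theta>3_def)
  have fin: "finite \<Theta>1" "finite \<Theta>2" "finite \<Theta>3"
    using fin\<Theta> by (auto simp: \<Theta>1_def \<Theta>2_def \<Theta>3_def)
  have \<Theta>3C: "C \<tau> \<in> ?L" if "\<tau> \<in> \<Theta>3" for \<tau>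
  proof -
    have \<tau>: "\<tau> l \<in> Q" if "l < n" for l using \<open>\<tau> \<in> \<Theta>3\<close> that by (auto simp: \<Theta>3_def \<Theta>_def)
    have 1: "fst (\<tau> l) + fst (snd (\<tau> l)) + snd (snd (\<tau> l)) \<le> d" if "l < n" for l
      using \<tau>[OF that] by (auto simp: Q_def)
    have "fst (\<tau> l) \<le> d" "fst (snd (\<tau> l)) \<le> d" "snd (snd (\<tau> l)) \<le> d" if "l < n" for l
      using 1[OF that] by linarith+
    then have "A \<tau> \<in> {..<n} \<rightarrow>\<^sub>E {..d}" "B \<tau> \<in> {..<n} \<rightarrow>\<^sub>E {..d}" "C \<tau> \<in> {..<n} \<rightarrow>\<^sub>E {..d}"
      by (auto simp: A_def B_def C_def)
    moreover have "(\<Sum>l<n. A \<tau> l) + (\<Sum>l<n. B \<tau> l) + (\<Sum>l<n. C \<tau> l) \<le> (\<Sum>l<n. d)"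
      unfolding sum.distrib[symmetric] by (rule sum_mono) (use 1 in \<open>auto simp: A_def B_def C_def\<close>)
    ultimately show ?thesis using that by (auto simp: \<Theta>3_def low_degree_def)
  qed
  have dec: "[of_bool (i = j \<and> j = k)
      = (\<Sum>\<alpha>\<in>?L. m (x i) \<alpha> * (\<Sum>\<tau> | \<tau> \<in> \<Theta>1 \<and> A \<tau> = \<alpha>. K \<tau> * m (y j) (B \<tau>) * m (z k) (C \<tau>)))
      + (\<Sum>\<alpha>\<in>?L. m (y j) \<alpha> * (\<Sum>\<tau> | \<tau> \<in> \<Theta>2 \<and> B \<tau> = \<alpha>. K \<tau> * m (x i) (A \<tau>) * m (z k) (C \<tau>)))
      + (\<Sum>\<alpha>\<in>?L. m (z k) \<alpha> * (\<Sum>\<tau> | \<tau> \<in> \<Theta>3 \<and> C \<tau> = \<alpha>. K \<tau> * m (x i) (A \<tau>) * m (y j) (B \<tau>)))]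
      (mod int p)" if ijk: "i \<in> S" "j \<in> S" "k \<in> S" for i j k
  proof -
    let ?t = "\<lambda>\<tau>. K \<tau> * (m (x i) (A \<tau>) * (m (y j) (B \<tau>) * m (z k) (C \<tau>)))"
    have factor: "[of_bool ([x i l + y j l = z k l] (mod int p)) = 1 - (x i l + y j l - z k l) ^ d] (mod int p)" for l
    proof (cases "[x i l + y j l = z k l] (mod int p)")
      case True
      then have "int p dvd (x i l + y j l - z k l) ^ d"
        using d by (meson cong_iff_dvd_diff dvd_power dvd_trans)
      then show ?thesis using True by (simp add: cong_iff_dvd_diff)
    next
      case False
      then have "\<not> int p dvd (x i l + y j l - z k l)" by (simp add: cong_iff_dvd_diff)
      then have "[(x i l + y j l - z k l) ^ d = 1] (mod int p)"
        using fermat_theorem_int p unfolding d_def by blast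
      then show ?thesis using False by (simp add: cong_iff_dvd_diff dvd_diff_commute)
    qed
    have "of_bool (i = j \<and> j = k) = (\<Prod>l<n. of_bool ([x i l + y j l = z k l] (mod int p)) :: int)"
      unfolding sf[OF ijk, symmetric] by (auto simp: prod_zero_iff)
    also have "[\<dots> = (\<Prod>l<n. 1 - (x i l + y j l - z k l) ^ d)] (mod int p)"
      by (intro cong_prod factor)
    also have "(\<Prod>l<n. 1 - (x i l + y j l - z k l) ^ d)
      = (\<Prod>l<n. \<Sum>(a, b, c)\<in>Q. \<kappa> (a, b, c) * (x i l ^ a * (y j l ^ b * z k l ^ c)))"
      by (simp only: \<kappa> Q_def)
    also have "\<dots> = (\<Sum>\<tau>\<in>\<Theta>. \<Prod>l<n. case \<tau> l of (a, b, c) \<Rightarrow> \<kappa> (a, b, c) * (x i l ^ a * (y j l ^ b * z k l ^ c)))"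
      unfolding \<Theta>_def by (rule prod_sum_PiE) (auto simp: finQ)
    also have "\<dots> = (\<Sum>\<tau>\<in>\<Theta>. ?t \<tau>)"
      by (rule sum.cong) (auto simp: K_def m_def A_def B_def C_def prod.distrib[symmetric] split_beta
          intro!: prod.cong)
    also have "\<dots> = (\<Sum>\<tau>\<in>\<Theta>1. ?t \<tau>)
      + (\<Sum>\<tau>\<in>\<Theta>2. ?t \<tau>)
      + (\<Sum>\<tau>\<in>\<Theta>3. ?t \<tau>)"
      using fin \<Theta> by (simp add: sum.union_disjoint add.assoc)
    also have "(\<Sum>\<tau>\<in>\<Theta>1. ?t \<tau>)
      = (\<Sum>\<alpha>\<in>?L. m (x i) \<alpha> * (\<Sum>\<tau> | \<tau> \<in> \<Theta>1 \<and> A \<tau> = \<alpha>. K \<tau> * m (y j) (B \<tau>) * m (z k) (C \<tau>)))"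
      by (subst sum.group[OF fin(1) finite_low_degree[of d n], of A, symmetric])
        (auto simp: \<Theta>1_def sum_distrib_left mult_ac intro!: sum.cong)
    also have "(\<Sum>\<tau>\<in>\<Theta>2. ?t \<tau>)
      = (\<Sum>\<alpha>\<in>?L. m (y j) \<alpha> * (\<Sum>\<tau> | \<tau> \<in> \<Theta>2 \<and> B \<tau> = \<alpha>. K \<tau> * m (x i) (A \<tau>) * m (z k) (C \<tau>)))"
      by (subst sum.group[OF fin(2) finite_low_degree[of d n], of B, symmetric])
        (auto simp: \<Theta>2_def sum_distrib_left mult_ac intro!: sum.cong)
    also have "(\<Sum>\<tau>\<in>\<Theta>3. ?t \<tau>)
      = (\<Sum>\<alpha>\<in>?L. m (z k) \<alpha> * (\<Sum>\<tau> | \<tau> \<in> \<Theta>3 \<and> C \<tau> = \<alpha>. K \<tau> * m (x i) (A \<tau>) * m (y j) (B \<tau>)))"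
      by (subst sum.group[OF fin(3) finite_low_degree[of d n], of C, symmetric])
        (auto simp: \<Theta>3C sum_distrib_left mult_ac intro!: sum.cong)
    finally show ?thesis .
  qed
  have "card S \<le> card ?L + card ?L + card ?L"
    by (rule slice_rank_diagonal[OF p S finite_low_degree finite_low_degree finite_low_degree dec])
  then show ?thesis by (simp add: d_def)
qed

section \<open>Hitting sets for the solutions of x + y = z modulo p\<close>

text \<open>If the linear part of \<open>v\<close> vanishes modulo \<open>p\<close>, then
  \<open>v n\<close> does not and no \<open>\<nu>\<close> qualifies; otherwise one coordinate of
  \<open>\<nu>\<close> is determined by the others. The factor \<open>p\<close> on the left avoids
  the exponent \<open>n - 1\<close>.\<close>

lemma card_affine_hyperplane:
  fixes p :: nat and v :: "nat \<Rightarrow> int"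
  assumes p: "Factorial_Ring.prime p" and v: "\<exists>l\<le>n. \<not> int p dvd v l"
  shows "p * card {\<nu> \<in> {..<n} \<rightarrow>\<^sub>E {0..<int p}. int p dvd (\<Sum>l<n. \<nu> l * v l) + v n} \<le> p ^ n"
    (is "p * card ?H \<le> _")
proof (cases "\<exists>l<n. \<not> int p dvd v l")
  case False
  have "\<not> int p dvd (\<Sum>l<n. \<nu> l * v l) + v n" for \<nu>
  proof -
    have "int p dvd (\<Sum>l<n. \<nu> l * v l)" using False by (intro dvd_sum) auto
    moreover have "\<not> int p dvd v n" using v False by (metis le_neq_implies_less)
    ultimately show ?thesis by (simp add: dvd_add_right_iff)
  qed
  then have "?H = {}" by blast
  then show ?thesis by (metis card.empty mult_0_right le0)
next
  case True
  then obtain k where k: "k < n" "\<not> int p dvd v k" by blast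
  let ?J = "{..<n} - {k}"
  have "inj_on (\<lambda>\<nu>. restrict \<nu> ?J) ?H"
  proof (rule inj_onI)
    fix \<nu> \<mu> assume \<nu>: "\<nu> \<in> ?H" and \<mu>: "\<mu> \<in> ?H" and eq: "restrict \<nu> ?J = restrict \<mu> ?J"
    have off: "\<nu> l = \<mu> l" if "l \<in> ?J" for l
      using fun_cong[OF eq, of l] that by (metis restrict_apply')
    have "int p dvd ((\<Sum>l<n. \<nu> l * v l) + v n) - ((\<Sum>l<n. \<mu> l * v l) + v n)"
      using \<nu> \<mu> by (blast intro: dvd_diff)
    also have "\<dots> = (\<Sum>l<n. (\<nu> l - \<mu> l) * v l)"
      by (simp add: sum_subtractf left_diff_distrib)
    also have "\<dots> = (\<nu> k - \<mu> k) * v k + (\<Sum>l\<in>?J. (\<nu> l - \<mu> l) * v l)"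
      using k by (simp add: sum.remove)
    also have "(\<Sum>l\<in>?J. (\<nu> l - \<mu> l) * v l) = 0" using off by (intro sum.neutral) auto
    finally have "int p dvd (\<nu> k - \<mu> k) * v k" by simp
    moreover have "Factorial_Ring.prime (int p)" using p by simp
    ultimately have "int p dvd \<nu> k - \<mu> k" using k(2) prime_dvd_mult_iff by blast
    then have "\<nu> k mod int p = \<mu> k mod int p" by (simp add: mod_eq_dvd_iff)
    moreover have PiE: "\<nu> \<in> {..<n} \<rightarrow>\<^sub>E {0..<int p}" "\<mu> \<in> {..<n} \<rightarrow>\<^sub>E {0..<int p}"
      using \<nu> \<mu> by blast+
    moreover have "\<nu> k \<in> {0..<int p}" "\<mu> k \<in> {0..<int p}"
      using PiE_mem[OF PiE(1)] PiE_mem[OF PiE(2)] k(1) by blast+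
    ultimately have "\<nu> k = \<mu> k" by simp
    with off have "\<nu> l = \<mu> l" if "l \<in> {..<n}" for l using that by (cases "l = k") auto
    then show "\<nu> = \<mu>" by (rule PiE_ext[OF PiE])
  qed
  moreover have "(\<lambda>\<nu>. restrict \<nu> ?J) ` ?H \<subseteq> ?J \<rightarrow>\<^sub>E {0..<int p}"
  proof (rule image_subsetI)
    fix \<nu> assume "\<nu> \<in> ?H"
    then have "\<nu> \<in> {..<n} \<rightarrow>\<^sub>E {0..<int p}" by blast
    then show "restrict \<nu> ?J \<in> ?J \<rightarrow>\<^sub>E {0..<int p}" by (simp add: PiE_iff)
  qed
  ultimately have "card ?H \<le> card (?J \<rightarrow>\<^sub>E {0..<int p})"
    by (rule card_inj_on_le) (simp add: finite_PiE)
  also have "\<dots> = p ^ (n - 1)" using k(1) by (simp add: card_funcsetE)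
  finally have "p * card ?H \<le> p * p ^ (n - 1)" by (rule mult_left_mono) simp
  also have "\<dots> = p ^ n" using k(1) by (cases n) auto
  finally show ?thesis .
qed

definition linked :: "('a \<times> 'b \<times> 'c) set \<Rightarrow> (('a \<times> 'b \<times> 'c) \<times> ('a \<times> 'b \<times> 'c)) set" where
  "linked T = {(s, t) \<in> T \<times> T. s \<noteq> t \<and>
     (fst s = fst t \<or> fst (snd s) = fst (snd t) \<or> snd (snd s) = snd (snd t))}"

lemma finite_linked: "finite T \<Longrightarrow> finite (linked T)"
  by (rule finite_subset[of _ "T \<times> T"]) (auto simp: linked_def)

text \<open>Elements stay abstract and carry vectors through \<open>f\<close>, \<open>g\<close>,
  \<open>h\<close>, while the dimension is a parameter of \<open>sols\<close> and
  \<open>separated\<close>. Passing to a hyperplane can then forget the last coordinate without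
  replacing the elements.\<close>

locale labelled_vectors =
  fixes p :: nat and f :: "'a \<Rightarrow> nat \<Rightarrow> int" and g :: "'b \<Rightarrow> nat \<Rightarrow> int" and h :: "'c \<Rightarrow> nat \<Rightarrow> int"
  assumes prime_p: "Factorial_Ring.prime p"
begin

definition sols :: "nat \<Rightarrow> 'a set \<Rightarrow> 'b set \<Rightarrow> 'c set \<Rightarrow> ('a \<times> 'b \<times> 'c) set" where
  "sols n X Y Z = {(x, y, z). x \<in> X \<and> y \<in> Y \<and> z \<in> Z \<and> (\<forall>l<n. [f x l + g y l = h z l] (mod int p))}"

definition separated :: "nat \<Rightarrow> 'a set \<Rightarrow> 'b set \<Rightarrow> 'c set \<Rightarrow> bool" where
  "separated n X Y Z \<longleftrightarrow>
     (\<forall>x\<in>X. \<forall>x'\<in>X. (\<forall>l<n. [f x l = f x' l] (mod int p)) \<longrightarrow> x = x') \<and>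
     (\<forall>y\<in>Y. \<forall>y'\<in>Y. (\<forall>l<n. [g y l = g y' l] (mod int p)) \<longrightarrow> y = y') \<and>
     (\<forall>z\<in>Z. \<forall>z'\<in>Z. (\<forall>l<n. [h z l = h z' l] (mod int p)) \<longrightarrow> z = z')"

lemma p_pos: "0 < p"
  using prime_p prime_gt_0_nat by blast

lemma separated_subset:
  "\<lbrakk>separated n X Y Z; X' \<subseteq> X; Y' \<subseteq> Y; Z' \<subseteq> Z\<rbrakk> \<Longrightarrow> separated n X' Y' Z'"
  unfolding separated_def by blast

lemma finite_sols: "\<lbrakk>finite X; finite Y; finite Z\<rbrakk> \<Longrightarrow> finite (sols n X Y Z)"
  by (rule finite_subset[of _ "X \<times> Y \<times> Z"]) (auto simp: sols_def)

lemma sols_unique: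
  assumes sep: "separated n X Y Z" and t: "(x, y, z) \<in> sols n X Y Z" "(x', y', z') \<in> sols n X Y Z"
  shows "\<lbrakk>x = x'; y = y'\<rbrakk> \<Longrightarrow> z = z'" "\<lbrakk>x = x'; z = z'\<rbrakk> \<Longrightarrow> y = y'" "\<lbrakk>y = y'; z = z'\<rbrakk> \<Longrightarrow> x = x'"
proof -
  have mem: "x \<in> X" "x' \<in> X" "y \<in> Y" "y' \<in> Y" "z \<in> Z" "z' \<in> Z"
    and c: "\<And>l. l < n \<Longrightarrow> [f x l + g y l = h z l] (mod int p)"
      "\<And>l. l < n \<Longrightarrow> [f x' l + g y' l = h z' l] (mod int p)"
    using t by (auto simp: sols_def)
  show "z = z'" if "x = x'" "y = y'"
    using sep mem that c unfolding separated_def by (metis cong_sym cong_trans)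
  show "y = y'" if "x = x'" "z = z'"
  proof -
    have "[g y l = g y' l] (mod int p)" if "l < n" for l
      using cong_trans[OF c(1)[OF that] cong_sym[OF c(2)[OF that, folded \<open>x = x'\<close> \<open>z = z'\<close>]]]
      by (simp add: cong_add_lcancel)
    then show ?thesis using sep mem unfolding separated_def by blast
  qed
  show "x = x'" if "y = y'" "z = z'"
  proof -
    have "[f x l = f x' l] (mod int p)" if "l < n" for l
      using cong_trans[OF c(1)[OF that] cong_sym[OF c(2)[OF that, folded \<open>y = y'\<close> \<open>z = z'\<close>]]]
      by (simp add: cong_add_rcancel)
    then show ?thesis using sep mem unfolding separated_def by blast
  qed
qed

text \<open>Averaging over the affine hyperplanes \<open>\<nu> \<bullet> (v\<^sub>0, \<dots>, v\<^bsub>n-1\<^esub>) + v\<^sub>n = a\<close>: on such a hyperplane the last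
  coordinate is redundant, so the vectors stay the same and only the dimension drops. A solution
  survives with probability \<open>p\<^sup>-\<^sup>2\<close>, a linked pair of solutions with probability at most \<open>p\<^sup>-\<^sup>3\<close>.\<close>

lemma exists_good_restriction:
  fixes \<theta> :: real
  assumes fin: "finite X" "finite Y" "finite Z" and sep: "separated (Suc n) X Y Z" and \<theta>: "0 \<le> \<theta>"
  obtains X' Y' Z' where "X' \<subseteq> X" "Y' \<subseteq> Y" "Z' \<subseteq> Z" "separated n X' Y' Z'"
    "card (sols (Suc n) X Y Z) - \<theta> / p * card (linked (sols (Suc n) X Y Z))
      \<le> p\<^sup>2 * (card (sols n X' Y' Z') - \<theta> * card (linked (sols n X' Y' Z')))"
proof -
  define T where "T = sols (Suc n) X Y Z"
  have finT: "finite T" using fin by (simp add: T_def finite_sols)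
  define \<phi> where "\<phi> \<nu> v = (\<Sum>l<n. \<nu> l * v l) + v n" for \<nu> v :: "nat \<Rightarrow> int"
  define \<Lambda> where "\<Lambda> = {..<n} \<rightarrow>\<^sub>E {0..<int p}"
  \<comment> \<open>A point is a direction \<open>\<nu>\<close> with values \<open>a\<close> and
    \<open>b\<close>. The hyperplanes for \<open>x\<close>, \<open>y\<close>, \<open>z\<close> get
    the values \<open>a\<close>, \<open>b\<close>, \<open>a + b\<close>, so for a solution the third
    condition follows from the first two.\<close>
  define \<Omega> where "\<Omega> = \<Lambda> \<times> {0..<int p} \<times> {0..<int p}"
  have fin\<Lambda>: "finite \<Lambda>" by (simp add: \<Lambda>_def finite_PiE)
  then have fin\<Omega>: "finite \<Omega>" by (simp add: \<Omega>_def)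
  have card\<Lambda>: "card \<Lambda> = p ^ n" by (simp add: \<Lambda>_def card_funcsetE)
  have card\<Omega>: "card \<Omega> = p ^ n * p\<^sup>2" by (simp add: \<Omega>_def card\<Lambda> card_cartesian_product power2_eq_square)
  have \<phi>_cong: "[\<phi> \<nu> u = \<phi> \<nu> v] (mod int p) \<longleftrightarrow> [u n = v n] (mod int p)"
    if "\<And>l. l < n \<Longrightarrow> [u l = v l] (mod int p)" for \<nu> u v
  proof -
    have s: "[(\<Sum>l<n. \<nu> l * u l) = (\<Sum>l<n. \<nu> l * v l)] (mod int p)"
      by (intro cong_sum cong_mult cong_refl that) auto
    show ?thesis
    proof
      assume "[\<phi> \<nu> u = \<phi> \<nu> v] (mod int p)"
      then show "[u n = v n] (mod int p)"
        using cong_diff[OF _ s, of "\<phi> \<nu> u" "\<phi> \<nu> v"] by (simp add: \<phi>_def)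
    qed (simp add: \<phi>_def cong_add s)
  qed
  have \<phi>_add: "\<phi> \<nu> u + \<phi> \<nu> v = \<phi> \<nu> (\<lambda>l. u l + v l)" for \<nu> u v
    by (simp add: \<phi>_def distrib_left sum.distrib)
  have \<phi>_diff: "\<phi> \<nu> u - \<phi> \<nu> v = \<phi> \<nu> (\<lambda>l. u l - v l)" for \<nu> u v
    by (simp add: \<phi>_def right_diff_distrib sum_subtractf)
  define X' where "X' w = {x \<in> X. [\<phi> (fst w) (f x) = fst (snd w)] (mod int p)}" for w :: "(nat \<Rightarrow> int) \<times> int \<times> int"
  define Y' where "Y' w = {y \<in> Y. [\<phi> (fst w) (g y) = snd (snd w)] (mod int p)}" for w :: "(nat \<Rightarrow> int) \<times> int \<times> int"
  define Z' where "Z' w = {z \<in> Z. [\<phi> (fst w) (h z) = fst (snd w) + snd (snd w)] (mod int p)}" for w :: "(nat \<Rightarrow> int) \<times> int \<times> int"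
  have sub: "X' w \<subseteq> X" "Y' w \<subseteq> Y" "Z' w \<subseteq> Z" for w by (auto simp: X'_def Y'_def Z'_def)
  \<comment> \<open>On a common hyperplane the first \<open>n\<close> coordinates determine the last
    one modulo \<open>p\<close>, so dropping it merges no two elements.\<close>
  have lift: "x = x'" if "[\<phi> \<nu> u = a] (mod int p)" "[\<phi> \<nu> v = a] (mod int p)"
    "\<forall>l<n. [u l = v l] (mod int p)" "(\<forall>l<Suc n. [u l = v l] (mod int p)) \<longrightarrow> x = x'"
    for \<nu> u v a and x x' :: 'd
  proof -
    have "[\<phi> \<nu> u = \<phi> \<nu> v] (mod int p)" using that(1,2) cong_sym cong_trans by blast
    then have "[u n = v n] (mod int p)" using that(3) \<phi>_cong[of u v \<nu>] by blast
    with that(3) have "\<forall>l<Suc n. [u l = v l] (mod int p)" by (simp add: less_Suc_eq all_conj_distrib)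
    then show ?thesis using that(4) by blast
  qed
  have sep': "separated n (X' w) (Y' w) (Z' w)" for w
    unfolding separated_def
  proof (intro conjI ballI impI)
    fix x x' assume "x \<in> X' w" "x' \<in> X' w" "\<forall>l<n. [f x l = f x' l] (mod int p)"
    then show "x = x'"
      using lift[of "fst w" "f x" "fst (snd w)" "f x'" x x'] sep
      unfolding X'_def separated_def by blast
  next
    fix x x' assume "x \<in> Y' w" "x' \<in> Y' w" "\<forall>l<n. [g x l = g x' l] (mod int p)"
    then show "x = x'"
      using lift[of "fst w" "g x" "snd (snd w)" "g x'" x x'] sep
      unfolding Y'_def separated_def by blast
  next
    fix x x' assume "x \<in> Z' w" "x' \<in> Z' w" "\<forall>l<n. [h x l = h x' l] (mod int p)"
    then show "x = x'"
      using lift[of "fst w" "h x" "fst (snd w) + snd (snd w)" "h x'" x x'] sep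
      unfolding Z'_def separated_def by blast
  qed
  define kept where "kept w t \<longleftrightarrow> [\<phi> (fst w) (f (fst t)) = fst (snd w)] (mod int p) \<and>
    [\<phi> (fst w) (g (fst (snd t))) = snd (snd w)] (mod int p)"
    for w :: "(nat \<Rightarrow> int) \<times> int \<times> int" and t :: "'a \<times> 'b \<times> 'c"
  have kept_z: "[\<phi> (fst w) (h (snd (snd t))) = fst (snd w) + snd (snd w)] (mod int p)"
    if "t \<in> T" "kept w t" for t w
  proof -
    have "[\<phi> (fst w) (\<lambda>l. f (fst t) l + g (fst (snd t)) l) = \<phi> (fst w) (h (snd (snd t)))] (mod int p)"
      using that(1) by (subst \<phi>_cong) (auto simp: T_def sols_def)
    moreover have "[\<phi> (fst w) (f (fst t)) + \<phi> (fst w) (g (fst (snd t))) = fst (snd w) + snd (snd w)] (mod int p)"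
      using that(2) by (intro cong_add) (auto simp: kept_def)
    ultimately show ?thesis unfolding \<phi>_add using cong_sym cong_trans by blast
  qed
  have sols': "sols n (X' w) (Y' w) (Z' w) = {t \<in> T. kept w t}" for w
  proof (rule subset_antisym; rule subsetI)
    fix t assume t: "t \<in> sols n (X' w) (Y' w) (Z' w)"
    obtain x y z where xyz: "t = (x, y, z)" by (cases t)
    have m: "x \<in> X' w" "y \<in> Y' w" "z \<in> Z' w" and c: "\<forall>l<n. [f x l + g y l = h z l] (mod int p)"
      using t by (auto simp: sols_def xyz)
    have "[\<phi> (fst w) (f x) + \<phi> (fst w) (g y) = fst (snd w) + snd (snd w)] (mod int p)"
      using m by (intro cong_add) (auto simp: X'_def Y'_def)
    moreover have "[\<phi> (fst w) (h z) = fst (snd w) + snd (snd w)] (mod int p)" using m by (simp add: Z'_def)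
    ultimately have "[\<phi> (fst w) (\<lambda>l. f x l + g y l) = \<phi> (fst w) (h z)] (mod int p)"
      unfolding \<phi>_add using cong_sym cong_trans by blast
    then have "[f x n + g y n = h z n] (mod int p)" using \<phi>_cong[of "\<lambda>l. f x l + g y l" "h z" "fst w"] c by blast
    then show "t \<in> {t \<in> T. kept w t}"
      using c m by (auto simp: xyz T_def sols_def kept_def X'_def Y'_def Z'_def less_Suc_eq)
  next
    fix t assume "t \<in> {t \<in> T. kept w t}"
    then have t: "t \<in> T" "kept w t" by blast+
    obtain x y z where xyz: "t = (x, y, z)" by (cases t)
    show "t \<in> sols n (X' w) (Y' w) (Z' w)"
      using kept_z[OF t] t unfolding xyz T_def sols_def kept_def X'_def Y'_def Z'_def by simp
  qed
  have one: "card {w \<in> \<Omega>. kept w t} = p ^ n" for t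
  proof -
    have "bij_betw (\<lambda>\<nu>. (\<nu>, \<phi> \<nu> (f (fst t)) mod int p, \<phi> \<nu> (g (fst (snd t))) mod int p)) \<Lambda> {w \<in> \<Omega>. kept w t}"
      by (rule bij_betw_byWitness[of _ fst]) (auto simp: \<Omega>_def kept_def cong_def p_pos)
    from bij_betw_same_card[OF this] show ?thesis using card\<Lambda> by simp
  qed
  \<comment> \<open>Linked solutions differ in \<open>x\<close> or in \<open>y\<close>. If both are
    kept, \<open>\<nu>\<close> lies on the affine hyperplane given by that difference, and
    \<open>\<nu>\<close> determines the two values.\<close>
  have two: "p * card {w \<in> \<Omega>. kept w s \<and> kept w t} \<le> p ^ n" if st: "(s, t) \<in> linked T" for s t
  proof -
    obtain x y z x' y' z' where xyz: "s = (x, y, z)" "t = (x', y', z')" by (cases s, cases t)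
    have T: "(x, y, z) \<in> T" "(x', y', z') \<in> T" and ne: "x \<noteq> x' \<or> y \<noteq> y' \<or> z \<noteq> z'"
      using st by (auto simp: linked_def xyz)
    have mem: "x \<in> X" "x' \<in> X" "y \<in> Y" "y' \<in> Y" using T by (auto simp: T_def sols_def)
    have "x \<noteq> x' \<or> y \<noteq> y'" using sols_unique(1)[OF sep T[unfolded T_def]] ne by blast
    then have "\<exists>v. (\<exists>l\<le>n. \<not> int p dvd v l) \<and> (v = (\<lambda>l. f x l - f x' l) \<or> v = (\<lambda>l. g y l - g y' l))"
    proof
      assume "x \<noteq> x'"
      then have "\<not> (\<forall>l<Suc n. [f x l = f x' l] (mod int p))"
        using sep mem unfolding separated_def by blast
      then have "\<exists>l\<le>n. \<not> int p dvd f x l - f x' l"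
        by (simp only: cong_iff_dvd_diff less_Suc_eq_le not_all not_imp)
      then show ?thesis by (intro exI[of _ "\<lambda>l. f x l - f x' l"]) simp
    next
      assume "y \<noteq> y'"
      then have "\<not> (\<forall>l<Suc n. [g y l = g y' l] (mod int p))"
        using sep mem unfolding separated_def by blast
      then have "\<exists>l\<le>n. \<not> int p dvd g y l - g y' l"
        by (simp only: cong_iff_dvd_diff less_Suc_eq_le not_all not_imp)
      then show ?thesis by (intro exI[of _ "\<lambda>l. g y l - g y' l"]) simp
    qed
    then obtain v where v: "(\<exists>l\<le>n. \<not> int p dvd v l) \<and>
      (v = (\<lambda>l. f x l - f x' l) \<or> v = (\<lambda>l. g y l - g y' l))" by (rule exE)
    have dv: "int p dvd \<phi> (fst w) v" if k: "kept w s" "kept w t" for w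
    proof -
      have "[\<phi> (fst w) (f x) = \<phi> (fst w) (f x')] (mod int p)" "[\<phi> (fst w) (g y) = \<phi> (fst w) (g y')] (mod int p)"
        using k unfolding kept_def xyz fst_conv snd_conv using cong_sym cong_trans by blast+
      then have "int p dvd \<phi> (fst w) (\<lambda>l. f x l - f x' l)" "int p dvd \<phi> (fst w) (\<lambda>l. g y l - g y' l)"
        by (simp_all only: cong_iff_dvd_diff \<phi>_diff)
      then show ?thesis using v[THEN conjunct2] by (elim disjE) simp_all
    qed
    define H where "H = {\<nu> \<in> \<Lambda>. int p dvd \<phi> \<nu> v}"
    let ?K = "{w \<in> \<Omega>. kept w s \<and> kept w t}"
    have "inj_on fst ?K"
    proof (rule inj_onI)
      fix w w' assume mem2: "w \<in> ?K" "w' \<in> ?K" "fst w = fst w'"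
      have "[fst (snd w) = fst (snd w')] (mod int p)" "[snd (snd w) = snd (snd w')] (mod int p)"
        using mem2 unfolding kept_def mem_Collect_eq by (metis cong_sym cong_trans)+
      moreover have "w \<in> \<Omega>" "w' \<in> \<Omega>" using mem2 by blast+
      ultimately show "w = w'" using mem2(3) by (cases w, cases w') (auto simp: \<Omega>_def cong_def)
    qed
    moreover have "fst ` ?K \<subseteq> H"
    proof (rule image_subsetI)
      fix w assume "w \<in> ?K"
      then have "w \<in> \<Omega>" "int p dvd \<phi> (fst w) v" using dv by blast+
      then show "fst w \<in> H" by (auto simp: H_def \<Omega>_def)
    qed
    moreover have "finite H" using fin\<Lambda> by (simp add: H_def)
    ultimately have "card ?K \<le> card H" by (rule card_inj_on_le)
    then have "p * card ?K \<le> p * card H" by (rule mult_left_mono) simp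
    also have "\<dots> \<le> p ^ n"
      unfolding H_def \<Lambda>_def \<phi>_def by (rule card_affine_hyperplane[OF prime_p v[THEN conjunct1]])
    finally show ?thesis .
  qed
  define e where "e w = card {t \<in> T. kept w t}" for w
  define P where "P w = card (linked {t \<in> T. kept w t})" for w
  have swap: "(\<Sum>w\<in>\<Omega>. card {t \<in> S. R w t}) = (\<Sum>t\<in>S. card {w \<in> \<Omega>. R w t})" if "finite S" for S :: "'d set" and R
  proof -
    have "(\<Sum>w\<in>\<Omega>. card {t \<in> S. R w t}) = (\<Sum>w\<in>\<Omega>. \<Sum>t\<in>S. if R w t then 1 else 0)"
      using that by (simp add: sum.If_cases Int_def)
    also have "\<dots> = (\<Sum>t\<in>S. \<Sum>w\<in>\<Omega>. if R w t then 1 else 0)" by (rule sum.swap)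
    also have "\<dots> = (\<Sum>t\<in>S. card {w \<in> \<Omega>. R w t})" using fin\<Omega> by (simp add: sum.If_cases Int_def)
    finally show ?thesis .
  qed
  have sumE: "(\<Sum>w\<in>\<Omega>. e w) = card T * p ^ n"
    using swap[OF finT, of kept] one by (simp add: e_def)
  have "linked {t \<in> T. kept w t} = {st \<in> linked T. kept w (fst st) \<and> kept w (snd st)}" for w
    by (auto simp: linked_def)
  then have "p * (\<Sum>w\<in>\<Omega>. P w) = (\<Sum>st\<in>linked T. p * card {w \<in> \<Omega>. kept w (fst st) \<and> kept w (snd st)})"
    using swap[OF finite_linked[OF finT], of "\<lambda>w st. kept w (fst st) \<and> kept w (snd st)"]
    by (simp add: P_def sum_distrib_left)
  also have "\<dots> \<le> (\<Sum>st\<in>linked T. p ^ n)" by (rule sum_mono) (use two in auto)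
  finally have sumP: "p * (\<Sum>w\<in>\<Omega>. P w) \<le> card (linked T) * p ^ n" by simp
  have "\<exists>w\<in>\<Omega>. card T - \<theta> / p * card (linked T) \<le> p\<^sup>2 * (e w - \<theta> * P w)"
  proof (rule ccontr)
    assume "\<not> ?thesis"
    then have lt: "p\<^sup>2 * (e w - \<theta> * P w) < card T - \<theta> / p * card (linked T)" if "w \<in> \<Omega>" for w
      using that by (meson not_le)
    have "\<Omega> \<noteq> {}" using card\<Omega> p_pos by (metis card.empty mult_eq_0_iff power_not_zero less_numeral_extra(3))
    then have "(\<Sum>w\<in>\<Omega>. p\<^sup>2 * (e w - \<theta> * P w)) < (\<Sum>w\<in>\<Omega>. card T - \<theta> / p * card (linked T))"
      using fin\<Omega> lt by (intro sum_strict_mono) auto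
    also have "\<dots> = p ^ n * p\<^sup>2 * (card T - \<theta> / p * card (linked T))"
      using card\<Omega> by simp
    also have "(\<Sum>w\<in>\<Omega>. p\<^sup>2 * (e w - \<theta> * P w)) = p\<^sup>2 * (real (\<Sum>w\<in>\<Omega>. e w) - \<theta> * real (\<Sum>w\<in>\<Omega>. P w))"
      by (simp add: sum_distrib_left[symmetric] sum_subtractf)
    finally have "real (p\<^sup>2) * (real (card T * p ^ n) - \<theta> * real (\<Sum>w\<in>\<Omega>. P w))
      < real (p\<^sup>2) * (p ^ n * (card T - \<theta> / p * card (linked T)))"
      unfolding sumE by (simp add: mult_ac)
    then have "real (card T * p ^ n) - \<theta> * real (\<Sum>w\<in>\<Omega>. P w)
      < p ^ n * (card T - \<theta> / p * card (linked T))"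
      using p_pos by (subst (asm) mult_less_cancel_left_pos) auto
    then have "\<theta> / p * (card (linked T) * p ^ n) < \<theta> * real (\<Sum>w\<in>\<Omega>. P w)"
      by (simp add: algebra_simps)
    moreover have "\<theta> / p * real (p * (\<Sum>w\<in>\<Omega>. P w)) \<le> \<theta> / p * real (card (linked T) * p ^ n)"
      using sumP \<theta> unfolding of_nat_le_iff[symmetric, where 'a = real] by (intro mult_left_mono) auto
    ultimately show False using p_pos by simp
  qed
  then obtain w where "card T - \<theta> / p * card (linked T) \<le> p\<^sup>2 * (e w - \<theta> * P w)" by blast
  then show ?thesis
    using that[OF sub sep'[of w]] by (simp add: sols' e_def P_def T_def)
qed

end

text \<open>Take a maximal \<open>R\<close> that hits at least \<open>D\<close> members of
  \<open>T\<close> per element on average. An element with more than \<open>D\<close> unhit members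
  could be added without spoiling this.\<close>

lemma greedy_hitting_set:
  fixes D :: real and I :: "'v \<Rightarrow> 't \<Rightarrow> bool"
  assumes fin: "finite V" "finite T" and D: "0 \<le> D"
  shows "\<exists>R\<subseteq>V. D * card R \<le> card {t \<in> T. \<exists>r\<in>R. I r t} \<and>
    (\<forall>v\<in>V. card {t \<in> T. I v t \<and> (\<forall>r\<in>R. \<not> I r t)} \<le> D)"
proof -
  define F where "F = {R. R \<subseteq> V \<and> D * card R \<le> card {t \<in> T. \<exists>r\<in>R. I r t}}"
  have "finite F" using fin by (auto simp: F_def intro: finite_subset[of _ "Pow V"])
  moreover have "{} \<in> F" by (simp add: F_def)
  ultimately obtain R where RF: "R \<in> F" and max: "\<forall>R'\<in>F. R \<subseteq> R' \<longrightarrow> R = R'"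
    using finite_has_maximal[of F] by blast
  have R: "R \<subseteq> V" "D * card R \<le> card {t \<in> T. \<exists>r\<in>R. I r t}" using RF by (simp_all add: F_def)
  have "card {t \<in> T. I v t \<and> (\<forall>r\<in>R. \<not> I r t)} \<le> D" if v: "v \<in> V" for v
  proof (rule ccontr)
    assume "\<not> ?thesis"
    then have gt: "D < card {t \<in> T. I v t \<and> (\<forall>r\<in>R. \<not> I r t)}" by simp
    have "v \<notin> R"
    proof
      assume "v \<in> R"
      then have "{t \<in> T. I v t \<and> (\<forall>r\<in>R. \<not> I r t)} = {}" by blast
      with gt D show False by (metis card.empty not_le of_nat_0)
    qed
    have finR: "finite R" using R(1) fin(1) by (rule finite_subset)
    have "{t \<in> T. \<exists>r\<in>insert v R. I r t}
      = {t \<in> T. \<exists>r\<in>R. I r t} \<union> {t \<in> T. I v t \<and> (\<forall>r\<in>R. \<not> I r t)}" by blast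
    moreover have "card ({t \<in> T. \<exists>r\<in>R. I r t} \<union> {t \<in> T. I v t \<and> (\<forall>r\<in>R. \<not> I r t)})
      = card {t \<in> T. \<exists>r\<in>R. I r t} + card {t \<in> T. I v t \<and> (\<forall>r\<in>R. \<not> I r t)}"
      using fin by (intro card_Un_disjoint) auto
    ultimately have "D * card (insert v R) \<le> card {t \<in> T. \<exists>r\<in>insert v R. I r t}"
      using R(2) gt \<open>v \<notin> R\<close> finR by (simp add: distrib_left)
    then have "insert v R \<in> F" using R v by (simp add: F_def)
    then show False using max \<open>v \<notin> R\<close> by blast
  qed
  then show ?thesis using R by blast
qed

section \<open>From isolated solutions to hitting sets, scale by scale\<close>

context labelled_vectors
begin

text \<open>With every hyperplane a linked pair is less likely to survive than a single solution by
  a factor \<open>p\<close>; so the weight \<open>\<theta> / p ^ k\<close> of linked pairs at the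
  start becomes \<open>\<theta>\<close> at the end.\<close>

lemma exists_iterated_restriction:
  fixes \<theta> :: real
  assumes "finite X" "finite Y" "finite Z" "separated (n + k) X Y Z" "0 \<le> \<theta>"
  shows "\<exists>X' Y' Z'. X' \<subseteq> X \<and> Y' \<subseteq> Y \<and> Z' \<subseteq> Z \<and> separated n X' Y' Z' \<and>
    card (sols (n + k) X Y Z) - \<theta> / p ^ k * card (linked (sols (n + k) X Y Z))
      \<le> p ^ (2 * k) * (card (sols n X' Y' Z') - \<theta> * card (linked (sols n X' Y' Z')))"
  using assms
proof (induction k arbitrary: X Y Z)
  case 0
  then show ?case by (intro exI[of _ X] exI[of _ Y] exI[of _ Z]) simp
next
  case (Suc k)
  have "0 \<le> \<theta> / p ^ k" using Suc.prems by simp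
  from exists_good_restriction[OF Suc.prems(1-3) Suc.prems(4)[unfolded add_Suc_right] this]
  obtain X1 Y1 Z1 where 1: "X1 \<subseteq> X" "Y1 \<subseteq> Y" "Z1 \<subseteq> Z" "separated (n + k) X1 Y1 Z1"
    "card (sols (Suc (n + k)) X Y Z) - \<theta> / p ^ k / p * card (linked (sols (Suc (n + k)) X Y Z))
      \<le> p\<^sup>2 * (card (sols (n + k) X1 Y1 Z1) - \<theta> / p ^ k * card (linked (sols (n + k) X1 Y1 Z1)))"
    by blast
  have "finite X1" "finite Y1" "finite Z1" using 1 Suc.prems finite_subset by blast+
  from Suc.IH[OF this 1(4) Suc.prems(5)] obtain X' Y' Z' where 2: "X' \<subseteq> X1" "Y' \<subseteq> Y1" "Z' \<subseteq> Z1"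
    "separated n X' Y' Z'"
    "card (sols (n + k) X1 Y1 Z1) - \<theta> / p ^ k * card (linked (sols (n + k) X1 Y1 Z1))
      \<le> p ^ (2 * k) * (card (sols n X' Y' Z') - \<theta> * card (linked (sols n X' Y' Z')))"
    by blast
  have "p\<^sup>2 * (card (sols (n + k) X1 Y1 Z1) - \<theta> / p ^ k * card (linked (sols (n + k) X1 Y1 Z1)))
    \<le> real (p\<^sup>2) * (p ^ (2 * k) * (card (sols n X' Y' Z') - \<theta> * card (linked (sols n X' Y' Z'))))"
    using 2(5) by (intro mult_left_mono) auto
  with 1(5) have "card (sols (n + Suc k) X Y Z) - \<theta> / p ^ Suc k * card (linked (sols (n + Suc k) X Y Z))
    \<le> p ^ (2 * Suc k) * (card (sols n X' Y' Z') - \<theta> * card (linked (sols n X' Y' Z')))"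
    by (simp add: power2_eq_square mult_ac)
  moreover have "X' \<subseteq> X" "Y' \<subseteq> Y" "Z' \<subseteq> Z" using 1(1-3) 2(1-3) by (meson order_trans)+
  ultimately show ?case using 2(4) by (intro exI[of _ X'] exI[of _ Y'] exI[of _ Z'] conjI)
qed

text \<open>The isolated solutions are a tricoloured sum-free family: if the \<open>x\<close> of
  \<open>i\<close>, the \<open>y\<close> of \<open>j\<close> and the \<open>z\<close> of
  \<open>k\<close> satisfy the equation, the solution they form shares a coordinate with each of
  \<open>i\<close>, \<open>j\<close>, \<open>k\<close>, and so equals all three.\<close>

lemma isolated_sols_bound:
  assumes fin: "finite X" "finite Y" "finite Z"
  shows "real (card (sols n X Y Z)) - card (linked (sols n X Y Z)) \<le> 3 * card (low_degree (p - 1) n)"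
proof -
  define T where "T = sols n X Y Z"
  define S where "S = T - fst ` linked T"
  have finT: "finite T" using fin by (simp add: T_def finite_sols)
  have "card (fst ` linked T) \<le> card (linked T)" using finite_linked[OF finT] by (rule card_image_le)
  then have "card T \<le> card S + card (linked T)"
    using diff_card_le_card_Diff[of "fst ` linked T" T] finite_linked[OF finT] by (simp add: S_def)
  moreover have "card S \<le> 3 * card (low_degree (p - 1) n)"
  proof (rule tricolored_sum_free_bound[OF prime_p, where x = "\<lambda>t. f (fst t)"
        and y = "\<lambda>t. g (fst (snd t))" and z = "\<lambda>t. h (snd (snd t))"])
    show "finite S" using finT by (simp add: S_def)
    fix i j k assume S: "i \<in> S" "j \<in> S" "k \<in> S"
    have T: "i \<in> T" "j \<in> T" "k \<in> T" using S by (auto simp: S_def)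
    have iso: "s = t" if "s \<in> S" "t \<in> T"
      "fst s = fst t \<or> fst (snd s) = fst (snd t) \<or> snd (snd s) = snd (snd t)" for s t
    proof (rule ccontr)
      assume "s \<noteq> t"
      then have "(s, t) \<in> linked T" using that by (auto simp: linked_def S_def)
      then have "s \<in> fst ` linked T" by (metis fst_conv imageI)
      then show False using that(1) by (simp add: S_def)
    qed
    show "(\<forall>l<n. [f (fst i) l + g (fst (snd j)) l = h (snd (snd k)) l] (mod int p)) \<longleftrightarrow> i = j \<and> j = k"
    proof
      assume c: "\<forall>l<n. [f (fst i) l + g (fst (snd j)) l = h (snd (snd k)) l] (mod int p)"
      have t: "(fst i, fst (snd j), snd (snd k)) \<in> T"
        using T c unfolding T_def sols_def by auto
      have "i = (fst i, fst (snd j), snd (snd k))" "j = (fst i, fst (snd j), snd (snd k))"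
        "k = (fst i, fst (snd j), snd (snd k))"
        by (rule iso[OF S(1) t] iso[OF S(2) t] iso[OF S(3) t], simp)+
      then show "i = j \<and> j = k" by metis
    next
      assume "i = j \<and> j = k"
      then show "\<forall>l<n. [f (fst i) l + g (fst (snd j)) l = h (snd (snd k)) l] (mod int p)"
        using T(1) unfolding T_def sols_def by auto
    qed
  qed
  ultimately show ?thesis by (simp add: T_def)
qed

definition incident :: "'a + 'b + 'c \<Rightarrow> 'a \<times> 'b \<times> 'c \<Rightarrow> bool" where
  "incident v t = (case v of Inl x \<Rightarrow> fst t = x | Inr (Inl y) \<Rightarrow> fst (snd t) = y
     | Inr (Inr z) \<Rightarrow> snd (snd t) = z)"

lemma incident_simps [simp]:
  "incident (Inl x) t \<longleftrightarrow> fst t = x" "incident (Inr (Inl y)) t \<longleftrightarrow> fst (snd t) = y"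
  "incident (Inr (Inr z)) t \<longleftrightarrow> snd (snd t) = z"
  by (simp_all add: incident_def)

text \<open>With degrees at most \<open>p ^ k / 6\<close>, the three coordinates of a solution link
  it to at most \<open>p ^ k / 2\<close> others. In codimension \<open>k\<close> the expected number
  of linked pairs is then at most half that of solutions, and the bound for isolated solutions
  applies with its factor 3 doubled.\<close>

lemma bounded_degree_sols_bound:
  assumes fin: "finite X" "finite Y" "finite Z" and sep: "separated (n + k) X Y Z"
    and deg: "\<And>v. v \<in> X <+> Y <+> Z \<Longrightarrow> 6 * card {t \<in> sols (n + k) X Y Z. incident v t} \<le> p ^ k"
  shows "card (sols (n + k) X Y Z) \<le> 6 * p ^ (2 * k) * card (low_degree (p - 1) n)"
proof -
  define T where "T = sols (n + k) X Y Z"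
  have finT: "finite T" using fin by (simp add: T_def finite_sols)
  define N where "N v = {t \<in> T. incident v t}" for v
  have finN: "finite (N v)" for v using finT by (simp add: N_def)
  let ?U = "\<lambda>t. N (Inl (fst t)) \<union> (N (Inr (Inl (fst (snd t)))) \<union> N (Inr (Inr (snd (snd t)))))"
  have "linked T \<subseteq> Sigma T (\<lambda>t. ?U t)"
    by (auto simp: linked_def N_def)
  then have "card (linked T) \<le> card (Sigma T (\<lambda>t. ?U t))"
    using finT finN by (intro card_mono finite_SigmaI) auto
  also have "\<dots> = (\<Sum>t\<in>T. card (?U t))"
    using finT finN by (intro card_SigmaI) auto
  finally have "2 * card (linked T)
    \<le> 2 * (\<Sum>t\<in>T. card (?U t))"
    by simp
  also have "\<dots> \<le> (\<Sum>t\<in>T. p ^ k)"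
    unfolding sum_distrib_left
  proof (rule sum_mono)
    fix t assume "t \<in> T"
    then have "6 * card (N (Inl (fst t))) \<le> p ^ k" "6 * card (N (Inr (Inl (fst (snd t))))) \<le> p ^ k"
      "6 * card (N (Inr (Inr (snd (snd t))))) \<le> p ^ k"
      unfolding N_def T_def by (intro deg; auto simp: sols_def)+
    then show "2 * card (?U t) \<le> p ^ k"
      using card_Un_le[of "N (Inl (fst t))" "N (Inr (Inl (fst (snd t)))) \<union> N (Inr (Inr (snd (snd t))))"]
        card_Un_le[of "N (Inr (Inl (fst (snd t))))" "N (Inr (Inr (snd (snd t))))"] by linarith
  qed
  finally have "2 * card (linked T) \<le> card T * p ^ k" by simp
  then have "2 * real (card (linked T)) \<le> real (card T) * p ^ k"
    by (metis of_nat_le_iff of_nat_mult of_nat_numeral of_nat_power)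
  then have L: "1 / p ^ k * card (linked T) \<le> card T / 2"
    using p_pos by (simp add: divide_le_eq)
  obtain X' Y' Z' where r: "X' \<subseteq> X" "Y' \<subseteq> Y" "Z' \<subseteq> Z" "separated n X' Y' Z'"
    "card T - 1 / p ^ k * card (linked T)
      \<le> p ^ (2 * k) * (card (sols n X' Y' Z') - (1::real) * card (linked (sols n X' Y' Z')))"
    using exists_iterated_restriction[OF fin sep, of 1] unfolding T_def by auto
  have fin': "finite X'" "finite Y'" "finite Z'" using r fin finite_subset by blast+
  have "p ^ (2 * k) * (card (sols n X' Y' Z') - (1::real) * card (linked (sols n X' Y' Z')))
    \<le> real p ^ (2 * k) * (3 * card (low_degree (p - 1) n))"
    using isolated_sols_bound[OF fin'] unfolding of_nat_power mult_1_left
    by (intro mult_left_mono) auto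
  then have "real (card T) \<le> 6 * p ^ (2 * k) * card (low_degree (p - 1) n)" using L r(5) by simp
  then have "real (card T) \<le> real (6 * p ^ (2 * k) * card (low_degree (p - 1) n))" by simp
  then show ?thesis unfolding T_def by (simp only: of_nat_le_iff)
qed

text \<open>The scale \<open>k\<close> descends from \<open>n - q\<close> to 0; after each stage no
  element lies on more than \<open>p ^ k / 6\<close> unhit solutions. The first stage has to pay for
  all solutions and gives the first summand. Every later stage meets only the few solutions left by
  \<open>bounded_degree_sols_bound\<close>. Increasing \<open>q\<close> raises the first summand and
  lowers the second, so \<open>q\<close> is left free for balancing.\<close>

theorem hitting_set_of_sols:
  fixes \<rho> :: real
  assumes fin: "finite X" "finite Y" "finite Z" and sep: "separated n X Y Z"
    and \<rho>: "0 < \<rho>" "\<rho> < p" "\<And>m. card (low_degree (p - 1) m) \<le> \<rho> ^ m" and q: "q \<le> n"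
  shows "\<exists>R\<subseteq>X <+> Y <+> Z. (\<forall>t\<in>sols n X Y Z. \<exists>r\<in>R. incident r t) \<and>
    card R \<le> 6 * card (sols n X Y Z) * p ^ q / p ^ n + 36 * p\<^sup>2 / (p - \<rho>) * p ^ n * (\<rho> / p) ^ q"
proof -
  define T where "T = sols n X Y Z"
  define V where "V = X <+> Y <+> Z"
  define c where "c = 36 * p\<^sup>2 / (p - \<rho>)"
  define m where "m = n - q"
  have c: "c * (p - \<rho>) = 36 * p\<^sup>2" "0 < c" using \<rho> p_pos by (auto simp: c_def)
  have finT: "finite T" using fin by (simp add: T_def finite_sols)
  have finV: "finite V" using fin by (simp add: V_def)
  let ?N = "\<lambda>v R. {t \<in> T. incident v t \<and> (\<forall>r\<in>R. \<not> incident r t)}"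
  \<comment> \<open>The second summand telescopes: \<open>c (p - \<rho>) p\<^sup>k \<rho>\<^sup>n\<^sup>-\<^sup>k\<^sup>-\<^sup>1\<close> bounds the vertices removed at scale \<open>k\<close>.\<close>
  let ?P = "\<lambda>k. \<exists>R\<subseteq>V. card R \<le> 6 * card T / p ^ m + c * (p ^ m * \<rho> ^ (n - m) - p ^ k * \<rho> ^ (n - k)) \<and>
    (\<forall>v\<in>V. 6 * card (?N v R) \<le> p ^ k)"
  have "?P 0"
  proof (rule inc_induct[of 0 m ?P])
    obtain R where R: "R \<subseteq> V" "real (p ^ m) / 6 * card R \<le> card {t \<in> T. \<exists>r\<in>R. incident r t}"
      "\<forall>v\<in>V. card (?N v R) \<le> real (p ^ m) / 6"
      using greedy_hitting_set[OF finV finT, of "real (p ^ m) / 6" incident] by auto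
    have "card {t \<in> T. \<exists>r\<in>R. incident r t} \<le> card T" using finT by (intro card_mono) auto
    with R(2) have "real (p ^ m) / 6 * card R \<le> card T" by linarith
    then have "card R \<le> 6 * card T / p ^ m" using p_pos by (simp add: field_simps)
    moreover have "6 * card (?N v R) \<le> p ^ m" if "v \<in> V" for v
    proof -
      have "real (6 * card (?N v R)) \<le> real (p ^ m)"
        using R(3)[rule_format, OF that] by linarith
      then show ?thesis by (simp only: of_nat_le_iff)
    qed
    ultimately show "?P m" using R(1) by (intro exI[of _ R]) auto
  next
    fix k assume k: "0 \<le> k" "k < m" and "?P (Suc k)"
    then obtain R where R: "R \<subseteq> V"
      "card R \<le> 6 * card T / p ^ m + c * (p ^ m * \<rho> ^ (n - m) - p ^ Suc k * \<rho> ^ (n - Suc k))"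
      "\<And>v. v \<in> V \<Longrightarrow> 6 * card (?N v R) \<le> p ^ Suc k"
      by blast
    define X' where "X' = {x \<in> X. Inl x \<notin> R}"
    define Y' where "Y' = {y \<in> Y. Inr (Inl y) \<notin> R}"
    define Z' where "Z' = {z \<in> Z. Inr (Inr z) \<notin> R}"
    have sub: "X' \<subseteq> X" "Y' \<subseteq> Y" "Z' \<subseteq> Z" by (auto simp: X'_def Y'_def Z'_def)
    have fin': "finite X'" "finite Y'" "finite Z'" using sub fin finite_subset by blast+
    have T': "sols n X' Y' Z' = {t \<in> T. \<forall>r\<in>R. \<not> incident r t}"
    proof (rule subset_antisym; rule subsetI)
      fix t assume t: "t \<in> sols n X' Y' Z'"
      have "\<not> incident r t" if "r \<in> R" for r
        using t that by (cases r rule: sum.exhaust[of _ thesis for thesis])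
          (auto simp: sols_def X'_def Y'_def Z'_def incident_def split: sum.splits)
      then show "t \<in> {t \<in> T. \<forall>r\<in>R. \<not> incident r t}"
        using t sub by (auto simp: T_def sols_def)
    next
      fix t assume t: "t \<in> {t \<in> T. \<forall>r\<in>R. \<not> incident r t}"
      then have "Inl (fst t) \<notin> R" "Inr (Inl (fst (snd t))) \<notin> R" "Inr (Inr (snd (snd t))) \<notin> R"
        by force+
      then show "t \<in> sols n X' Y' Z'"
        using t by (auto simp: T_def sols_def X'_def Y'_def Z'_def)
    qed
    have n: "(n - Suc k) + Suc k = n" using k by (simp add: m_def)
    \<comment> \<open>The degrees left at scale \<open>Suc k\<close> are just small enough for
      codimension \<open>Suc k\<close>.\<close>
    have "card (sols (n - Suc k + Suc k) X' Y' Z') \<le> 6 * p ^ (2 * Suc k) * card (low_degree (p - 1) (n - Suc k))"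
    proof (rule bounded_degree_sols_bound[OF fin'])
      show "separated (n - Suc k + Suc k) X' Y' Z'"
        unfolding n using separated_subset[OF sep sub] .
      fix v assume "v \<in> X' <+> Y' <+> Z'"
      then have "v \<in> V" using sub by (auto simp: V_def)
      moreover have "{t \<in> sols (n - Suc k + Suc k) X' Y' Z'. incident v t}
        = (?N v R)" unfolding n T' by blast
      ultimately show "6 * card {t \<in> sols (n - Suc k + Suc k) X' Y' Z'. incident v t} \<le> p ^ Suc k"
        using R(3) by simp
    qed
    then have "card (sols n X' Y' Z') \<le> 6 * p ^ (2 * Suc k) * card (low_degree (p - 1) (n - Suc k))"
      unfolding n .
    then have "real (card (sols n X' Y' Z')) \<le> 6 * p ^ (2 * Suc k) * card (low_degree (p - 1) (n - Suc k))"
      by (metis of_nat_le_iff of_nat_mult of_nat_numeral of_nat_power)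
    also have "\<dots> \<le> 6 * p ^ (2 * Suc k) * \<rho> ^ (n - Suc k)"
      using \<rho>(3) unfolding of_nat_mult by (intro mult_left_mono) auto
    finally have e: "card (sols n X' Y' Z') \<le> 6 * p ^ (2 * Suc k) * \<rho> ^ (n - Suc k)" .
    have finT': "finite (sols n X' Y' Z')" using fin' by (rule finite_sols)
    obtain R' where R': "R' \<subseteq> V"
      "real (p ^ k) / 6 * card R' \<le> card {t \<in> sols n X' Y' Z'. \<exists>r\<in>R'. incident r t}"
      "\<forall>v\<in>V. card {t \<in> sols n X' Y' Z'. incident v t \<and> (\<forall>r\<in>R'. \<not> incident r t)} \<le> real (p ^ k) / 6"
      using greedy_hitting_set[OF finV finT', of "real (p ^ k) / 6" incident] by auto
    have "card {t \<in> sols n X' Y' Z'. \<exists>r\<in>R'. incident r t} \<le> card (sols n X' Y' Z')"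
      using finT' by (intro card_mono) auto
    with R'(2) e have "real (p ^ k) / 6 * card R' \<le> 6 * p ^ (2 * Suc k) * \<rho> ^ (n - Suc k)" by linarith
    also have "\<dots> = real (p ^ k) / 6 * (36 * p\<^sup>2 * p ^ k * \<rho> ^ (n - Suc k))"
      by (simp add: power_mult power2_eq_square power_mult_distrib mult_2 power_add)
    finally have "card R' \<le> 36 * p\<^sup>2 * p ^ k * \<rho> ^ (n - Suc k)"
      using p_pos by (subst (asm) mult_le_cancel_left_pos) auto
    also have "\<dots> = c * (p - \<rho>) * p ^ k * \<rho> ^ (n - Suc k)" by (simp add: c(1))
    also have "\<dots> = c * (p ^ Suc k * \<rho> ^ (n - Suc k) - p ^ k * \<rho> ^ (n - k))"
    proof -
      have "n - k = Suc (n - Suc k)" using n by simp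
      then have "\<rho> ^ (n - k) = \<rho> * \<rho> ^ (n - Suc k)" by simp
      then show ?thesis by (simp add: algebra_simps)
    qed
    finally have "card R' \<le> c * (p ^ Suc k * \<rho> ^ (n - Suc k) - p ^ k * \<rho> ^ (n - k))" .
    moreover have "card (R \<union> R') \<le> card R + card R'" by (rule card_Un_le)
    ultimately have "card (R \<union> R') \<le> 6 * card T / p ^ m + c * (p ^ m * \<rho> ^ (n - m) - p ^ k * \<rho> ^ (n - k))"
      using R(2) by (simp add: right_diff_distrib)
    moreover have "6 * card (?N v (R \<union> R')) \<le> p ^ k" if "v \<in> V" for v
    proof -
      have "{t \<in> sols n X' Y' Z'. incident v t \<and> (\<forall>r\<in>R'. \<not> incident r t)}
        = (?N v (R \<union> R'))" unfolding T' by blast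
      then have "real (6 * card (?N v (R \<union> R'))) \<le> real (p ^ k)"
        using R'(3)[rule_format, OF that] by simp
      then show ?thesis by (simp only: of_nat_le_iff)
    qed
    ultimately show "?P k" using R(1) R'(1) by (intro exI[of _ "R \<union> R'"]) auto
  qed simp
  then obtain R where R: "R \<subseteq> V" "card R \<le> 6 * card T / p ^ m + c * (p ^ m * \<rho> ^ (n - m) - p ^ 0 * \<rho> ^ (n - 0))"
    "\<And>v. v \<in> V \<Longrightarrow> 6 * card (?N v R) \<le> p ^ 0" by blast
  have "\<exists>r\<in>R. incident r t" if t: "t \<in> T" for t
  proof (rule ccontr)
    assume no: "\<not> ?thesis"
    have "Inl (fst t) \<in> V" using t by (auto simp: T_def V_def sols_def)
    \<comment> \<open>At scale 0 six times a cardinality is at most 1, so nothing is left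
      unhit.\<close>
    from R(3)[OF this] have "card {u \<in> T. incident (Inl (fst t)) u \<and> (\<forall>r\<in>R. \<not> incident r u)} = 0" by simp
    then have "{u \<in> T. incident (Inl (fst t)) u \<and> (\<forall>r\<in>R. \<not> incident r u)} = {}" using finT by simp
    moreover have "t \<in> {u \<in> T. incident (Inl (fst t)) u \<and> (\<forall>r\<in>R. \<not> incident r u)}"
      using t no by simp
    ultimately show False by blast
  qed
  moreover have "card R \<le> 6 * card T * p ^ q / p ^ n + c * p ^ n * (\<rho> / p) ^ q"
  proof -
    have pw: "real p ^ n = p ^ m * p ^ q" "n - m = q"
      using q by (auto simp: m_def power_add[symmetric])
    have "0 \<le> c * \<rho> ^ n" using c(2) \<rho>(1) by simp
    then have "card R \<le> 6 * card T / p ^ m + c * (p ^ m * \<rho> ^ q)"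
      using R(2) by (simp add: pw(2) right_diff_distrib)
    also have "\<dots> = 6 * card T * p ^ q / p ^ n + c * p ^ n * (\<rho> / p) ^ q"
      using p_pos by (simp add: pw(1) power_divide)
    finally show ?thesis .
  qed
  ultimately show ?thesis using R(1) unfolding T_def V_def c_def by blast
qed

end

section \<open>Restricted sumsets in abelian groups\<close>

lemma card_mult_le_if_fibres_large:
  fixes m :: real
  assumes Q: "finite Q" and D: "finite D" and fib: "\<And>d. d \<in> D \<Longrightarrow> m \<le> card {q \<in> Q. \<phi> q = d}"
  shows "m * card D \<le> card Q"
proof -
  have "m * card D = (\<Sum>d\<in>D. m)" by simp
  also have "\<dots> \<le> (\<Sum>d\<in>D. real (card {q \<in> Q. \<phi> q = d}))" by (rule sum_mono) (rule fib)
  also have "\<dots> = card (\<Union>d\<in>D. {q \<in> Q. \<phi> q = d})"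
    using Q D by (subst card_UN_disjoint) auto
  also have "\<dots> \<le> card Q" using Q by (intro of_nat_mono card_mono) auto
  finally show ?thesis .
qed

definition large_subsets ::
    "('a, 'b) monoid_scheme \<Rightarrow> real \<Rightarrow> 'a set \<Rightarrow> 'a set \<Rightarrow> nat \<Rightarrow> 'a set \<Rightarrow> bool" where
  "large_subsets G \<epsilon> A B N C \<longleftrightarrow> (\<exists>A' B'. A' \<subseteq> A \<and> B' \<subseteq> B \<and>
     (1 - \<epsilon>) * real N \<le> card A' \<and> (1 - \<epsilon>) * real N \<le> card B' \<and>
     card (A' <#>\<^bsub>G\<^esub> B') \<le> card C + \<epsilon> * real N)"

lemma almost_all_sums_iff_large_subsets:
  "almost_all_sums G K \<epsilon> \<delta> \<longleftrightarrow> (\<forall>N A B \<Gamma>. A \<subseteq> carrier G \<longrightarrow> B \<subseteq> carrier G \<longrightarrow> finite A \<longrightarrow> finite B \<longrightarrow>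
     card A = N \<longrightarrow> card B = N \<longrightarrow> \<Gamma> \<subseteq> A \<times> B \<longrightarrow> (1 - \<delta>) * (real N)\<^sup>2 \<le> card \<Gamma> \<longrightarrow>
     card (restricted_sumset G \<Gamma>) \<le> K * real N \<longrightarrow> large_subsets G \<epsilon> A B N (restricted_sumset G \<Gamma>))"
  unfolding almost_all_sums_def large_subsets_def ..

definition rich :: "('a \<times> 'b) set \<Rightarrow> real \<Rightarrow> 'a set \<Rightarrow> 'a set" where
  "rich \<Gamma> m A = {a \<in> A. m \<le> card (\<Gamma> `` {a})}"

text \<open>Markov's inequality: at most \<open>\<tau>\<^sup>2 * (real N)\<^sup>2\<close> pairs are
  missing, and an element that is not rich misses more than \<open>\<tau> * N\<close> of
  them.\<close>

lemma card_not_rich: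
  fixes \<tau> :: real and N :: nat
  assumes fin: "finite A" "finite B" and N: "card A = N" "card B = N" and \<Gamma>: "\<Gamma> \<subseteq> A \<times> B"
    and \<tau>: "0 < \<tau>" and dense: "(1 - \<tau>\<^sup>2) * (real N)\<^sup>2 \<le> card \<Gamma>"
  shows "card (A - rich \<Gamma> ((1 - \<tau>) * N) A) \<le> \<tau> * N"
proof (cases "N = 0")
  case True
  then show ?thesis using fin N by simp
next
  case False
  let ?P = "A - rich \<Gamma> ((1 - \<tau>) * N) A"
  have sub: "\<Gamma> `` {a} \<subseteq> B" for a using \<Gamma> by auto
  have "\<Gamma> = Sigma A (\<lambda>a. \<Gamma> `` {a})" using \<Gamma> by auto
  then have "card \<Gamma> = (\<Sum>a\<in>A. card (\<Gamma> `` {a}))"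
    using card_SigmaI[of A "\<lambda>a. \<Gamma> `` {a}"] fin sub finite_subset by metis
  then have eq: "real (card \<Gamma>) = (\<Sum>a\<in>A. real (card (\<Gamma> `` {a})))" by simp
  have le: "real (card (\<Gamma> `` {a})) \<le> N" for a using card_mono[OF fin(2) sub] N by simp
  have "card ?P * (\<tau> * N) = (\<Sum>a\<in>?P. \<tau> * N)" by simp
  also have "\<dots> \<le> (\<Sum>a\<in>?P. N - real (card (\<Gamma> `` {a})))"
    by (rule sum_mono) (auto simp: rich_def algebra_simps)
  also have "\<dots> \<le> (\<Sum>a\<in>A. N - real (card (\<Gamma> `` {a})))"
    using fin le by (intro sum_mono2) auto
  also have "\<dots> = (real N)\<^sup>2 - card \<Gamma>"
    using N by (simp add: sum_subtractf eq power2_eq_square)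
  also have "\<dots> \<le> (\<tau> * N) * (\<tau> * N)" using dense by (simp add: algebra_simps power2_eq_square)
  finally show ?thesis using \<tau> False by (subst (asm) mult_le_cancel_right_pos) auto
qed

section \<open>Popular representations and Pluennecke's inequality\<close>

context comm_group
begin

lemma mult_cancel_diff: "\<lbrakk>a \<in> carrier G; a' \<in> carrier G; b \<in> carrier G\<rbrakk>
  \<Longrightarrow> (a \<otimes> b) \<otimes> inv (a' \<otimes> b) = a \<otimes> inv a'"
  by (simp add: inv_mult m_ac)

lemma finite_restricted_sumset: "finite \<Gamma> \<Longrightarrow> finite (restricted_sumset G \<Gamma>)"
proof -
  assume "finite \<Gamma>"
  moreover have "restricted_sumset G \<Gamma> = (\<lambda>(a, b). a \<otimes> b) ` \<Gamma>"
    by (auto simp: restricted_sumset_def image_iff)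
  ultimately show ?thesis by simp
qed

lemma restricted_sumset_converse:
  assumes "\<Gamma> \<subseteq> A \<times> B" "A \<subseteq> carrier G" "B \<subseteq> carrier G"
  shows "restricted_sumset G (\<Gamma>\<inverse>) = restricted_sumset G \<Gamma>"
proof -
  have "a \<otimes> b = b \<otimes> a" if "(a, b) \<in> \<Gamma>" for a b
    using that assms by (intro m_comm) auto
  then show ?thesis unfolding restricted_sumset_def by (force simp: eq_commute)
qed

lemma restricted_sumset_in_carrier:
  "\<lbrakk>\<Gamma> \<subseteq> A \<times> B; A \<subseteq> carrier G; B \<subseteq> carrier G\<rbrakk> \<Longrightarrow> restricted_sumset G \<Gamma> \<subseteq> carrier G"
  by (auto simp: restricted_sumset_def)

lemma rich_differences_bound:
  fixes \<tau> :: real and N :: nat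
  assumes fin: "finite A" "finite B" and N: "card B = N" and car: "A \<subseteq> carrier G" "B \<subseteq> carrier G"
    and \<Gamma>: "\<Gamma> \<subseteq> A \<times> B" and \<tau>: "\<tau> \<le> 1/4"
    and A1: "A1 = rich \<Gamma> ((1 - \<tau>) * N) A"
  shows "N / 2 * card (A1 <#> m_inv G ` A1) \<le> (card (restricted_sumset G \<Gamma>))\<^sup>2"
proof -
  let ?C = "restricted_sumset G \<Gamma>"
  have finC: "finite ?C" using fin \<Gamma> by (intro finite_restricted_sumset) (auto intro: finite_subset)
  have "N / 2 * card (A1 <#> m_inv G ` A1) \<le> card (?C \<times> ?C)"
  proof (rule card_mult_le_if_fibres_large[where \<phi> = "\<lambda>(c, c'). c \<otimes> inv c'"])
    show "finite (A1 <#> m_inv G ` A1)" using fin(1) by (auto simp: A1 rich_def set_mult_def)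
    fix d assume "d \<in> A1 <#> m_inv G ` A1"
    then obtain a a' where a: "a \<in> A1" "a' \<in> A1" and d: "d = a \<otimes> inv a'"
      by (auto simp: set_mult_def)
    have ac: "a \<in> carrier G" "a' \<in> carrier G" using a car by (auto simp: A1 rich_def)
    let ?W = "\<Gamma> `` {a} \<inter> \<Gamma> `` {a'}"
    have WB: "?W \<subseteq> B" "\<Gamma> `` {a} \<subseteq> B" "\<Gamma> `` {a'} \<subseteq> B" using \<Gamma> by auto
    then have finW: "finite (\<Gamma> `` {a})" "finite (\<Gamma> `` {a'})" using fin finite_subset by blast+
    have "card (\<Gamma> `` {a} \<union> \<Gamma> `` {a'}) \<le> N"
      unfolding N[symmetric] using fin WB by (intro card_mono) auto
    then have "card (\<Gamma> `` {a}) + card (\<Gamma> `` {a'}) \<le> N + card ?W"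
      using card_Un_Int[OF finW] by linarith
    moreover have "(1 - \<tau>) * N \<le> card (\<Gamma> `` {a})" "(1 - \<tau>) * N \<le> card (\<Gamma> `` {a'})"
      using a by (auto simp: A1 rich_def)
    moreover have "3/4 * real N \<le> (1 - \<tau>) * N" using \<tau> by (intro mult_right_mono) auto
    ultimately have "real N / 2 \<le> card ?W" by linarith
    also have "card ?W = card ((\<lambda>b. (a \<otimes> b, a' \<otimes> b)) ` ?W)"
    proof -
      have "x \<in> carrier G" if "(a, x) \<in> \<Gamma>" for x using that \<Gamma> car by auto
      then show ?thesis using ac by (intro card_image[symmetric] inj_onI) auto
    qed
    also have "\<dots> \<le> card {q \<in> ?C \<times> ?C. (case q of (c, c') \<Rightarrow> c \<otimes> inv c') = d}"
    proof (rule card_mono)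
      show "(\<lambda>b. (a \<otimes> b, a' \<otimes> b)) ` ?W \<subseteq> {q \<in> ?C \<times> ?C. (case q of (c, c') \<Rightarrow> c \<otimes> inv c') = d}"
        using WB car ac by (auto simp: d mult_cancel_diff restricted_sumset_def)
    qed (use finC in auto)
    finally show "real N / 2 \<le> card {q \<in> ?C \<times> ?C. (case q of (c, c') \<Rightarrow> c \<otimes> inv c') = d}" by simp
  qed (use finC in auto)
  then show ?thesis by (simp add: card_cartesian_product power2_eq_square)
qed

text \<open>Additively, \<open>a + b = (a + b') - (a' + b') + (a' + b)\<close>, a path of length
  three through \<open>\<Gamma>\<close>. The neighbourhoods of \<open>b\<close> and \<open>a\<close>
  contain at least \<open>((1 - \<tau>)\<^sup>2 - \<tau>\<^sup>2) * N\<^sup>2\<close> admissible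
  pairs \<open>(a', b')\<close>, no less than half of \<open>N\<^sup>2\<close>, and they give
  distinct triples of elements of the restricted sumset.\<close>

lemma rich_sums_bound:
  fixes \<tau> :: real and N :: nat
  assumes fin: "finite A" "finite B" and N: "card A = N" "card B = N"
    and car: "A \<subseteq> carrier G" "B \<subseteq> carrier G"
    and \<Gamma>: "\<Gamma> \<subseteq> A \<times> B" and \<tau>: "0 < \<tau>" "\<tau> \<le> 1/4" and dense: "(1 - \<tau>\<^sup>2) * (real N)\<^sup>2 \<le> card \<Gamma>"
    and A1: "A1 = rich \<Gamma> ((1 - \<tau>) * N) A" and B1: "B1 = rich (\<Gamma>\<inverse>) ((1 - \<tau>) * N) B"
  shows "(real N)\<^sup>2 / 2 * card (A1 <#> B1) \<le> (card (restricted_sumset G \<Gamma>)) ^ 3"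
proof -
  let ?C = "restricted_sumset G \<Gamma>"
  have finG: "finite \<Gamma>" using \<Gamma> fin by (auto intro: finite_subset)
  have finC: "finite ?C" using finG by (intro finite_restricted_sumset)
  let ?\<phi> = "\<lambda>(c1, c2, c3). c1 \<otimes> inv c2 \<otimes> c3"
  have "(real N)\<^sup>2 / 2 * card (A1 <#> B1) \<le> card (?C \<times> ?C \<times> ?C)"
  proof (rule card_mult_le_if_fibres_large[where \<phi> = ?\<phi>])
    show "finite (A1 <#> B1)" using fin by (auto simp: A1 B1 rich_def set_mult_def)
    fix d assume "d \<in> A1 <#> B1"
    then obtain a b where ab: "a \<in> A1" "b \<in> B1" and d: "d = a \<otimes> b"
      by (auto simp: set_mult_def)
    have abc: "a \<in> carrier G" "b \<in> carrier G" using ab car by (auto simp: A1 B1 rich_def)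
    let ?X = "\<Gamma>\<inverse> `` {b}" and ?Y = "\<Gamma> `` {a}"
    have sub: "?X \<subseteq> A" "?Y \<subseteq> B" using \<Gamma> by auto
    have "card ?X * card ?Y \<le> card (\<Gamma> \<inter> ?X \<times> ?Y) + card (A \<times> B - \<Gamma>)"
    proof -
      have "card (?X \<times> ?Y) \<le> card ((\<Gamma> \<inter> ?X \<times> ?Y) \<union> (A \<times> B - \<Gamma>))"
        using fin finG sub by (intro card_mono) auto
      also have "\<dots> \<le> card (\<Gamma> \<inter> ?X \<times> ?Y) + card (A \<times> B - \<Gamma>)" by (rule card_Un_le)
      finally show ?thesis by (simp add: card_cartesian_product)
    qed
    then have "real (card ?X) * card ?Y \<le> card (\<Gamma> \<inter> ?X \<times> ?Y) + card (A \<times> B - \<Gamma>)"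
      by (metis of_nat_add of_nat_le_iff of_nat_mult)
    moreover have "real (card (A \<times> B - \<Gamma>)) \<le> \<tau>\<^sup>2 * (real N)\<^sup>2"
    proof -
      have "card (A \<times> B - \<Gamma>) = N * N - card \<Gamma>" "card \<Gamma> \<le> N * N"
        using card_Diff_subset[OF finG \<Gamma>] card_mono[OF _ \<Gamma>] fin N by (simp_all add: card_cartesian_product)
      then have "real (card (A \<times> B - \<Gamma>)) = (real N)\<^sup>2 - card \<Gamma>"
        by (simp add: of_nat_diff power2_eq_square)
      then show ?thesis using dense by (simp add: algebra_simps)
    qed
    moreover have "((1 - \<tau>) * N) * ((1 - \<tau>) * N) \<le> real (card ?X) * card ?Y"
      using ab \<tau> by (intro mult_mono) (auto simp: A1 B1 rich_def)
    moreover have "((1 - \<tau>) * N) * ((1 - \<tau>) * N) = (real N)\<^sup>2 - 2 * \<tau> * (real N)\<^sup>2 + \<tau>\<^sup>2 * (real N)\<^sup>2"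
      by (simp add: algebra_simps power2_eq_square)
    moreover have "2 * \<tau> * (real N)\<^sup>2 \<le> 1/2 * (real N)\<^sup>2" using \<tau> by (intro mult_right_mono) auto
    ultimately have "(real N)\<^sup>2 / 2 \<le> card (\<Gamma> \<inter> ?X \<times> ?Y)" by linarith
    also have "card (\<Gamma> \<inter> ?X \<times> ?Y) = card ((\<lambda>(a', b'). (a \<otimes> b', a' \<otimes> b', a' \<otimes> b)) ` (\<Gamma> \<inter> ?X \<times> ?Y))"
    proof (intro card_image[symmetric] inj_onI)
      fix s t assume st: "s \<in> \<Gamma> \<inter> ?X \<times> ?Y" "t \<in> \<Gamma> \<inter> ?X \<times> ?Y"
        and eq: "(case s of (a', b') \<Rightarrow> (a \<otimes> b', a' \<otimes> b', a' \<otimes> b)) = (case t of (a', b') \<Rightarrow> (a \<otimes> b', a' \<otimes> b', a' \<otimes> b))"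
      have "fst s \<in> carrier G" "fst t \<in> carrier G" "snd s \<in> carrier G" "snd t \<in> carrier G"
        using st sub car by auto
      then show "s = t" using eq abc by (cases s, cases t) auto
    qed
    also have "\<dots> \<le> card {q \<in> ?C \<times> ?C \<times> ?C. ?\<phi> q = d}"
    proof (rule card_mono)
      have key: "(a \<otimes> b') \<otimes> inv (a' \<otimes> b') \<otimes> (a' \<otimes> b) = a \<otimes> b" if "a' \<in> carrier G" "b' \<in> carrier G" for a' b'
      proof -
        have "(a \<otimes> b') \<otimes> inv (a' \<otimes> b') \<otimes> (a' \<otimes> b) = a \<otimes> (inv a' \<otimes> (a' \<otimes> b))"
          using that abc by (simp only: mult_cancel_diff) (simp add: m_assoc)
        also have "inv a' \<otimes> (a' \<otimes> b) = b" using that abc by (simp add: m_assoc[symmetric])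
        finally show ?thesis .
      qed
      show "(\<lambda>(a', b'). (a \<otimes> b', a' \<otimes> b', a' \<otimes> b)) ` (\<Gamma> \<inter> ?X \<times> ?Y)
        \<subseteq> {q \<in> ?C \<times> ?C \<times> ?C. ?\<phi> q = d}"
      proof (rule image_subsetI)
        fix s assume s: "s \<in> \<Gamma> \<inter> ?X \<times> ?Y"
        obtain a' b' where s': "s = (a', b')" by (cases s)
        have m: "(a', b') \<in> \<Gamma>" "(a', b) \<in> \<Gamma>" "(a, b') \<in> \<Gamma>" using s by (auto simp: s')
        then have "a' \<in> carrier G" "b' \<in> carrier G" using \<Gamma> car by auto
        note key[OF this]
        moreover have "a \<otimes> b' \<in> ?C" "a' \<otimes> b' \<in> ?C" "a' \<otimes> b \<in> ?C"
          using m by (auto simp: restricted_sumset_def)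
        ultimately show "(case s of (a', b') \<Rightarrow> (a \<otimes> b', a' \<otimes> b', a' \<otimes> b)) \<in> {q \<in> ?C \<times> ?C \<times> ?C. ?\<phi> q = d}"
          by (simp add: s' d)
      qed
    qed (use finC in auto)
    finally show "(real N)\<^sup>2 / 2 \<le> card {q \<in> ?C \<times> ?C \<times> ?C. ?\<phi> q = d}" by simp
  qed (use finC in auto)
  then show ?thesis by (simp add: card_cartesian_product power3_eq_cube mult.assoc)
qed

lemma conclusion_from_hitting_sets:
  fixes \<epsilon> :: real and N :: nat
  assumes fin: "finite A" "finite B" "finite C" and N: "card A = N" "card B = N"
    and sub: "A1 \<subseteq> A" "B1 \<subseteq> B" and small: "card (A - A1) \<le> \<epsilon> / 2 * N" "card (B - B1) \<le> \<epsilon> / 2 * N"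
    and R: "finite RA" "finite RB" "finite RC" "card RA \<le> \<epsilon> / 2 * N" "card RB \<le> \<epsilon> / 2 * N" "card RC \<le> \<epsilon> * N"
    and hit: "\<And>a b. \<lbrakk>a \<in> A1; b \<in> B1; a \<otimes> b \<notin> C\<rbrakk> \<Longrightarrow> a \<in> RA \<or> b \<in> RB \<or> a \<otimes> b \<in> RC"
  shows "large_subsets G \<epsilon> A B N C"
  unfolding large_subsets_def
proof (rule exI[of _ "A1 - RA"], rule exI[of _ "B1 - RB"], intro conjI)
  have big: "(1 - \<epsilon>) * N \<le> card (S1 - R)"
    if "finite S" "card S = N" "S1 \<subseteq> S" "card (S - S1) \<le> \<epsilon> / 2 * N" "finite R" "card R \<le> \<epsilon> / 2 * N" for S S1 R :: "'a set"
  proof -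
    have "card S \<le> card (S1 - R) + card (S - S1) + card R"
    proof -
      have "card S \<le> card (((S1 - R) \<union> (S - S1)) \<union> R)"
        using that finite_subset[OF that(3,1)] by (intro card_mono) auto
      also have "\<dots> \<le> card ((S1 - R) \<union> (S - S1)) + card R" by (rule card_Un_le)
      also have "\<dots> \<le> card (S1 - R) + card (S - S1) + card R" by (simp add: card_Un_le)
      finally show ?thesis .
    qed
    then show ?thesis using that by (simp add: algebra_simps)
  qed
  show "(1 - \<epsilon>) * N \<le> card (A1 - RA)" using big[of A A1 RA] fin N sub small R by blast
  show "(1 - \<epsilon>) * N \<le> card (B1 - RB)" using big[of B B1 RB] fin N sub small R by blast
  have "(A1 - RA) <#> (B1 - RB) \<subseteq> C \<union> RC" using hit by (auto simp: set_mult_def)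
  then have "card ((A1 - RA) <#> (B1 - RB)) \<le> card C + card RC"
    using card_mono[of "C \<union> RC"] card_Un_le[of C RC] fin(3) R(3) by (meson finite_UnI order_trans)
  then show "real (card ((A1 - RA) <#> (B1 - RB))) \<le> real (card C) + \<epsilon> * real N" using R(6) by linarith
qed (use sub in auto)

text \<open>Induction on \<open>C\<close>. For a new \<open>c\<close> let \<open>Z\<close> collect
  the \<open>x\<close> for which all \<open>x \<otimes> b \<otimes> c\<close> are already covered.
  The left side grows by at most \<open>card (X <#> B) - card (Z <#> B)\<close>, which
  \<open>le\<close> and \<open>min\<close> bound by \<open>\<kappa> * (card X - card Z)\<close>; the
  right side grows by at least as much, because \<open>x \<otimes> c\<close> is new for every
  \<open>x\<close> outside \<open>Z\<close>.\<close>

lemma Petridis: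
  fixes \<kappa> :: real
  assumes fin: "finite X" "finite B" "finite C" and car: "X \<subseteq> carrier G" "B \<subseteq> carrier G" "C \<subseteq> carrier G"
    and le: "card (X <#> B) \<le> \<kappa> * card X" and min: "\<And>Y. Y \<subseteq> X \<Longrightarrow> \<kappa> * card Y \<le> card (Y <#> B)"
    and \<kappa>: "0 \<le> \<kappa>"
  shows "card (X <#> B <#> C) \<le> \<kappa> * card (X <#> C)"
  using fin(3) car(3)
proof (induction C rule: finite_induct)
  case empty
  then show ?case by (simp add: set_mult_def)
next
  case (insert c C)
  have c: "c \<in> carrier G" and C: "C \<subseteq> carrier G" using insert.prems by auto
  have finm: "finite (S <#> T)" if "finite S" "finite T" for S T
    using that by (simp add: set_mult_def)
  let ?S = "X <#> B <#> C"
  define Z where "Z = {x \<in> X. \<forall>b\<in>B. x \<otimes> b \<otimes> c \<in> ?S}"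
  have ZX: "Z \<subseteq> X" by (auto simp: Z_def)
  have finZ: "finite Z" using ZX fin(1) finite_subset by blast
  have injc: "inj_on (\<lambda>x. x \<otimes> c) (carrier G)" using c by (auto intro: inj_onI)
  have "X <#> B <#> insert c C \<subseteq> ?S \<union> (\<lambda>x. x \<otimes> c) ` ((X <#> B) - (Z <#> B))"
  proof
    fix s assume "s \<in> X <#> B <#> insert c C"
    then obtain x b c' where s: "x \<in> X" "b \<in> B" "c' \<in> insert c C" "s = x \<otimes> b \<otimes> c'"
      by (auto simp: set_mult_def)
    show "s \<in> ?S \<union> (\<lambda>x. x \<otimes> c) ` ((X <#> B) - (Z <#> B))"
    proof (cases "c' \<in> C")
      case True
      then show ?thesis using s by (auto simp: set_mult_def)
    next
      case False
      then have "c' = c" using s by auto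
      moreover have "x \<otimes> b \<in> X <#> B" using s by (auto simp: set_mult_def)
      moreover have "y \<otimes> c \<in> ?S" if "y \<in> Z <#> B" for y
      proof -
        from that obtain z b' where "z \<in> Z" "b' \<in> B" "y = z \<otimes> b'" by (auto simp: set_mult_def)
        then show ?thesis by (simp add: Z_def)
      qed
      ultimately show ?thesis using s by blast
    qed
  qed
  then have "card (X <#> B <#> insert c C) \<le> card (?S \<union> (\<lambda>x. x \<otimes> c) ` ((X <#> B) - (Z <#> B)))"
    using fin insert.hyps finm by (intro card_mono) auto
  also have "\<dots> \<le> card ?S + card ((X <#> B) - (Z <#> B))"
    by (rule order_trans[OF card_Un_le]) (use fin finm in \<open>simp add: card_image_le\<close>)
  also have "card ((X <#> B) - (Z <#> B)) = card (X <#> B) - card (Z <#> B)"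
    using fin finm finZ ZX by (intro card_Diff_subset) (auto simp: set_mult_def)
  finally have 1: "card (X <#> B <#> insert c C) \<le> card ?S + (card (X <#> B) - card (Z <#> B))" .
  have "card (Z <#> B) \<le> card (X <#> B)"
    using fin finm ZX by (intro card_mono) (auto simp: set_mult_def)
  with 1 have "real (card (X <#> B <#> insert c C)) \<le> card ?S + (real (card (X <#> B)) - card (Z <#> B))"
    by linarith
  also have "\<dots> \<le> \<kappa> * card (X <#> C) + (\<kappa> * card X - \<kappa> * card Z)"
    using insert.IH[OF C] le min[OF ZX] by linarith
  also have "\<dots> = \<kappa> * (card (X <#> C) + (real (card X) - card Z))" by (simp add: algebra_simps)
  also have "\<dots> \<le> \<kappa> * card (X <#> insert c C)"
  proof (rule mult_left_mono[OF _ \<kappa>])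
    have new: "x \<otimes> c \<notin> X <#> C" if x: "x \<in> X - Z" for x
    proof
      assume "x \<otimes> c \<in> X <#> C"
      then obtain x' c' where x': "x' \<in> X" "c' \<in> C" "x \<otimes> c = x' \<otimes> c'" by (auto simp: set_mult_def)
      have "x \<otimes> b \<otimes> c \<in> ?S" if b: "b \<in> B" for b
      proof -
        have cc: "x \<in> carrier G" "x' \<in> carrier G" "b \<in> carrier G" "c' \<in> carrier G"
          using x x' b car C by auto
        have "x \<otimes> b \<otimes> c = (x \<otimes> c) \<otimes> b" using cc c by (simp add: m_ac)
        also have "\<dots> = x' \<otimes> b \<otimes> c'" unfolding x'(3) using cc c by (simp add: m_ac)
        finally show ?thesis using x' b by (auto simp: set_mult_def)
      qed
      then show False using x by (auto simp: Z_def)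
    qed
    have "(X <#> C) \<union> (\<lambda>x. x \<otimes> c) ` (X - Z) \<subseteq> X <#> insert c C" by (auto simp: set_mult_def)
    then have "card ((X <#> C) \<union> (\<lambda>x. x \<otimes> c) ` (X - Z)) \<le> card (X <#> insert c C)"
      using fin insert.hyps finm by (intro card_mono) auto
    also have "card ((X <#> C) \<union> (\<lambda>x. x \<otimes> c) ` (X - Z)) = card (X <#> C) + card ((\<lambda>x. x \<otimes> c) ` (X - Z))"
      using fin insert.hyps finm new by (intro card_Un_disjoint) auto
    also have "card ((\<lambda>x. x \<otimes> c) ` (X - Z)) = card (X - Z)"
      using car injc by (intro card_image) (auto intro: inj_on_subset)
    also have "card (X - Z) = card X - card Z" using finZ ZX by (rule card_Diff_subset)
    finally show "card (X <#> C) + (real (card X) - card Z) \<le> card (X <#> insert c C)"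
      using card_mono[OF fin(1) ZX] by linarith
  qed
  finally show ?case .
qed

text \<open>Additively \<open>B\<close> is \<open>- W - W\<close>, and the set to be bounded is
  \<open>W + W - W - W\<close>. For a nonempty \<open>X\<close> in \<open>W\<close> that minimises
  the ratio \<open>r\<close>, Petridis's lemma shows that adding \<open>- W\<close> twice costs only
  \<open>(r X)\<^sup>2\<close>. Ruzsa's triangle inequality squares this again, hence the fourth
  power.\<close>

lemma Pluennecke_Ruzsa_double_difference:
  fixes \<alpha> :: real
  assumes W: "finite W" "W \<subseteq> carrier G" "W \<noteq> {}" and \<alpha>: "card (W <#> m_inv G ` W) \<le> \<alpha> * card W"
  defines "B \<equiv> m_inv G ` W <#> m_inv G ` W"
  shows "card (B <#> m_inv G ` B) \<le> \<alpha> ^ 4 * card W"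
proof -
  let ?I = "m_inv G ` W"
  have I: "finite ?I" "?I \<subseteq> carrier G" using W by auto
  define r where "r X = card (X <#> ?I) / card X" for X
  obtain X where X: "X \<subseteq> W" "X \<noteq> {}" and Xmin: "\<And>Y. \<lbrakk>Y \<subseteq> W; Y \<noteq> {}\<rbrakk> \<Longrightarrow> r X \<le> r Y"
  proof -
    have "finite (Pow W - {{}})" "Pow W - {{}} \<noteq> {}" using W by auto
    then have "finite (r ` (Pow W - {{}}))" "r ` (Pow W - {{}}) \<noteq> {}" by blast+
    from ex_min_if_finite[OF this]
    obtain m where "m \<in> r ` (Pow W - {{}})" and m: "\<not> (\<exists>y\<in>r ` (Pow W - {{}}). y < m)" by blast
    then obtain X where X: "X \<in> Pow W - {{}}" "m = r X" by blast
    have "r X \<le> r Y" if "Y \<subseteq> W" "Y \<noteq> {}" for Y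
      using m that X(2) by (meson DiffI PowI imageI not_le singletonD)
    then show ?thesis using X(1) by (intro that[of X]) blast+
  qed
  have finX: "finite X" and Xc: "X \<subseteq> carrier G" using X W finite_subset by auto
  have cX: "0 < card X" "0 < card W" using X W finX by (auto simp: card_gt_0_iff)
  have r0: "0 \<le> r X" by (simp add: r_def)
  have "r W \<le> \<alpha>" using \<alpha> cX by (simp add: r_def divide_le_eq)
  then have r\<alpha>: "r X \<le> \<alpha>" using Xmin[OF order_refl W(3)] by linarith
  have Pet: "card (X <#> ?I <#> ?I) \<le> r X * card (X <#> ?I)"
  proof (rule Petridis[OF finX I(1) I(1) Xc I(2) I(2) _ _ r0])
    show "card (X <#> ?I) \<le> r X * card X" using cX by (simp add: r_def)
    fix Y assume Y: "Y \<subseteq> X"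
    show "r X * card Y \<le> card (Y <#> ?I)"
    proof (cases "Y = {}")
      case False
      then have "0 < card Y" using Y finX finite_subset by (auto simp: card_gt_0_iff)
      moreover have "r X \<le> r Y" using Xmin[of Y] Y X False by auto
      ultimately show ?thesis by (simp add: r_def le_divide_eq)
    qed simp
  qed
  define U where "U = X <#> B"
  have UX: "U = X <#> ?I <#> ?I" unfolding U_def B_def using Xc I by (simp add: set_mult_assoc)
  have "card (X <#> ?I) = r X * card X" using cX by (simp add: r_def)
  with Pet have U: "card U \<le> (r X)\<^sup>2 * card X" by (simp add: UX power2_eq_square mult.assoc)
  have Bc: "B \<subseteq> carrier G" "finite B" using I W(1) by (auto simp: B_def set_mult_def)
  have finU: "finite U" using finX Bc by (simp add: U_def set_mult_def)
  \<comment> \<open>Ruzsa's triangle inequality: a difference \<open>v - v'\<close> is represented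
    as \<open>(x + v) - (x + v')\<close> by every \<open>x\<close> in \<open>X\<close>.\<close>
  have "real (card X) * card (B <#> m_inv G ` B) \<le> card (U \<times> U)"
  proof (rule card_mult_le_if_fibres_large[where \<phi> = "\<lambda>(u, u'). u \<otimes> inv u'"])
    show "finite (B <#> m_inv G ` B)" using Bc by (simp add: set_mult_def)
    fix d assume "d \<in> B <#> m_inv G ` B"
    then obtain v v' where v: "v \<in> B" "v' \<in> B" "d = v \<otimes> inv v'" by (auto simp: set_mult_def)
    have vc: "v \<in> carrier G" "v' \<in> carrier G" using v Bc by auto
    have "card X = card ((\<lambda>x. (x \<otimes> v, x \<otimes> v')) ` X)"
      using Xc vc by (intro card_image[symmetric] inj_onI) (auto simp: subset_iff)
    also have "\<dots> \<le> card {q \<in> U \<times> U. (case q of (u, u') \<Rightarrow> u \<otimes> inv u') = d}"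
    proof (rule card_mono)
      show "(\<lambda>x. (x \<otimes> v, x \<otimes> v')) ` X \<subseteq> {q \<in> U \<times> U. (case q of (u, u') \<Rightarrow> u \<otimes> inv u') = d}"
      proof (rule image_subsetI)
        fix x assume x: "x \<in> X"
        then have xc: "x \<in> carrier G" using Xc by auto
        have "(x \<otimes> v) \<otimes> inv (x \<otimes> v') = d"
          using mult_cancel_diff[OF vc xc] v(3) m_comm[OF xc vc(1)] m_comm[OF xc vc(2)] by simp
        then show "(x \<otimes> v, x \<otimes> v') \<in> {q \<in> U \<times> U. (case q of (u, u') \<Rightarrow> u \<otimes> inv u') = d}"
          using x v by (auto simp: U_def set_mult_def)
      qed
    qed (use finU in auto)
    finally show "real (card X) \<le> card {q \<in> U \<times> U. (case q of (u, u') \<Rightarrow> u \<otimes> inv u') = d}" by simp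
  qed (use finU in auto)
  also have "\<dots> = real (card U) * card U" by (simp add: card_cartesian_product)
  also have "\<dots> \<le> ((r X)\<^sup>2 * card X) * ((r X)\<^sup>2 * card X)" using U by (intro mult_mono) auto
  also have "\<dots> = card X * ((r X) ^ 4 * card X)" by (simp add: eval_nat_numeral)
  finally have "card (B <#> m_inv G ` B) \<le> (r X) ^ 4 * card X"
    using cX by (subst (asm) mult_le_cancel_left_pos) auto
  also have "\<dots> \<le> \<alpha> ^ 4 * card W"
    using r0 r\<alpha> card_mono[OF W(1) X(1)] by (intro mult_mono power_mono) auto
  finally show ?thesis .
qed

end

lemma set_mult_memI: "\<lbrakk>x \<in> S; y \<in> T\<rbrakk> \<Longrightarrow> x \<otimes>\<^bsub>G\<^esub> y \<in> S <#>\<^bsub>G\<^esub> T"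
  by (auto simp: set_mult_def)

lemma finite_set_mult: "\<lbrakk>finite S; finite T\<rbrakk> \<Longrightarrow> finite (S <#>\<^bsub>G\<^esub> T)"
  by (simp add: set_mult_def)

text \<open>The union \<open>W\<close> of \<open>A1\<close> and the inverses of \<open>B1\<close>
  treats both sets at once: additively, \<open>W - W\<close> consists of \<open>A1 - A1\<close>,
  \<open>B1 - B1\<close> and plus or minus \<open>A1 + B1\<close>, all known to be small. The double
  difference set of \<open>W\<close> then contains the differences of sums.\<close>

lemma (in comm_group) rich_subsets:
  fixes K \<tau> :: real and N :: nat
  assumes fin: "finite A" "finite B" and N: "card A = N" "card B = N" "0 < N"
    and car: "A \<subseteq> carrier G" "B \<subseteq> carrier G"
    and \<Gamma>: "\<Gamma> \<subseteq> A \<times> B" and \<tau>: "0 < \<tau>" "\<tau> \<le> 1/4" and dense: "(1 - \<tau>\<^sup>2) * (real N)\<^sup>2 \<le> card \<Gamma>"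
    and K: "1 \<le> K" "card (restricted_sumset G \<Gamma>) \<le> K * N"
  shows "\<exists>A1 B1. A1 \<subseteq> A \<and> B1 \<subseteq> B \<and> card (A - A1) \<le> \<tau> * N \<and> card (B - B1) \<le> \<tau> * N \<and>
    card (A1 <#> m_inv G ` A1) \<le> 2 * K\<^sup>2 * N \<and>
    card ((A1 <#> B1) <#> m_inv G ` (A1 <#> B1)) \<le> 2 ^ 17 * K ^ 12 * N \<and>
    (\<forall>b\<in>B1. (1 - \<tau>) * N \<le> card {a \<in> A. a \<otimes> b \<in> restricted_sumset G \<Gamma>}) \<and>
    card {(a, b) \<in> A1 \<times> B1. a \<otimes> b \<notin> restricted_sumset G \<Gamma>} \<le> \<tau>\<^sup>2 * (real N)\<^sup>2"
proof -
  let ?C = "restricted_sumset G \<Gamma>"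
  define A1 where "A1 = rich \<Gamma> ((1 - \<tau>) * N) A"
  define B1 where "B1 = rich (\<Gamma>\<inverse>) ((1 - \<tau>) * N) B"
  have sub: "A1 \<subseteq> A" "B1 \<subseteq> B" by (auto simp: A1_def B1_def rich_def)
  have fin1: "finite A1" "finite B1" using sub fin finite_subset by blast+
  have car1: "A1 \<subseteq> carrier G" "B1 \<subseteq> carrier G" using sub car by blast+
  have \<Gamma>': "\<Gamma>\<inverse> \<subseteq> B \<times> A" using \<Gamma> by auto
  have fin\<Gamma>: "finite \<Gamma>" using \<Gamma> fin by (auto intro: finite_subset)
  have card_conv: "card (\<Gamma>\<inverse>) = card \<Gamma>" by (simp add: card_inverse)
  have small: "card (A - A1) \<le> \<tau> * N" "card (B - B1) \<le> \<tau> * N"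
    unfolding A1_def B1_def
    using card_not_rich[OF fin N(1,2) \<Gamma> \<tau>(1) dense]
      card_not_rich[OF fin(2,1) N(2,1) \<Gamma>' \<tau>(1)] dense card_conv by simp_all
  have C2: "(real (card ?C))\<^sup>2 \<le> N / 2 * (2 * K\<^sup>2 * N)"
  proof -
    have "(real (card ?C))\<^sup>2 \<le> (K * N)\<^sup>2" using K by (intro power_mono) auto
    then show ?thesis by (simp add: power2_eq_square mult_ac)
  qed
  have "N / 2 * card (A1 <#> m_inv G ` A1) \<le> N / 2 * (2 * K\<^sup>2 * N)"
    using rich_differences_bound[OF fin N(2) car \<Gamma> \<tau>(2) A1_def] C2 by simp
  then have AA: "card (A1 <#> m_inv G ` A1) \<le> 2 * K\<^sup>2 * N"
    using N(3) by (subst (asm) mult_le_cancel_left_pos) auto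
  have "N / 2 * card (B1 <#> m_inv G ` B1) \<le> N / 2 * (2 * K\<^sup>2 * N)"
    using rich_differences_bound[OF fin(2,1) N(1) car(2,1) \<Gamma>' \<tau>(2) B1_def] C2
    by (simp add: restricted_sumset_converse[OF \<Gamma> car])
  then have BB: "card (B1 <#> m_inv G ` B1) \<le> 2 * K\<^sup>2 * N"
    using N(3) by (subst (asm) mult_le_cancel_left_pos) auto
  have "(real N)\<^sup>2 / 2 * card (A1 <#> B1) \<le> (real (card ?C)) ^ 3"
    using rich_sums_bound[OF fin N(1,2) car \<Gamma> \<tau> dense A1_def B1_def] by simp
  also have "\<dots> \<le> (K * N) ^ 3" using K by (intro power_mono) auto
  also have "\<dots> = (real N)\<^sup>2 / 2 * (2 * K ^ 3 * N)" by (simp add: eval_nat_numeral)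
  finally have AB: "card (A1 <#> B1) \<le> 2 * K ^ 3 * N"
    using N(3) by (subst (asm) mult_le_cancel_left_pos) auto
  define W where "W = A1 \<union> m_inv G ` B1"
  have W: "finite W" "W \<subseteq> carrier G" using fin1 car1 by (auto simp: W_def)
  have "real (card A) \<le> real (card A1) + real (card (A - A1))"
    using card_Diff_subset[OF fin1(1) sub(1)] card_mono[OF fin(1) sub(1)] by simp
  moreover have "\<tau> * N \<le> 1/4 * N" using \<tau> by (intro mult_right_mono) auto
  ultimately have A1: "real N / 2 \<le> card A1" using small N by linarith
  have cW: "real N / 2 \<le> card W" using A1 card_mono[OF W(1), of A1] by (auto simp: W_def)
  then have "W \<noteq> {}" using N(3) by auto
  have finAB: "finite (A1 <#> B1)" "A1 <#> B1 \<subseteq> carrier G"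
    using fin1 car1 by (auto simp: set_mult_def)
  let ?P = "m_inv G ` W <#> m_inv G ` W <#> m_inv G ` (m_inv G ` W <#> m_inv G ` W)"
  \<comment> \<open>Four pieces of at most \<open>2 * K ^ 3 * N\<close> elements, against at least
    \<open>N / 2\<close> elements of \<open>W\<close>, give the factor 16.\<close>
  have "card (W <#> m_inv G ` W) \<le> 16 * K ^ 3 * card W"
  proof -
    have "W <#> m_inv G ` W \<subseteq> (A1 <#> m_inv G ` A1) \<union> (A1 <#> B1) \<union>
      (m_inv G ` (A1 <#> B1) \<union> (B1 <#> m_inv G ` B1))"
    proof
      fix d assume "d \<in> W <#> m_inv G ` W"
      then obtain w w' where w: "w \<in> W" "w' \<in> W" "d = w \<otimes> inv w'" by (auto simp: set_mult_def)
      consider a a' where "a \<in> A1" "a' \<in> A1" "w = a" "w' = a'"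
        | a b where "a \<in> A1" "b \<in> B1" "w = a" "w' = inv b"
        | a b where "a \<in> A1" "b \<in> B1" "w = inv b" "w' = a"
        | b b' where "b \<in> B1" "b' \<in> B1" "w = inv b" "w' = inv b'"
        using w unfolding W_def by blast
      then show "d \<in> (A1 <#> m_inv G ` A1) \<union> (A1 <#> B1) \<union>
        (m_inv G ` (A1 <#> B1) \<union> (B1 <#> m_inv G ` B1))"
      proof cases
        case 1
        then show ?thesis using w by (auto simp: set_mult_def)
      next
        case 2
        then have "b \<in> carrier G" using car1 by auto
        then show ?thesis using w 2 by (auto simp: set_mult_def)
      next
        case 3
        then have "a \<in> carrier G" "b \<in> carrier G" using car1 by auto
        then have "d = inv (a \<otimes> b)" using w 3 by (simp add: inv_mult m_comm)
        moreover have "a \<otimes> b \<in> A1 <#> B1" using 3 by (auto simp: set_mult_def)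
        ultimately show ?thesis by blast
      next
        case 4
        then have "b \<in> carrier G" "b' \<in> carrier G" using car1 by auto
        then have "d = b' \<otimes> inv b" using w 4 by (simp add: m_comm)
        then show ?thesis using 4 by (auto simp: set_mult_def)
      qed
    qed
    then have "card (W <#> m_inv G ` W) \<le> card ((A1 <#> m_inv G ` A1) \<union> (A1 <#> B1) \<union>
      (m_inv G ` (A1 <#> B1) \<union> (B1 <#> m_inv G ` B1)))"
      using fin1 finAB by (intro card_mono) (simp_all add: finite_set_mult)
    also have "\<dots> \<le> (card (A1 <#> m_inv G ` A1) + card (A1 <#> B1)) +
      (card (m_inv G ` (A1 <#> B1)) + card (B1 <#> m_inv G ` B1))"
      by (intro order_trans[OF card_Un_le] add_mono card_Un_le)
    also have "card (m_inv G ` (A1 <#> B1)) \<le> card (A1 <#> B1)" using finAB by (intro card_image_le)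
    finally have "real (card (W <#> m_inv G ` W)) \<le> 2 * (2 * K\<^sup>2 * N) + 2 * (2 * K ^ 3 * N)"
      using AA BB AB by linarith
    moreover have "2 * K\<^sup>2 * N \<le> 2 * K ^ 3 * N"
      using K by (intro mult_right_mono mult_left_mono power_increasing) auto
    moreover have "16 * K ^ 3 * (real N / 2) = 4 * (2 * K ^ 3 * N)" by simp
    ultimately have "real (card (W <#> m_inv G ` W)) \<le> 16 * K ^ 3 * (real N / 2)" by linarith
    also have "\<dots> \<le> 16 * K ^ 3 * card W" using cW K by (intro mult_left_mono) auto
    finally show ?thesis .
  qed
  from Pluennecke_Ruzsa_double_difference[OF W \<open>W \<noteq> {}\<close> this]
  have PR: "card (?P) \<le> (16 * K ^ 3) ^ 4 * card W"
    by simp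
  have "(A1 <#> B1) <#> m_inv G ` (A1 <#> B1)
    \<subseteq> ?P"
  proof
    fix d assume "d \<in> (A1 <#> B1) <#> m_inv G ` (A1 <#> B1)"
    then obtain a b a' b' where ab: "a \<in> A1" "b \<in> B1" "a' \<in> A1" "b' \<in> B1" "d = (a \<otimes> b) \<otimes> inv (a' \<otimes> b')"
      by (auto simp: set_mult_def)
    have c: "a \<in> carrier G" "b \<in> carrier G" "a' \<in> carrier G" "b' \<in> carrier G" using ab car1 by auto
    \<comment> \<open>Additively \<open>a + b - a' - b' = (b - a') - (b' - a)\<close>, a difference
      of two elements of \<open>- W - W\<close>.\<close>
    have "d = (inv a' \<otimes> b) \<otimes> inv (inv a \<otimes> b')" using c ab(5) by (simp add: inv_mult m_ac)
    moreover have "inv a \<in> m_inv G ` W" "inv a' \<in> m_inv G ` W" using ab by (auto simp: W_def)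
    moreover have "b \<in> m_inv G ` W" "b' \<in> m_inv G ` W"
    proof -
      have "inv b \<in> W" "inv b' \<in> W" using ab by (simp_all add: W_def)
      then have "inv (inv b) \<in> m_inv G ` W" "inv (inv b') \<in> m_inv G ` W" by (simp_all only: imageI)
      then show "b \<in> m_inv G ` W" "b' \<in> m_inv G ` W" using c by simp_all
    qed
    ultimately show "d \<in> ?P"
      by (simp add: set_mult_memI)
  qed
  then have "card ((A1 <#> B1) <#> m_inv G ` (A1 <#> B1))
    \<le> card (?P)"
    using W(1) by (intro card_mono) (simp_all add: finite_set_mult)
  with PR have "card ((A1 <#> B1) <#> m_inv G ` (A1 <#> B1)) \<le> (16 * K ^ 3) ^ 4 * card W" by linarith
  also have "\<dots> \<le> (16 * K ^ 3) ^ 4 * (2 * N)"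
  proof (rule mult_left_mono)
    have "card W \<le> card A1 + card B1"
      unfolding W_def by (rule order_trans[OF card_Un_le]) (simp add: card_image_le fin1)
    also have "\<dots> \<le> N + N" using card_mono[OF fin(1) sub(1)] card_mono[OF fin(2) sub(2)] N by linarith
    finally show "real (card W) \<le> 2 * N" by simp
  qed (use K in auto)
  also have "\<dots> = 2 ^ 17 * K ^ 12 * N" by (simp add: power_mult_distrib power_mult[symmetric])
  finally have D: "card ((A1 <#> B1) <#> m_inv G ` (A1 <#> B1)) \<le> 2 ^ 17 * K ^ 12 * N" .
  have deg: "(1 - \<tau>) * N \<le> card {a \<in> A. a \<otimes> b \<in> ?C}" if b: "b \<in> B1" for b
  proof -
    have "\<Gamma>\<inverse> `` {b} \<subseteq> {a \<in> A. a \<otimes> b \<in> ?C}" using \<Gamma> by (auto simp: restricted_sumset_def)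
    then have "card (\<Gamma>\<inverse> `` {b}) \<le> card {a \<in> A. a \<otimes> b \<in> ?C}" using fin by (intro card_mono) auto
    then show ?thesis using b by (auto simp: B1_def rich_def)
  qed
  have "{(a, b) \<in> A1 \<times> B1. a \<otimes> b \<notin> ?C} \<subseteq> A \<times> B - \<Gamma>"
    using sub by (auto simp: restricted_sumset_def)
  then have "card {(a, b) \<in> A1 \<times> B1. a \<otimes> b \<notin> ?C} \<le> card (A \<times> B - \<Gamma>)"
    using fin by (intro card_mono) auto
  also have "\<dots> = N * N - card \<Gamma>"
    using card_Diff_subset[OF fin\<Gamma> \<Gamma>] N by (simp add: card_cartesian_product)
  finally have "card {(a, b) \<in> A1 \<times> B1. a \<otimes> b \<notin> ?C} + card \<Gamma> \<le> N * N"
    using card_mono[OF _ \<Gamma>] fin N by (simp add: card_cartesian_product)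
  from of_nat_mono[OF this, where 'a = real]
  have "real (card {(a, b) \<in> A1 \<times> B1. a \<otimes> b \<notin> ?C}) + real (card \<Gamma>) \<le> real (N * N)"
    unfolding of_nat_add .
  moreover have "real (N * N) - \<tau>\<^sup>2 * (real N)\<^sup>2 \<le> card \<Gamma>"
    using dense by (simp add: left_diff_distrib power2_eq_square)
  ultimately have bad: "card {(a, b) \<in> A1 \<times> B1. a \<otimes> b \<notin> ?C} \<le> \<tau>\<^sup>2 * (real N)\<^sup>2"
    by linarith
  show ?thesis
    by (rule exI[of _ A1], rule exI[of _ B1], intro conjI ballI sub small AA D deg bad)
qed

section \<open>General abelian groups: bad pairs as triangles\<close>

lemma almost_all_sumsI:
  assumes "\<And>N A B \<Gamma>. \<lbrakk>0 < N; A \<subseteq> carrier G; B \<subseteq> carrier G; finite A; finite B; card A = N; card B = N;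
    \<Gamma> \<subseteq> A \<times> B; real (card \<Gamma>) \<ge> (1 - \<delta>) * (real N)\<^sup>2;
    real (card (restricted_sumset G \<Gamma>)) \<le> K * real N\<rbrakk> \<Longrightarrow>
    large_subsets G \<epsilon> A B N (restricted_sumset G \<Gamma>)"
  shows "almost_all_sums G K \<epsilon> \<delta>"
  unfolding almost_all_sums_iff_large_subsets
proof (intro allI impI)
  fix N A B \<Gamma>
  assume *: "A \<subseteq> carrier G" "B \<subseteq> carrier G" "finite A" "finite B" "card A = N" "card B = N"
    "\<Gamma> \<subseteq> A \<times> B" "real (card \<Gamma>) \<ge> (1 - \<delta>) * (real N)\<^sup>2"
    "real (card (restricted_sumset G \<Gamma>)) \<le> K * real N"
  show "large_subsets G \<epsilon> A B N (restricted_sumset G \<Gamma>)"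
  proof (cases "N = 0")
    case True
    then show ?thesis
      unfolding large_subsets_def by (intro exI[of _ "{}"]) (simp add: set_mult_def)
  next
    case False
    then show ?thesis using assms[OF _ *] by simp
  qed
qed

text \<open>The quotient \<open>\<phi>\<close> of its end points labels an edge: by \<open>a\<close>
  in \<open>E0\<close>, by \<open>b\<close> in \<open>E1\<close>, by \<open>a \<otimes> b\<close> in
  \<open>E2\<close>. Labels with at least \<open>N / 8\<close> removed edges form the hitting sets.
  Since \<open>card V \<le> 4 * K\<^sup>2 * N\<close>, the constant \<open>256 * K ^ 4\<close> makes
  the number of removed edges at most \<open>N / 8 * (\<epsilon> / 2 * N)\<close>.\<close>

lemma (in comm_group) almost_all_sums_of_triangle_removal:
  fixes K \<epsilon> \<tau> \<delta> :: real
  assumes K: "1 \<le> K" and \<epsilon>: "0 < \<epsilon>"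
    and \<tau>: "0 < \<tau>" "\<tau> \<le> 1/4" "\<tau> \<le> \<epsilon> / 2" "\<tau>\<^sup>2 \<le> \<delta>"
    and removal: "\<And>V :: 'a set. finite V \<Longrightarrow> triangle_removable (\<epsilon> / (256 * K ^ 4)) \<delta> V"
  shows "almost_all_sums G K \<epsilon> (\<tau>\<^sup>2)"
proof (rule almost_all_sumsI)
  fix N A B \<Gamma>
  assume N0: "0 < N" and car: "A \<subseteq> carrier G" "B \<subseteq> carrier G" and fin: "finite A" "finite B"
    and N: "card A = N" "card B = N" and \<Gamma>: "\<Gamma> \<subseteq> A \<times> B"
    and dense: "real (card \<Gamma>) \<ge> (1 - \<tau>\<^sup>2) * (real N)\<^sup>2"
    and KN: "real (card (restricted_sumset G \<Gamma>)) \<le> K * real N"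
  define C where "C = restricted_sumset G \<Gamma>"
  have finC: "finite C" unfolding C_def using fin \<Gamma> by (intro finite_restricted_sumset) (auto intro: finite_subset)
  have carC: "C \<subseteq> carrier G" unfolding C_def by (rule restricted_sumset_in_carrier[OF \<Gamma> car])
  from rich_subsets[OF fin N N0 car \<Gamma> \<tau>(1,2) dense K KN] obtain A1 B1
    where sub: "A1 \<subseteq> A" "B1 \<subseteq> B" and small: "card (A - A1) \<le> \<tau> * N" "card (B - B1) \<le> \<tau> * N"
    and AA: "card (A1 <#> m_inv G ` A1) \<le> 2 * K\<^sup>2 * N"
    and deg: "\<forall>b\<in>B1. (1 - \<tau>) * N \<le> card {a \<in> A. a \<otimes> b \<in> C}"
    and bad: "card {(a, b) \<in> A1 \<times> B1. a \<otimes> b \<notin> C} \<le> \<tau>\<^sup>2 * (real N)\<^sup>2"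
    unfolding C_def[symmetric] by (elim exE conjE)
  have fin1: "finite A1" "finite B1" using sub fin finite_subset by blast+
  have car1: "A1 \<subseteq> carrier G" "B1 \<subseteq> carrier G" using sub car by blast+
  \<comment> \<open>The three pieces contain the corners \<open>y\<close>,
    \<open>y \<otimes> b\<close> and \<open>y \<otimes> inv a\<close> of the triangles that come
    from a bad pair.\<close>
  define V where "V = A \<union> C \<union> (A1 <#> m_inv G ` A1)"
  have finV: "finite V" using fin fin1 finC by (simp add: V_def finite_set_mult)
  have "A1 <#> m_inv G ` A1 \<subseteq> carrier G" using car1 by (intro set_mult_closed) auto
  then have carV: "V \<subseteq> carrier G" using car carC by (simp add: V_def)
  have VN: "N \<le> card V" unfolding N(1)[symmetric] by (rule card_mono[OF finV]) (auto simp: V_def)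
  have "card V \<le> card A + card C + card (A1 <#> m_inv G ` A1)"
    unfolding V_def by (intro order_trans[OF card_Un_le] add_mono card_Un_le order_refl)
  then have "real (card V) \<le> N + K * N + 2 * K\<^sup>2 * N" using AA KN N unfolding C_def by linarith
  also have "\<dots> \<le> 4 * K\<^sup>2 * N"
  proof -
    have "K * 1 \<le> K * K" using K by (intro mult_left_mono) auto
    then have "1 + K + 2 * K\<^sup>2 \<le> 4 * K\<^sup>2" using K unfolding power2_eq_square by linarith
    then have "(1 + K + 2 * K\<^sup>2) * N \<le> 4 * K\<^sup>2 * N" by (intro mult_right_mono) auto
    then show ?thesis by (simp add: algebra_simps)
  qed
  finally have V4: "card V \<le> 4 * K\<^sup>2 * N" .
  define E0 where "E0 = {(x, y) \<in> V \<times> V. y \<in> A1 \<and> y \<otimes> inv x \<in> A1}"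
  define E1 where "E1 = {(y, z) \<in> V \<times> V. y \<in> A1 \<and> z \<otimes> inv y \<in> B1}"
  define E2 where "E2 = {(x, z) \<in> V \<times> V. z \<otimes> inv x \<notin> C}"
  have EV: "E0 \<subseteq> V \<times> V" "E1 \<subseteq> V \<times> V" "E2 \<subseteq> V \<times> V" by (auto simp: E0_def E1_def E2_def)
  have finE: "finite E0" "finite E1" "finite E2" using EV finV by (meson finite_SigmaI finite_subset)+
  let ?T = "{(x, y, z). (x, y) \<in> E0 \<and> (y, z) \<in> E1 \<and> (x, z) \<in> E2}"
  let ?bad = "{(a, b) \<in> A1 \<times> B1. a \<otimes> b \<notin> C}"
  \<comment> \<open>A triangle is determined by \<open>y\<close> and the bad pair of its labels, so
    there are at most \<open>N\<close> times as many triangles as bad pairs.\<close>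
  let ?m = "\<lambda>(x, y, z). (y, y \<otimes> inv x, z \<otimes> inv y)"
  have recover: "v = v'" if "u \<otimes> inv v = u \<otimes> inv v'" "u \<in> carrier G" "v \<in> carrier G" "v' \<in> carrier G" for u v v'
  proof -
    have "inv v = inv v'" using that by simp
    then have "inv (inv v) = inv (inv v')" by (rule arg_cong)
    then show ?thesis using that by simp
  qed
  have "inj_on ?m ?T"
  proof (rule inj_onI)
    fix s t assume st: "s \<in> ?T" "t \<in> ?T" "?m s = ?m t"
    obtain x y z x' y' z' where xyz: "s = (x, y, z)" "t = (x', y', z')" by (cases s, cases t)
    have c: "x \<in> carrier G" "y \<in> carrier G" "z \<in> carrier G" "x' \<in> carrier G" "z' \<in> carrier G"
      using st(1,2) EV carV by (auto simp: xyz)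
    have e: "y' = y" "y \<otimes> inv x = y \<otimes> inv x'" "z \<otimes> inv y = z' \<otimes> inv y" using st(3) by (auto simp: xyz)
    show "s = t" unfolding xyz using e(1) recover[OF e(2)] e(3) c by simp
  qed
  moreover have "?m ` ?T \<subseteq> A1 \<times> ?bad"
  proof (rule image_subsetI)
    fix t assume t: "t \<in> ?T"
    obtain x y z where xyz: "t = (x, y, z)" by (cases t)
    have c: "x \<in> carrier G" "y \<in> carrier G" "z \<in> carrier G" using t EV carV by (auto simp: xyz)
    have "(y \<otimes> inv x) \<otimes> (z \<otimes> inv y) = (z \<otimes> inv x) \<otimes> (y \<otimes> inv y)" using c by (simp only: m_ac m_closed inv_closed)
    then have "(y \<otimes> inv x) \<otimes> (z \<otimes> inv y) = z \<otimes> inv x" using c by simp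
    then show "?m t \<in> A1 \<times> ?bad" using t by (simp add: xyz E0_def E1_def E2_def)
  qed
  moreover have "finite ?bad" by (rule finite_subset[of _ "A1 \<times> B1"]) (use fin1 in auto)
  then have "finite (A1 \<times> ?bad)" using fin1 by simp
  ultimately have "card ?T \<le> card (A1 \<times> ?bad)" by (rule card_inj_on_le)
  from of_nat_mono[OF this[unfolded card_cartesian_product], where 'a = real]
  have "real (card ?T) \<le> real (card A1) * card ?bad" unfolding of_nat_mult .
  also have "\<dots> \<le> N * (\<tau>\<^sup>2 * (real N)\<^sup>2)"
    using card_mono[OF fin(1) sub(1)] N bad by (intro mult_mono) auto
  also have "\<dots> = \<tau>\<^sup>2 * real N ^ 3" by (simp add: eval_nat_numeral)
  also have "\<dots> \<le> \<delta> * real (card V) ^ 3"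
    using \<tau> VN order_trans[OF zero_le_power2 \<tau>(4)] by (intro mult_mono power_mono) auto
  finally have few: "card ?T \<le> \<delta> * card V ^ 3" by simp
  from removal[OF finV, unfolded triangle_removable_def, rule_format, OF EV few]
  obtain F0 F1 F2 where FE: "F0 \<subseteq> E0" "F1 \<subseteq> E1" "F2 \<subseteq> E2"
    and F: "card F0 \<le> \<epsilon> / (256 * K ^ 4) * (card V)\<^sup>2" "card F1 \<le> \<epsilon> / (256 * K ^ 4) * (card V)\<^sup>2"
      "card F2 \<le> \<epsilon> / (256 * K ^ 4) * (card V)\<^sup>2"
    and cover: "\<forall>x y z. (x, y) \<in> E0 \<longrightarrow> (y, z) \<in> E1 \<longrightarrow> (x, z) \<in> E2 \<longrightarrow>
          (x, y) \<in> F0 \<or> (y, z) \<in> F1 \<or> (x, z) \<in> F2"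
    by (elim exE conjE)
  have finF: "finite F0" "finite F1" "finite F2" using FE finE finite_subset by blast+
  have size: "\<epsilon> / (256 * K ^ 4) * (card V)\<^sup>2 \<le> N / 8 * (\<epsilon> / 2 * N)"
  proof -
    have "\<epsilon> / (256 * K ^ 4) * (card V)\<^sup>2 \<le> \<epsilon> / (256 * K ^ 4) * (4 * K\<^sup>2 * N)\<^sup>2"
      unfolding of_nat_power using V4 \<epsilon> K by (intro mult_left_mono power_mono) auto
    also have "\<dots> = N / 8 * (\<epsilon> / 2 * N)"
      using K by (simp add: power_mult_distrib power2_eq_square eval_nat_numeral)
    finally show ?thesis .
  qed
  define \<phi> where "\<phi> = (\<lambda>(u, v). v \<otimes> inv u)"
  have pop: "finite {d \<in> S. N / 8 \<le> card {e \<in> F. \<phi> e = d}} \<and>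
    card {d \<in> S. N / 8 \<le> card {e \<in> F. \<phi> e = d}} \<le> \<epsilon> / 2 * N"
    if "finite S" "finite F" "card F \<le> \<epsilon> / (256 * K ^ 4) * (card V)\<^sup>2" for S F
  proof -
    have "N / 8 * card {d \<in> S. N / 8 \<le> card {e \<in> F. \<phi> e = d}} \<le> card F"
      using that by (intro card_mult_le_if_fibres_large[where \<phi> = \<phi>]) auto
    also have "\<dots> \<le> N / 8 * (\<epsilon> / 2 * N)" using that size by linarith
    finally show ?thesis using N0 that(1) by (subst (asm) mult_le_cancel_left_pos) auto
  qed
  define RA where "RA = {d \<in> A1. N / 8 \<le> card {e \<in> F0. \<phi> e = d}}"
  define RB where "RB = {d \<in> B1. N / 8 \<le> card {e \<in> F1. \<phi> e = d}}"
  define RC where "RC = {d \<in> A1 <#> B1. N / 8 \<le> card {e \<in> F2. \<phi> e = d}}"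
  have finAB: "finite (A1 <#> B1)" using fin1 by (simp add: set_mult_def)
  have R: "finite RA" "finite RB" "finite RC" "card RA \<le> \<epsilon> / 2 * N" "card RB \<le> \<epsilon> / 2 * N" "card RC \<le> \<epsilon> / 2 * N"
    using pop[OF fin1(1) finF(1) F(1)] pop[OF fin1(2) finF(2) F(2)] pop[OF finAB finF(3) F(3)]
    unfolding RA_def RB_def RC_def by blast+
  have hit: "a \<in> RA \<or> b \<in> RB \<or> a \<otimes> b \<in> RC" if ab: "a \<in> A1" "b \<in> B1" "a \<otimes> b \<notin> C" for a b
  proof (rule ccontr)
    assume no: "\<not> ?thesis"
    have abc: "a \<in> carrier G" "b \<in> carrier G" using ab car1 by auto
    have "a \<otimes> b \<in> A1 <#> B1" using ab by (auto simp: set_mult_def)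
    then have lt: "card {e \<in> F0. \<phi> e = a} < real N / 8" "card {e \<in> F1. \<phi> e = b} < real N / 8"
      "card {e \<in> F2. \<phi> e = a \<otimes> b} < real N / 8"
      using no ab by (auto simp: RA_def RB_def RC_def)
    \<comment> \<open>The condition \<open>y \<otimes> b \<in> C\<close> places the third corner in
      \<open>V\<close>. At least \<open>(1 - \<tau>) * N\<close> elements of \<open>A\<close>
      satisfy it, and at most \<open>\<tau> * N\<close> of these lie outside
      \<open>A1\<close>.\<close>
    define Y where "Y = {y \<in> A1. y \<otimes> b \<in> C}"
    have finY: "finite Y" using fin1 by (simp add: Y_def)
    have Yc: "Y \<subseteq> carrier G" using car1 by (auto simp: Y_def)
    have "card {y \<in> A. y \<otimes> b \<in> C} \<le> card (Y \<union> (A - A1))" using fin finY by (intro card_mono) (auto simp: Y_def)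
    also have "\<dots> \<le> card Y + card (A - A1)" by (rule card_Un_le)
    finally have "(1 - \<tau>) * N \<le> card Y + \<tau> * N" using deg[rule_format, OF ab(2)] small by linarith
    moreover have "\<tau> * N \<le> 1/4 * N" using \<tau> by (intro mult_right_mono) auto
    ultimately have Y: "real N / 2 \<le> card Y" by (simp add: left_diff_distrib)
    \<comment> \<open>This is the edge-disjointness of the triangles: an edge of the family comes
      from only one \<open>y\<close>.\<close>
    have inj: "card {y \<in> Y. (g y, h y) \<in> F} \<le> card {e \<in> F. \<phi> e = d}"
      if "finite F" "\<And>y. y \<in> Y \<Longrightarrow> \<phi> (g y, h y) = d" "inj_on g Y \<or> inj_on h Y" for F d and g h :: "'a \<Rightarrow> 'a"
    proof (rule card_inj_on_le[of "\<lambda>y. (g y, h y)"])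
      show "inj_on (\<lambda>y. (g y, h y)) {y \<in> Y. (g y, h y) \<in> F}"
        using that(3) by (auto simp: inj_on_def)
    qed (use that(1,2) in auto)
    have i1: "inj_on (\<lambda>y. y) Y" by simp
    have i2: "inj_on (\<lambda>y. y \<otimes> inv a) Y" using abc by (auto intro!: inj_onI simp: subsetD[OF Yc])
    have p0: "\<phi> (y \<otimes> inv a, y) = a" and p1: "\<phi> (y, y \<otimes> b) = b" and p2: "\<phi> (y \<otimes> inv a, y \<otimes> b) = a \<otimes> b"
      if "y \<in> Y" for y
    proof -
      have y: "y \<in> carrier G" using that Yc by auto
      have "y \<otimes> inv (y \<otimes> inv a) = a \<otimes> (y \<otimes> inv y)" using y abc by (simp only: inv_mult inv_inv m_ac m_closed inv_closed)
      then show "\<phi> (y \<otimes> inv a, y) = a" using y abc by (simp add: \<phi>_def)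
      have "y \<otimes> b \<otimes> inv y = b \<otimes> (y \<otimes> inv y)" using y abc by (simp only: m_ac m_closed inv_closed)
      then show "\<phi> (y, y \<otimes> b) = b" using y abc by (simp add: \<phi>_def)
      have "y \<otimes> b \<otimes> inv (y \<otimes> inv a) = a \<otimes> b \<otimes> (y \<otimes> inv y)" using y abc by (simp only: inv_mult inv_inv m_ac m_closed inv_closed)
      then show "\<phi> (y \<otimes> inv a, y \<otimes> b) = a \<otimes> b" using y abc by (simp add: \<phi>_def)
    qed
    let ?Y0 = "{y \<in> Y. (y \<otimes> inv a, y) \<in> F0}" and ?Y1 = "{y \<in> Y. (y, y \<otimes> b) \<in> F1}"
      and ?Y2 = "{y \<in> Y. (y \<otimes> inv a, y \<otimes> b) \<in> F2}"
    have "Y \<subseteq> ?Y0 \<union> (?Y1 \<union> ?Y2)"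
    proof
      fix y assume y: "y \<in> Y"
      have yA: "y \<in> A1" "y \<otimes> b \<in> C" using y by (auto simp: Y_def)
      have "y \<otimes> inv a \<in> A1 <#> m_inv G ` A1" using yA ab by (auto simp: set_mult_def)
      then have V: "y \<in> V" "y \<otimes> b \<in> V" "y \<otimes> inv a \<in> V" using yA sub by (auto simp: V_def)
      have "(y \<otimes> inv a, y) \<in> E0" using V yA p0[OF y] ab by (simp add: E0_def \<phi>_def)
      moreover have "(y, y \<otimes> b) \<in> E1" using V yA p1[OF y] ab by (simp add: E1_def \<phi>_def)
      moreover have "(y \<otimes> inv a, y \<otimes> b) \<in> E2" using V p2[OF y] ab by (simp add: E2_def \<phi>_def)
      ultimately show "y \<in> ?Y0 \<union> (?Y1 \<union> ?Y2)"
        using cover[rule_format, of "y \<otimes> inv a" y "y \<otimes> b"] y by blast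
    qed
    then have "card Y \<le> card (?Y0 \<union> (?Y1 \<union> ?Y2))"
      using finY by (intro card_mono) auto
    also have "\<dots> \<le> card ?Y0 + (card ?Y1 + card ?Y2)"
      by (intro order_trans[OF card_Un_le] add_mono card_Un_le order_refl)
    also have "\<dots> \<le> card {e \<in> F0. \<phi> e = a} + (card {e \<in> F1. \<phi> e = b} + card {e \<in> F2. \<phi> e = a \<otimes> b})"
      by (intro add_mono inj[OF finF(1)] inj[OF finF(2)] inj[OF finF(3)] p0 p1 p2) (use i1 i2 in simp_all)
    finally show False using lt Y N0 by linarith
  qed
  have small': "card (A - A1) \<le> \<epsilon> / 2 * N" "card (B - B1) \<le> \<epsilon> / 2 * N"
    using small \<tau>(3) mult_right_mono[OF \<tau>(3), of "real N"] by linarith+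
  have "real (card RC) \<le> \<epsilon> * N" using R(6) \<epsilon> by simp
  from conclusion_from_hitting_sets[OF fin finC N sub small' R(1-5) this hit]
  show "large_subsets G \<epsilon> A B N (restricted_sumset G \<Gamma>)"
    unfolding C_def by blast
qed

lemma exists_delta_all_comm_groups:
  fixes K \<epsilon> :: real
  assumes K: "1 \<le> K" and \<epsilon>: "0 < \<epsilon>"
  shows "\<exists>\<delta>>0. \<forall>G :: 'a monoid. comm_group G \<longrightarrow> almost_all_sums G K \<epsilon> \<delta>"
proof -
  have "0 < \<epsilon> / (256 * K ^ 4)" using K \<epsilon> by simp
  obtain \<delta> where \<delta>: "0 < \<delta>"
    "\<And>V :: 'a set. finite V \<Longrightarrow> triangle_removable (\<epsilon> / (256 * K ^ 4)) \<delta> V"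
    using triangle_removal[OF \<open>0 < \<epsilon> / (256 * K ^ 4)\<close>, where 'v = 'a] by blast
  define \<tau> where "\<tau> = min (min (1/4) (\<epsilon> / 2)) (sqrt \<delta>)"
  have \<tau>: "0 < \<tau>" "\<tau> \<le> 1/4" "\<tau> \<le> \<epsilon> / 2" "\<tau> \<le> sqrt \<delta>" using \<epsilon> \<delta>(1) by (auto simp: \<tau>_def)
  have "\<tau>\<^sup>2 \<le> (sqrt \<delta>)\<^sup>2" using \<tau> by (intro power_mono) auto
  then have "\<tau>\<^sup>2 \<le> \<delta>" using \<delta>(1) by simp
  then have "almost_all_sums G K \<epsilon> (\<tau>\<^sup>2)" if "comm_group G" for G :: "'a monoid"
    by (intro comm_group.almost_all_sums_of_triangle_removal[OF that K \<epsilon> \<tau>(1-3) _ \<delta>(2)])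
  then show ?thesis using \<tau>(1) by (intro exI[of _ "\<tau>\<^sup>2"]) simp
qed

section \<open>Reduction to groups on the natural numbers\<close>

lemma almost_all_sums_inj_hom:
  assumes inj: "inj_on f (carrier G)" and into: "f ` carrier G \<subseteq> carrier H"
    and closed: "\<And>x y. \<lbrakk>x \<in> carrier G; y \<in> carrier G\<rbrakk> \<Longrightarrow> x \<otimes>\<^bsub>G\<^esub> y \<in> carrier G"
    and hom: "\<And>x y. \<lbrakk>x \<in> carrier G; y \<in> carrier G\<rbrakk> \<Longrightarrow> f (x \<otimes>\<^bsub>G\<^esub> y) = f x \<otimes>\<^bsub>H\<^esub> f y"
    and H: "almost_all_sums H K \<epsilon> \<delta>"
  shows "almost_all_sums G K \<epsilon> \<delta>"
  unfolding almost_all_sums_iff_large_subsets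
proof (intro allI impI)
  fix N A B \<Gamma>
  assume car: "A \<subseteq> carrier G" "B \<subseteq> carrier G" and fin: "finite A" "finite B"
    and N: "card A = N" "card B = N" and \<Gamma>: "\<Gamma> \<subseteq> A \<times> B"
    and dense: "real (card \<Gamma>) \<ge> (1 - \<delta>) * (real N)\<^sup>2"
    and KN: "real (card (restricted_sumset G \<Gamma>)) \<le> K * real N"
  have injS: "card (f ` S) = card S" if "S \<subseteq> carrier G" for S
    using inj that by (intro card_image) (rule inj_on_subset)
  have rs: "restricted_sumset H (map_prod f f ` \<Gamma>) = f ` restricted_sumset G \<Gamma>"
  proof (intro equalityI subsetI)
    fix c assume "c \<in> restricted_sumset H (map_prod f f ` \<Gamma>)"
    then obtain a b where ab: "(a, b) \<in> \<Gamma>" "c = f a \<otimes>\<^bsub>H\<^esub> f b"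
      by (auto simp: restricted_sumset_def)
    then have "c = f (a \<otimes>\<^bsub>G\<^esub> b)" using \<Gamma> car by (subst hom) auto
    then show "c \<in> f ` restricted_sumset G \<Gamma>" using ab by (auto simp: restricted_sumset_def)
  next
    fix c assume "c \<in> f ` restricted_sumset G \<Gamma>"
    then obtain a b where ab: "(a, b) \<in> \<Gamma>" "c = f (a \<otimes>\<^bsub>G\<^esub> b)"
      by (auto simp: restricted_sumset_def)
    then have "c = f a \<otimes>\<^bsub>H\<^esub> f b" using \<Gamma> car by (subst hom[symmetric]) auto
    moreover have "(f a, f b) \<in> map_prod f f ` \<Gamma>" using ab(1) by force
    ultimately show "c \<in> restricted_sumset H (map_prod f f ` \<Gamma>)"
      unfolding restricted_sumset_def mem_Collect_eq by (intro exI conjI)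
  qed
  have "inj_on (map_prod f f) (carrier G \<times> carrier G)" using inj by (intro map_prod_inj_on)
  moreover have "\<Gamma> \<subseteq> carrier G \<times> carrier G" using \<Gamma> car by auto
  ultimately have "inj_on (map_prod f f) \<Gamma>" by (rule inj_on_subset)
  then have c\<Gamma>: "card (map_prod f f ` \<Gamma>) = card \<Gamma>" by (rule card_image)
  have rsc: "restricted_sumset G \<Gamma> \<subseteq> carrier G"
    using \<Gamma> car closed by (force simp: restricted_sumset_def)
  have "f ` A \<subseteq> carrier H" "f ` B \<subseteq> carrier H" using car into by auto
  moreover have "map_prod f f ` \<Gamma> \<subseteq> f ` A \<times> f ` B" using \<Gamma> by auto
  ultimately obtain A' B' where AB: "A' \<subseteq> f ` A" "B' \<subseteq> f ` B" "real (card A') \<ge> (1 - \<epsilon>) * real N"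
    "real (card B') \<ge> (1 - \<epsilon>) * real N"
    "real (card (A' <#>\<^bsub>H\<^esub> B')) \<le> real (card (restricted_sumset G \<Gamma>)) + \<epsilon> * real N"
    using H[unfolded almost_all_sums_def, rule_format, of "f ` A" "f ` B" N "map_prod f f ` \<Gamma>"]
      fin N dense KN car by (auto simp: injS rs c\<Gamma> rsc)
  obtain A'' B'' where A'': "A'' \<subseteq> A" "A' = f ` A''" and B'': "B'' \<subseteq> B" "B' = f ` B''"
    using AB(1,2) by (meson subset_imageE)
  have "A' <#>\<^bsub>H\<^esub> B' = f ` (A'' <#>\<^bsub>G\<^esub> B'')"
    unfolding A''(2) B''(2) set_mult_def image_UN using A''(1) B''(1) car hom
    by (auto simp: subset_iff) 
  moreover have "A'' <#>\<^bsub>G\<^esub> B'' \<subseteq> carrier G"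
    using A''(1) B''(1) car closed by (auto simp: set_mult_def subset_iff)
  ultimately have "card (A' <#>\<^bsub>H\<^esub> B') = card (A'' <#>\<^bsub>G\<^esub> B'')" by (simp add: injS)
  moreover have "card A' = card A''" "card B' = card B''"
    using A'' B'' car by (simp_all add: injS)
  ultimately show "large_subsets G \<epsilon> A B N (restricted_sumset G \<Gamma>)"
    unfolding large_subsets_def using A''(1) B''(1) AB(3-5) by (intro exI conjI) simp_all
qed

text \<open>In \<open>generate\<close> inverses are taken of generators only, so closing the unit,
  the generators and their inverses under products exhausts it, in countably many stages
  \<open>U i\<close>.\<close>

lemma countable_generate:
  assumes S: "countable S"
  shows "countable (generate G S)"
proof -
  define U where "U i = ((\<lambda>T. T \<union> (\<lambda>(x, y). x \<otimes>\<^bsub>G\<^esub> y) ` (T \<times> T)) ^^ i) ({\<one>\<^bsub>G\<^esub>} \<union> S \<union> m_inv G ` S)" for i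
  have U_Suc: "U (Suc i) = U i \<union> (\<lambda>(x, y). x \<otimes>\<^bsub>G\<^esub> y) ` (U i \<times> U i)" for i by (simp add: U_def)
  have mono: "U i \<subseteq> U (i + j)" for i j by (induction j) (auto simp: U_Suc)
  have "countable (U i)" for i
  proof (induction i)
    case 0
    then show ?case using S by (simp add: U_def)
  next
    case (Suc i)
    then show ?case unfolding U_Suc by (intro countable_Un countable_image countable_SIGMA)
  qed
  then have "countable (\<Union>i. U i)" by simp
  moreover have "generate G S \<subseteq> (\<Union>i. U i)"
  proof
    fix x assume "x \<in> generate G S"
    then show "x \<in> (\<Union>i. U i)"
    proof (induction rule: generate.induct)
      case one
      then show ?case by (intro UN_I[of 0]) (auto simp: U_def)
    next
      case (incl h)
      then show ?case by (intro UN_I[of 0]) (auto simp: U_def)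
    next
      case (inv h)
      then show ?case by (intro UN_I[of 0]) (auto simp: U_def)
    next
      case (eng h1 h2)
      then obtain i j where "h1 \<in> U i" "h2 \<in> U j" by blast
      then have "h1 \<in> U (i + j)" "h2 \<in> U (i + j)" using mono[of i j] mono[of j i] by (auto simp: add.commute)
      then have "h1 \<otimes>\<^bsub>G\<^esub> h2 \<in> U (Suc (i + j))" by (auto simp: U_Suc)
      then show ?case by blast
    qed
  qed
  ultimately show ?thesis by (rule countable_subset[rotated])
qed

text \<open>Each instance lives in the subgroup generated by the finite set
  \<open>A \<union> B\<close>, which is countable and so isomorphic to a group carried by a subset
  of \<open>nat\<close>.\<close>

lemma (in comm_group) almost_all_sums_from_nat:
  assumes nat: "\<And>H :: nat monoid. comm_group H \<Longrightarrow> almost_all_sums H K \<epsilon> \<delta>"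
  shows "almost_all_sums G K \<epsilon> \<delta>"
  unfolding almost_all_sums_iff_large_subsets
proof (intro allI impI)
  fix N A B \<Gamma>
  assume car: "A \<subseteq> carrier G" "B \<subseteq> carrier G" and fin: "finite A" "finite B"
    and N: "card A = N" "card B = N" and \<Gamma>: "\<Gamma> \<subseteq> A \<times> B"
    and dense: "real (card \<Gamma>) \<ge> (1 - \<delta>) * (real N)\<^sup>2"
    and KN: "real (card (restricted_sumset G \<Gamma>)) \<le> K * real N"
  define S where "S = generate G (A \<union> B)"
  define G1 where "G1 = G\<lparr>carrier := S\<rparr>"
  have S: "subgroup S G" unfolding S_def using car by (intro generate_is_subgroup) auto
  have Sc: "S \<subseteq> carrier G" using S by (rule subgroup.subset)
  have S_closed: "x \<otimes> y \<in> S" "inv x \<in> S" "\<one> \<in> S" if "x \<in> S" "y \<in> S" for x y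
    using S that by (auto intro: subgroup.m_closed subgroup.m_inv_closed subgroup.one_closed)
  have one: "\<one> \<in> S" using S by (rule subgroup.one_closed)
  have AS: "A \<subseteq> S" "B \<subseteq> S" unfolding S_def by (auto intro: generate.incl)
  have "countable S" unfolding S_def using fin by (intro countable_generate) (simp add: countable_finite)
  define f where "f = to_nat_on S"
  define g where "g = inv_into S f"
  have inj: "inj_on f S" unfolding f_def using \<open>countable S\<close> by (rule inj_on_to_nat_on)
  have gf: "g (f x) = x" if "x \<in> S" for x unfolding g_def using inj that by simp
  define H :: "nat monoid" where "H = \<lparr>carrier = f ` S, monoid.mult = (\<lambda>u v. f (g u \<otimes> g v)), one = f \<one>\<rparr>"
  have "comm_group H"
  proof (rule comm_groupI)
    fix u v w assume "u \<in> carrier H" "v \<in> carrier H" "w \<in> carrier H"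
    then obtain x y z where xyz: "x \<in> S" "y \<in> S" "z \<in> S" "u = f x" "v = f y" "w = f z"
      by (auto simp: H_def)
    have c: "x \<in> carrier G" "y \<in> carrier G" "z \<in> carrier G" using xyz Sc by auto
    show "u \<otimes>\<^bsub>H\<^esub> v \<otimes>\<^bsub>H\<^esub> w = u \<otimes>\<^bsub>H\<^esub> (v \<otimes>\<^bsub>H\<^esub> w)"
      using xyz c by (simp add: H_def gf S_closed m_assoc)
  next
    fix u v assume "u \<in> carrier H" "v \<in> carrier H"
    then obtain x y where xy: "x \<in> S" "y \<in> S" "u = f x" "v = f y" by (auto simp: H_def)
    have c: "x \<in> carrier G" "y \<in> carrier G" using xy Sc by auto
    show "u \<otimes>\<^bsub>H\<^esub> v \<in> carrier H" using xy by (simp add: H_def gf S_closed)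
    show "u \<otimes>\<^bsub>H\<^esub> v = v \<otimes>\<^bsub>H\<^esub> u" using xy c by (simp add: H_def gf m_comm)
  next
    show "\<one>\<^bsub>H\<^esub> \<in> carrier H" using one by (simp add: H_def)
  next
    fix u assume "u \<in> carrier H"
    then obtain x where x: "x \<in> S" "u = f x" by (auto simp: H_def)
    have c: "x \<in> carrier G" using x Sc by auto
    show "\<one>\<^bsub>H\<^esub> \<otimes>\<^bsub>H\<^esub> u = u" using x c one by (simp add: H_def gf)
    show "\<exists>v\<in>carrier H. v \<otimes>\<^bsub>H\<^esub> u = \<one>\<^bsub>H\<^esub>"
      using x c S_closed(2)[OF x(1) x(1)] by (intro bexI[of _ "f (inv x)"]) (simp_all add: H_def gf)
  qed
  then have "almost_all_sums G1 K \<epsilon> \<delta>"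
    using S_closed inj by (intro almost_all_sums_inj_hom[OF _ _ _ _ nat, of f G1 H]) (auto simp: G1_def H_def gf)
  then have "large_subsets G1 \<epsilon> A B N (restricted_sumset G1 \<Gamma>)"
    unfolding almost_all_sums_iff_large_subsets
    using AS fin N \<Gamma> dense KN by (simp add: G1_def restricted_sumset_def)
  then show "large_subsets G \<epsilon> A B N (restricted_sumset G \<Gamma>)"
    by (simp add: G1_def restricted_sumset_def large_subsets_def)
qed

section \<open>Vector spaces over the prime field\<close>

text \<open>Coordinates are dropped one at a time. In dimension \<open>n + 1\<close> there are
  \<open>p ^ n\<close> directions \<open>(v, 1)\<close> to project along and each member of
  \<open>D\<close> forbids at most one, so a good one exists while \<open>card D < p ^ n\<close>.
  Once this fails the dimension \<open>n + 1\<close> is kept, which explains the spare factor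
  \<open>p\<close>.\<close>

lemma exists_injective_reduction:
  fixes D :: "(nat \<Rightarrow> int) set"
  assumes p: "Factorial_Ring.prime p" and D: "finite D" "D \<noteq> {}"
  shows "\<exists>m \<pi>. p ^ m \<le> p * card D \<and>
    (\<forall>x y :: nat \<Rightarrow> int. \<forall>i. \<pi> (\<lambda>j. x j + y j) i = \<pi> x i + (\<pi> y i :: int)) \<and>
    (\<forall>x. (\<forall>j<n. int p dvd x j) \<longrightarrow> (\<forall>i<m. int p dvd \<pi> x i)) \<and>
    (\<forall>d\<in>D. (\<forall>i<m. int p dvd \<pi> d i) \<longrightarrow> (\<forall>j<n. int p dvd d j))"
  using D
proof (induction n arbitrary: D)
  case 0
  have "1 \<le> p * card D" using 0 p prime_gt_0_nat[OF p] by (simp add: Suc_le_eq card_gt_0_iff)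
  then show ?case by (intro exI[of _ "0 :: nat"] exI[of _ "\<lambda>x. x"]) simp
next
  case (Suc n)
  show ?case
  proof (cases "p ^ n \<le> card D")
    case True
    then have "p ^ Suc n \<le> p * card D" by simp
    then show ?thesis by (intro exI[of _ "Suc n"] exI[of _ "\<lambda>x. x"]) simp
  next
    case False
    define \<Lambda> where "\<Lambda> = {..<n} \<rightarrow>\<^sub>E {0..<int p}"
    \<comment> \<open>Project along \<open>(v, 1)\<close>; this is injective on \<open>D\<close> unless \<open>(v, 1)\<close> is proportional to some \<open>d \<in> D\<close>.\<close>
    define bad where "bad v d \<longleftrightarrow> \<not> int p dvd d n \<and> (\<forall>i<n. int p dvd d i - d n * v i)" for v d :: "nat \<Rightarrow> int"
    have uniq: "v = v'" if v: "v \<in> \<Lambda>" "v' \<in> \<Lambda>" and b: "bad v d" "bad v' d" for v v' d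
    proof (rule PiE_ext[of v "{..<n}" "\<lambda>_. {0..<int p}" v'])
      fix i assume "i \<in> {..<n}"
      then have i: "i < n" by simp
      have "int p dvd (d i - d n * v' i) - (d i - d n * v i)"
        by (rule dvd_diff) (use b i in \<open>simp_all add: bad_def\<close>)
      then have "int p dvd d n * (v i - v' i)" by (simp add: algebra_simps)
      moreover have "Factorial_Ring.prime (int p)" using p by simp
      ultimately have "int p dvd v i - v' i" using b(1) by (simp add: bad_def prime_dvd_mult_iff)
      then have "v i mod int p = v' i mod int p" by (simp add: mod_eq_dvd_iff)
      moreover have "v i \<in> {0..<int p}" "v' i \<in> {0..<int p}"
        by (rule PiE_mem[OF v(1)[unfolded \<Lambda>_def]] PiE_mem[OF v(2)[unfolded \<Lambda>_def]], simp add: i)+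
      ultimately show "v i = v' i" by simp
    qed (use v in \<open>simp_all add: \<Lambda>_def\<close>)
    define Bad where "Bad = {v \<in> \<Lambda>. \<exists>d\<in>D. bad v d}"
    define ch where "ch v = (SOME d. d \<in> D \<and> bad v d)" for v
    have ch: "ch v \<in> D" "bad v (ch v)" if "v \<in> Bad" for v
    proof -
      have "\<exists>d. d \<in> D \<and> bad v d" using that by (auto simp: Bad_def)
      from someI_ex[OF this] show "ch v \<in> D" "bad v (ch v)" by (simp_all add: ch_def)
    qed
    have "inj_on ch Bad"
    proof (rule inj_onI)
      fix v v' assume "v \<in> Bad" "v' \<in> Bad" "ch v = ch v'"
      then show "v = v'" using uniq[of v v' "ch v"] ch[of v] ch[of v'] by (simp add: Bad_def)
    qed
    then have "card Bad \<le> card D" using ch Suc.prems(1) by (intro card_inj_on_le) auto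
    moreover have "card \<Lambda> = p ^ n" by (simp add: \<Lambda>_def card_funcsetE)
    ultimately have "Bad \<noteq> \<Lambda>" using False by auto
    then obtain v where v: "v \<in> \<Lambda>" "v \<notin> Bad" by (auto simp: Bad_def)
    define \<pi>1 where "\<pi>1 x i = x i - x n * v i" for x :: "nat \<Rightarrow> int" and i
    have ker: "\<forall>j<Suc n. int p dvd d j" if d: "d \<in> D" and k: "\<forall>i<n. int p dvd \<pi>1 d i" for d
    proof -
      have "\<not> bad v d" using v d by (auto simp: Bad_def)
      then have "int p dvd d n" using k by (auto simp: bad_def \<pi>1_def)
      moreover have "int p dvd d i" if "i < n" for i
      proof -
        have "int p dvd \<pi>1 d i + d n * v i" using k that \<open>int p dvd d n\<close> by (intro dvd_add) auto
        then show ?thesis by (simp add: \<pi>1_def)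
      qed
      ultimately show ?thesis by (simp add: less_Suc_eq all_conj_distrib)
    qed
    have fD: "finite (\<pi>1 ` D)" "\<pi>1 ` D \<noteq> {}" using Suc.prems by auto
    from Suc.IH[OF fD] obtain m \<pi> where m: "p ^ m \<le> p * card (\<pi>1 ` D)"
      and add: "\<forall>x y :: nat \<Rightarrow> int. \<forall>i. \<pi> (\<lambda>j. x j + y j) i = \<pi> x i + (\<pi> y i :: int)"
      and div: "\<forall>x. (\<forall>j<n. int p dvd x j) \<longrightarrow> (\<forall>i<m. int p dvd \<pi> x i)"
      and inj: "\<forall>d\<in>\<pi>1 ` D. (\<forall>i<m. int p dvd \<pi> d i) \<longrightarrow> (\<forall>j<n. int p dvd d j)"
      by (elim exE conjE)
    have "p * card (\<pi>1 ` D) \<le> p * card D" using Suc.prems(1) by (intro mult_left_mono card_image_le) auto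
    with m have m': "p ^ m \<le> p * card D" by linarith
    have add1: "\<pi>1 (\<lambda>j. x j + y j) = (\<lambda>i. \<pi>1 x i + \<pi>1 y i)" for x y
      by (simp add: \<pi>1_def fun_eq_iff algebra_simps)
    have "\<pi> (\<pi>1 (\<lambda>j. x j + y j)) i = \<pi> (\<pi>1 x) i + \<pi> (\<pi>1 y) i" for x y i
      unfolding add1 using add by blast
    moreover have "int p dvd \<pi> (\<pi>1 x) i" if "\<forall>j<Suc n. int p dvd x j" "i < m" for x i
    proof -
      have "\<forall>j<n. int p dvd \<pi>1 x j" unfolding \<pi>1_def using that by (intro allI impI dvd_diff dvd_mult2) auto
      then show ?thesis using div that by blast
    qed
    moreover have "\<forall>j<Suc n. int p dvd d j" if "d \<in> D" "\<forall>i<m. int p dvd \<pi> (\<pi>1 d) i" for d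
      using ker[OF that(1)] inj that by blast
    ultimately show ?thesis using m' by (intro exI[of _ m] exI[of _ "\<lambda>x. \<pi> (\<pi>1 x)"]) blast
  qed
qed

lemma carrier_Fp_power: "0 < p \<Longrightarrow> carrier (Fp_power p n) = {..<n} \<rightarrow>\<^sub>E {0..<int p}"
  by (simp add: Fp_power_def carrier_integer_mod_group)

lemma mult_Fp_power: "j < n \<Longrightarrow> (x \<otimes>\<^bsub>Fp_power p n\<^esub> y) j = (x j + y j) mod int p"
  by (simp add: Fp_power_def)

lemma inv_Fp_power:
  assumes "x \<in> carrier (Fp_power p n)" "j < n"
  shows "(inv\<^bsub>Fp_power p n\<^esub> x) j = (- x j) mod int p"
proof -
  have x: "x \<in> (\<Pi>\<^sub>E i\<in>{..<n}. carrier (integer_mod_group p))" using assms(1) by (simp add: Fp_power_def)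
  then have "x j \<in> carrier (integer_mod_group p)" using assms(2) by (auto simp: PiE_iff)
  then show ?thesis using x assms(2) unfolding Fp_power_def by (simp add: inv_product_group)
qed

lemma Fp_power_eqI:
  assumes "0 < p" "x \<in> carrier (Fp_power p n)" "y \<in> carrier (Fp_power p n)"
    and "\<And>j. j < n \<Longrightarrow> [x j = y j] (mod int p)"
  shows "x = y"
proof -
  have PiE: "x \<in> {..<n} \<rightarrow>\<^sub>E {0..<int p}" "y \<in> {..<n} \<rightarrow>\<^sub>E {0..<int p}"
    using assms(1-3) by (simp_all add: carrier_Fp_power)
  show ?thesis
  proof (rule PiE_ext[OF PiE])
    fix j assume j: "j \<in> {..<n}"
    have "x j \<in> {0..<int p}" "y j \<in> {0..<int p}"
      by (rule PiE_mem[OF PiE(1) j], rule PiE_mem[OF PiE(2) j])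
    then show "x j = y j" using assms(4)[of j] j by (simp add: cong_def)
  qed
qed

text \<open>\<open>q\<close> separates two regimes of the reduced dimension \<open>m\<close>. If
  \<open>q \<le> m\<close>, the hitting set theorem applies, and \<open>small\<close> says that its
  cost is within \<open>\<epsilon> / 2\<close> per element. If \<open>m < q\<close>, then
  \<open>N\<close> is at most \<open>2 * p ^ q\<close>, and \<open>\<tau>q\<close> forces the number
  of bad pairs below one.\<close>

theorem almost_all_sums_Fp_power:
  fixes p q :: nat and K \<epsilon> \<tau> \<rho> :: real
  assumes p: "Factorial_Ring.prime p" and K: "1 \<le> K" and \<epsilon>: "0 < \<epsilon>"
    and \<tau>: "0 < \<tau>" "\<tau> \<le> 1/4" "\<tau> \<le> \<epsilon> / 2" and \<tau>q: "4 * \<tau>\<^sup>2 * p ^ (2 * q) < 1"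
    and \<rho>: "0 < \<rho>" "\<rho> < p" "\<And>m. card (low_degree (p - 1) m) \<le> \<rho> ^ m"
    and small: "12 * \<tau>\<^sup>2 * p ^ q + 36 * p\<^sup>2 / (p - \<rho>) * (p * (2 ^ 17 * K ^ 12)) * (\<rho> / p) ^ q \<le> \<epsilon> / 2"
  shows "almost_all_sums (Fp_power p n) K \<epsilon> (\<tau>\<^sup>2)"
proof (rule almost_all_sumsI)
  have p0: "0 < p" using p prime_gt_0_nat by blast
  interpret comm_group "Fp_power p n" by (rule comm_group_Fp_power)
  let ?G = "Fp_power p n"
  fix N A B \<Gamma>
  assume N0: "0 < N" and car: "A \<subseteq> carrier ?G" "B \<subseteq> carrier ?G" and fin: "finite A" "finite B"
    and N: "card A = N" "card B = N" and \<Gamma>: "\<Gamma> \<subseteq> A \<times> B"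
    and dense: "real (card \<Gamma>) \<ge> (1 - \<tau>\<^sup>2) * (real N)\<^sup>2"
    and KN: "real (card (restricted_sumset ?G \<Gamma>)) \<le> K * real N"
  define C where "C = restricted_sumset ?G \<Gamma>"
  have finC: "finite C" unfolding C_def using fin \<Gamma> by (intro finite_restricted_sumset) (auto intro: finite_subset)
  from rich_subsets[OF fin N N0 car \<Gamma> \<tau>(1,2) dense K KN] obtain A1 B1
    where sub: "A1 \<subseteq> A" "B1 \<subseteq> B" and few: "card (A - A1) \<le> \<tau> * N" "card (B - B1) \<le> \<tau> * N"
    and D4: "card ((A1 <#>\<^bsub>?G\<^esub> B1) <#>\<^bsub>?G\<^esub> m_inv ?G ` (A1 <#>\<^bsub>?G\<^esub> B1)) \<le> 2 ^ 17 * K ^ 12 * N"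
    and bad: "card {(a, b) \<in> A1 \<times> B1. a \<otimes>\<^bsub>?G\<^esub> b \<notin> C} \<le> \<tau>\<^sup>2 * (real N)\<^sup>2"
    unfolding C_def[symmetric] by (elim exE conjE)
  have fin1: "finite A1" "finite B1" using sub fin finite_subset by blast+
  have car1: "A1 \<subseteq> carrier ?G" "B1 \<subseteq> carrier ?G" using sub car by blast+
  have "\<tau> * N \<le> 1/4 * N" using \<tau> by (intro mult_right_mono) auto
  moreover have "real (card A) = real (card A1) + real (card (A - A1))"
    using card_Diff_subset[OF fin1(1) sub(1)] card_mono[OF fin(1) sub(1)] by simp
  moreover have "real (card B) = real (card B1) + real (card (B - B1))"
    using card_Diff_subset[OF fin1(2) sub(2)] card_mono[OF fin(2) sub(2)] by simp
  ultimately have half: "real N / 2 \<le> card A1" "real N / 2 \<le> card B1" using few N by linarith+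
  have "A1 \<noteq> {}" "B1 \<noteq> {}" using half N0 by auto
  then obtain a0 b0 where ab0: "a0 \<in> A1" "b0 \<in> B1" by blast
  define S where "S = A1 <#>\<^bsub>?G\<^esub> B1"
  define D where "D = S <#>\<^bsub>?G\<^esub> m_inv ?G ` S"
  have finS: "finite S" using fin1 by (simp add: S_def finite_set_mult)
  have finD: "finite D" using finS by (simp add: D_def finite_set_mult)
  have carS: "S \<subseteq> carrier ?G" unfolding S_def using car1 by (rule set_mult_closed)
  have "a0 \<otimes>\<^bsub>?G\<^esub> b0 \<in> S" using ab0 by (simp add: S_def set_mult_memI)
  then have "D \<noteq> {}" unfolding D_def by (metis empty_iff imageI set_mult_memI)
  from exists_injective_reduction[OF p finD this, of n] obtain m \<pi> where m: "p ^ m \<le> p * card D"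
    and add: "\<forall>x y :: nat \<Rightarrow> int. \<forall>i. \<pi> (\<lambda>j. x j + y j) i = \<pi> x i + (\<pi> y i :: int)"
    and div: "\<forall>x. (\<forall>j<n. int p dvd x j) \<longrightarrow> (\<forall>i<m. int p dvd \<pi> x i)"
    and ker: "\<forall>d\<in>D. (\<forall>i<m. int p dvd \<pi> d i) \<longrightarrow> (\<forall>j<n. int p dvd d j)"
    by (elim exE conjE)
  have diff: "\<pi> (\<lambda>j. x j - y j) i = \<pi> x i - \<pi> y i" for x y :: "nat \<Rightarrow> int" and i
    using add[rule_format, of "\<lambda>j. x j - y j" y i] by simp
  \<comment> \<open>\<open>w\<close> is any integer vector congruent to \<open>x - x'\<close>, so
    the fact applies to sums and differences formed without reduction modulo \<open>p\<close>;
    \<open>d\<close> is the reduced difference, which lies in \<open>D\<close>.\<close>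
  have key: "(\<forall>i<m. int p dvd \<pi> w i) \<longleftrightarrow> x = x'"
    if x: "x \<in> S" "x' \<in> S" and w: "\<And>j. j < n \<Longrightarrow> [w j = x j - x' j] (mod int p)" for x x' w
  proof
    assume "x = x'"
    then have "\<forall>j<n. int p dvd w j" using w by (simp add: cong_0_iff)
    then show "\<forall>i<m. int p dvd \<pi> w i" using div by blast
  next
    assume dv: "\<forall>i<m. int p dvd \<pi> w i"
    have xc: "x \<in> carrier ?G" "x' \<in> carrier ?G" using x carS by auto
    define d where "d = x \<otimes>\<^bsub>?G\<^esub> inv\<^bsub>?G\<^esub> x'"
    have "d \<in> D" unfolding d_def D_def using x by (intro set_mult_memI imageI)
    have dj: "[d j = x j - x' j] (mod int p)" if "j < n" for j
      using that xc by (simp add: d_def mult_Fp_power inv_Fp_power cong_def mod_simps)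
    have "\<forall>j<n. int p dvd w j - d j"
      using w dj by (metis cong_iff_dvd_diff cong_sym cong_trans)
    then have wd: "int p dvd \<pi> w i - \<pi> d i" if "i < m" for i
      using div[rule_format, of "\<lambda>j. w j - d j" i] that by (simp add: diff)
    have "int p dvd \<pi> w i - (\<pi> w i - \<pi> d i)" if "i < m" for i
      by (rule dvd_diff[OF dv[rule_format, OF that] wd[OF that]])
    then have "\<forall>i<m. int p dvd \<pi> d i" by simp
    then have "\<forall>j<n. int p dvd d j" using ker \<open>d \<in> D\<close> by blast
    then have "[x j = x' j] (mod int p)" if "j < n" for j
      using dj[OF that] that by (metis cong_dvd_iff cong_iff_dvd_diff)
    then show "x = x'" using Fp_power_eqI[OF p0 xc] by blast
  qed
  interpret labelled_vectors p \<pi> \<pi> \<pi> by unfold_locales (rule p)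
  define Z where "Z = S - C"
  have finZ: "finite Z" using finS by (simp add: Z_def)
  have sols: "a \<in> A1 \<and> b \<in> B1 \<and> c = a \<otimes>\<^bsub>?G\<^esub> b \<and> c \<notin> C \<longleftrightarrow> (a, b, c) \<in> sols m A1 B1 Z" for a b c
  proof -
    have "(\<forall>l<m. [\<pi> a l + \<pi> b l = \<pi> c l] (mod int p)) \<longleftrightarrow> a \<otimes>\<^bsub>?G\<^esub> b = c" if abc: "a \<in> A1" "b \<in> B1" "c \<in> S"
    proof -
      have "a \<otimes>\<^bsub>?G\<^esub> b \<in> S" using abc by (simp add: S_def set_mult_memI)
      then have "(\<forall>i<m. int p dvd \<pi> (\<lambda>j. a j + b j - c j) i) \<longleftrightarrow> a \<otimes>\<^bsub>?G\<^esub> b = c"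
        using abc by (intro key) (simp_all add: mult_Fp_power cong_def mod_simps)
      then show ?thesis unfolding diff add[rule_format] cong_iff_dvd_diff .
    qed
    moreover have "a \<otimes>\<^bsub>?G\<^esub> b \<in> S" if "a \<in> A1" "b \<in> B1" using that by (simp add: S_def set_mult_memI)
    ultimately show ?thesis unfolding sols_def Z_def by auto
  qed
  \<comment> \<open>Adding the fixed \<open>b0\<close> turns differences in \<open>A1\<close> into
    differences of sums, which belong to \<open>D\<close>; \<open>a0\<close> does the same for
    \<open>B1\<close>.\<close>
  have sep: "separated m A1 B1 Z"
    unfolding separated_def
  proof (intro conjI ballI impI)
    fix a a' assume a: "a \<in> A1" "a' \<in> A1" and c: "\<forall>l<m. [\<pi> a l = \<pi> a' l] (mod int p)"
    have "(\<forall>i<m. int p dvd \<pi> (\<lambda>j. a j - a' j) i) \<longleftrightarrow> a \<otimes>\<^bsub>?G\<^esub> b0 = a' \<otimes>\<^bsub>?G\<^esub> b0"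
      using a ab0 by (intro key) (simp_all add: S_def set_mult_memI mult_Fp_power cong_def mod_simps)
    then have "a \<otimes>\<^bsub>?G\<^esub> b0 = a' \<otimes>\<^bsub>?G\<^esub> b0" using c unfolding diff cong_iff_dvd_diff by blast
    then show "a = a'" using a ab0 car1 by (simp add: subset_iff)
  next
    fix b b' assume b: "b \<in> B1" "b' \<in> B1" and c: "\<forall>l<m. [\<pi> b l = \<pi> b' l] (mod int p)"
    have "(\<forall>i<m. int p dvd \<pi> (\<lambda>j. b j - b' j) i) \<longleftrightarrow> a0 \<otimes>\<^bsub>?G\<^esub> b = a0 \<otimes>\<^bsub>?G\<^esub> b'"
      using b ab0 by (intro key) (simp_all add: S_def set_mult_memI mult_Fp_power cong_def mod_simps)
    then have "a0 \<otimes>\<^bsub>?G\<^esub> b = a0 \<otimes>\<^bsub>?G\<^esub> b'" using c unfolding diff cong_iff_dvd_diff by blast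
    then show "b = b'" using b ab0 car1 by (simp add: subset_iff)
  next
    fix x x' assume x: "x \<in> Z" "x' \<in> Z" and c: "\<forall>l<m. [\<pi> x l = \<pi> x' l] (mod int p)"
    have "(\<forall>i<m. int p dvd \<pi> (\<lambda>j. x j - x' j) i) \<longleftrightarrow> x = x'"
      using x by (intro key) (simp_all add: Z_def)
    then show "x = x'" using c unfolding diff cong_iff_dvd_diff by blast
  qed
  define T where "T = sols m A1 B1 Z"
  have finT: "finite T" unfolding T_def using fin1 finZ by (intro finite_sols)
  have cardT: "card T \<le> \<tau>\<^sup>2 * (real N)\<^sup>2"
  proof -
    have "card T \<le> card {(a, b) \<in> A1 \<times> B1. a \<otimes>\<^bsub>?G\<^esub> b \<notin> C}"
    proof (rule card_inj_on_le[of "\<lambda>(a, b, c). (a, b)"])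
      show "inj_on (\<lambda>(a, b, c). (a, b)) T" unfolding T_def by (auto intro!: inj_onI simp: sols[symmetric])
      show "(\<lambda>(a, b, c). (a, b)) ` T \<subseteq> {(a, b) \<in> A1 \<times> B1. a \<otimes>\<^bsub>?G\<^esub> b \<notin> C}"
        unfolding T_def by (auto simp: sols[symmetric])
      show "finite {(a, b) \<in> A1 \<times> B1. a \<otimes>\<^bsub>?G\<^esub> b \<notin> C}"
        by (rule finite_subset[of _ "A1 \<times> B1"]) (use fin1 in auto)
    qed
    then show ?thesis using bad by linarith
  qed
  \<comment> \<open>\<open>A1\<close> has at least \<open>N / 2\<close> elements and embeds in
    dimension \<open>m\<close>. Together with \<open>pmD\<close> this ties \<open>p ^ m\<close> to
    \<open>N\<close> up to factors in \<open>p\<close> and \<open>K\<close>.\<close>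
  have Npm: "N \<le> 2 * real p ^ m"
  proof -
    have "inj_on (\<lambda>a. \<lambda>l\<in>{..<m}. \<pi> a l mod int p) A1"
    proof (rule inj_onI)
      fix a a' assume a: "a \<in> A1" "a' \<in> A1"
        and eq: "(\<lambda>l\<in>{..<m}. \<pi> a l mod int p) = (\<lambda>l\<in>{..<m}. \<pi> a' l mod int p)"
      have "[\<pi> a l = \<pi> a' l] (mod int p)" if "l < m" for l
        using fun_cong[OF eq, of l] that by (simp add: cong_def)
      then show "a = a'" using sep a unfolding separated_def by blast
    qed
    moreover have "(\<lambda>a. \<lambda>l\<in>{..<m}. \<pi> a l mod int p) ` A1 \<subseteq> {..<m} \<rightarrow>\<^sub>E {0..<int p}"
      using p0 by (intro image_subsetI restrict_PiE_iff[THEN iffD2]) auto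
    ultimately have "card A1 \<le> card ({..<m} \<rightarrow>\<^sub>E {0..<int p})"
      by (rule card_inj_on_le) (simp add: finite_PiE)
    then have "card A1 \<le> p ^ m" by (simp add: card_funcsetE)
    from of_nat_mono[OF this, where 'a = real] have "real (card A1) \<le> real p ^ m" unfolding of_nat_power .
    then show ?thesis using half(1) by linarith
  qed
  have pmD: "real p ^ m \<le> p * (2 ^ 17 * K ^ 12) * N"
  proof -
    have "real p ^ m \<le> p * real (card D)"
      using of_nat_mono[OF m, where 'a = real] unfolding of_nat_power of_nat_mult .
    also have "\<dots> \<le> p * (2 ^ 17 * K ^ 12 * N)"
      using D4 unfolding D_def S_def by (intro mult_left_mono) auto
    finally show ?thesis by (simp add: mult.assoc)
  qed
  have "\<exists>R\<subseteq>A1 <+> B1 <+> Z. (\<forall>t\<in>T. \<exists>r\<in>R. incident r t) \<and> card R \<le> \<epsilon> / 2 * N"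
  proof (cases "q \<le> m")
    case True
    from hitting_set_of_sols[OF fin1 finZ sep \<rho> True] obtain R where R: "R \<subseteq> A1 <+> B1 <+> Z"
      "\<forall>t\<in>T. \<exists>r\<in>R. incident r t"
      "card R \<le> 6 * card T * p ^ q / p ^ m + 36 * p\<^sup>2 / (p - \<rho>) * p ^ m * (\<rho> / p) ^ q"
      unfolding T_def by blast
    have "6 * card T * p ^ q / p ^ m \<le> 12 * \<tau>\<^sup>2 * p ^ q * N"
    proof -
      \<comment> \<open>One of the two factors \<open>N\<close> in the bound for bad pairs is traded
        for \<open>2 * p ^ m\<close>, which cancels the denominator.\<close>
      have "real (card T) \<le> \<tau>\<^sup>2 * (N * (2 * real p ^ m))"
        using cardT mult_left_mono[OF mult_left_mono[OF Npm, of "real N"], of "\<tau>\<^sup>2"]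
        by (simp add: power2_eq_square)
      then have "6 * real p ^ q * real (card T) \<le> 6 * real p ^ q * (\<tau>\<^sup>2 * (N * (2 * real p ^ m)))"
        by (intro mult_left_mono) auto
      then show ?thesis using p0 by (simp add: divide_le_eq mult_ac)
    qed
    moreover have "36 * p\<^sup>2 / (p - \<rho>) * p ^ m * (\<rho> / p) ^ q
      \<le> 36 * p\<^sup>2 / (p - \<rho>) * (p * (2 ^ 17 * K ^ 12) * N) * (\<rho> / p) ^ q"
      using pmD \<rho> by (intro mult_right_mono mult_left_mono) auto
    moreover have "36 * p\<^sup>2 / (p - \<rho>) * (p * (2 ^ 17 * K ^ 12) * N) * (\<rho> / p) ^ q
      = 36 * p\<^sup>2 / (p - \<rho>) * (p * (2 ^ 17 * K ^ 12)) * (\<rho> / p) ^ q * N" by (simp only: mult_ac)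
    moreover have "(12 * \<tau>\<^sup>2 * p ^ q + 36 * p\<^sup>2 / (p - \<rho>) * (p * (2 ^ 17 * K ^ 12)) * (\<rho> / p) ^ q) * N
      \<le> \<epsilon> / 2 * N" using small by (intro mult_right_mono) auto
    ultimately have "card R \<le> \<epsilon> / 2 * N" using R(3) unfolding distrib_right by linarith
    then show ?thesis using R(1,2) by (intro exI[of _ R]) simp
  next
    case False
    have "real p ^ m \<le> real p ^ q" using False p0 by (intro power_increasing) auto
    then have "real N \<le> 2 * real p ^ q" using Npm by linarith
    then have "\<tau>\<^sup>2 * (real N)\<^sup>2 \<le> \<tau>\<^sup>2 * (2 * real p ^ q)\<^sup>2"
      by (intro mult_left_mono power_mono) auto
    also have "\<dots> = 4 * \<tau>\<^sup>2 * p ^ (2 * q)" by (simp add: power_mult_distrib power_mult[symmetric] mult.commute)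
    also have "\<dots> < 1" by (rule \<tau>q)
    finally have "card T = 0" using cardT by simp
    then have "T = {}" using finT by simp
    then show ?thesis using \<epsilon> by (intro exI[of _ "{}"]) simp
  qed
  then obtain R where R: "R \<subseteq> A1 <+> B1 <+> Z" "\<forall>t\<in>T. \<exists>r\<in>R. incident r t" "card R \<le> \<epsilon> / 2 * N" by blast
  have finR: "finite R" using R(1) fin1 finZ by (meson finite_Plus finite_subset)
  have part: "finite (f -` R) \<and> card (f -` R) \<le> \<epsilon> / 2 * N" if "inj f" for f :: "(nat \<Rightarrow> int) \<Rightarrow> _"
  proof -
    have "card (f -` R) \<le> card R" using finR that by (intro card_inj_on_le[of f]) (auto intro: inj_on_subset)
    then show ?thesis using R(3) finR that by (auto intro: finite_vimageI)
  qed
  have i: "inj (Inl :: (nat \<Rightarrow> int) \<Rightarrow> (nat \<Rightarrow> int) + (nat \<Rightarrow> int) + (nat \<Rightarrow> int))"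
    "inj (\<lambda>y :: nat \<Rightarrow> int. Inr (Inl y) :: (nat \<Rightarrow> int) + (nat \<Rightarrow> int) + (nat \<Rightarrow> int))"
    "inj (\<lambda>z :: nat \<Rightarrow> int. Inr (Inr z) :: (nat \<Rightarrow> int) + (nat \<Rightarrow> int) + (nat \<Rightarrow> int))"
    by (auto intro: injI)
  have hit: "a \<in> Inl -` R \<or> b \<in> (\<lambda>y. Inr (Inl y)) -` R \<or> a \<otimes>\<^bsub>?G\<^esub> b \<in> (\<lambda>z. Inr (Inr z)) -` R"
    if ab: "a \<in> A1" "b \<in> B1" "a \<otimes>\<^bsub>?G\<^esub> b \<notin> C" for a b
  proof -
    have "(a, b, a \<otimes>\<^bsub>?G\<^esub> b) \<in> T" using ab by (simp add: T_def sols[symmetric])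
    then obtain r where r: "r \<in> R" "incident r (a, b, a \<otimes>\<^bsub>?G\<^esub> b)" using R(2) by blast
    then have "r = Inl a \<or> r = Inr (Inl b) \<or> r = Inr (Inr (a \<otimes>\<^bsub>?G\<^esub> b))"
      by (auto simp: incident_def split: sum.splits)
    then show ?thesis using r(1) by auto
  qed
  have few': "card (A - A1) \<le> \<epsilon> / 2 * N" "card (B - B1) \<le> \<epsilon> / 2 * N"
    using few mult_right_mono[OF \<tau>(3), of "real N"] by linarith+
  have "card ((\<lambda>z. Inr (Inr z)) -` R) \<le> \<epsilon> * N"
    using part[OF i(3)] mult_right_mono[of "\<epsilon> / 2" \<epsilon> "real N"] \<epsilon> by linarith
  from conclusion_from_hitting_sets[OF fin finC N sub few' part[OF i(1), THEN conjunct1]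
    part[OF i(2), THEN conjunct1] part[OF i(3), THEN conjunct1] part[OF i(1), THEN conjunct2]
    part[OF i(2), THEN conjunct2] this hit]
  show "large_subsets ?G \<epsilon> A B N (restricted_sumset ?G \<Gamma>)"
    unfolding C_def by blast
qed

section \<open>Choice of parameters, polynomial in \<open>\<epsilon> / K\<close>\<close>

lemma power_scale:
  fixes t :: real
  assumes t: "0 < t" "t < 1/2"
  obtains l :: nat where "0 < l" "(1/2) ^ l \<le> t" "2 ^ l * t\<^sup>2 \<le> 1"
proof -
  obtain k :: nat where k: "(1/2) ^ k \<le> t" using t real_arch_pow_inv[of t "1/2"] by (meson less_imp_le half_gt_zero_iff one_less_numeral_iff divide_less_eq_1_pos semiring_norm(76) zero_less_numeral)
  \<comment> \<open>The dyadic scale of \<open>t\<close>: minimality gives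
    \<open>t / 2 < (1/2) ^ l\<close>, and \<open>t\<^sup>2 \<le> t / 2\<close> then bounds
    \<open>2 ^ l\<close> by the inverse square of \<open>t\<close>.\<close>
  define l where "l = (LEAST k. (1/2 :: real) ^ k \<le> t)"
  have l: "(1/2) ^ l \<le> t" unfolding l_def by (rule LeastI[of _ k]) (rule k)
  have l0: "0 < l" using l t by (cases l) auto
  then have "\<not> (1/2) ^ (l - 1) \<le> t" unfolding l_def by (intro not_less_Least) simp
  then have "t < (1/2) ^ (l - 1)" by simp
  then have "t * (1/2) < (1/2) ^ (l - 1) * (1/2)" by simp
  also have "\<dots> = (1/2) ^ l" using l0 by (cases l) auto
  finally have half: "t / 2 < (1/2) ^ l" by simp
  have "t * t \<le> t * (1/2)" using t by (intro mult_left_mono) auto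
  then have "t\<^sup>2 \<le> (1/2) ^ l" using half unfolding power2_eq_square by linarith
  then have "2 ^ l * t\<^sup>2 \<le> 2 ^ l * (1/2) ^ l" by (intro mult_left_mono) auto
  also have "\<dots> = 1" by (simp add: power_mult_distrib[symmetric])
  finally show ?thesis using that[OF l0 l] by simp
qed

text \<open>With \<open>t = \<epsilon> / K\<close> the threshold \<open>q = Q * l\<close> is
  logarithmic in \<open>1 / t\<close>. A suitable \<open>Q\<close> makes the saving
  \<open>r ^ q\<close> smaller than the required power of \<open>t\<close>, while
  \<open>p ^ q\<close> stays at most the inverse of \<open>t ^ (2 * B)\<close>, which a high enough
  power \<open>\<tau>\<close> of \<open>t\<close> absorbs.\<close>

lemma Fp_power_polynomial_bound:
  assumes p: "Factorial_Ring.prime (p :: nat)"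
  shows "\<exists>C>0. \<forall>K \<epsilon> n. 1 \<le> K \<longrightarrow> 0 < \<epsilon> \<longrightarrow> \<epsilon> < 1/2 \<longrightarrow>
    almost_all_sums (Fp_power p n) K \<epsilon> ((\<epsilon> / K) ^ C)"
proof -
  have p1: "1 < p" using p prime_gt_1_nat by blast
  obtain \<rho> :: real where \<rho>: "0 < \<rho>" "\<rho> < real (p - 1) + 1" "\<And>m. card (low_degree (p - 1) m) \<le> \<rho> ^ m"
    using low_degree_bound[of "p - 1"] p1 by auto
  have \<rho>p: "\<rho> < p" using \<rho>(2) p1 by (simp add: of_nat_diff)
  define r where "r = \<rho> / p"
  have r: "0 < r" "r < 1" using \<rho>(1) \<rho>p p1 by (auto simp: r_def)
  define c where "c = 36 * p\<^sup>2 / (p - \<rho>) * p * 2 ^ 17"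
  have c: "0 < c" using \<rho>p p1 by (simp add: c_def)
  obtain b :: nat where b: "4 * c < 2 ^ b" using real_arch_pow[of 2 "4 * c"] by auto
  \<comment> \<open>In \<open>t ^ 13\<close> twelve factors cancel \<open>K ^ 12\<close> and the
    last one is at most \<open>\<epsilon>\<close>; \<open>(1/2) ^ b\<close> absorbs the constant
    \<open>c\<close>.\<close>
  obtain Q :: nat where Q: "r ^ Q < (1/2) ^ (13 + b)" using real_arch_pow_inv[of "(1/2) ^ (13 + b)" r] r by auto
  obtain B :: nat where B: "real p ^ Q < 2 ^ B" using real_arch_pow[of 2 "real p ^ Q"] by auto
  \<comment> \<open>\<open>\<tau>\<^sup>2 = t ^ (4 * B + 8)\<close>: the part
    \<open>t ^ (4 * B)\<close> pays for \<open>p ^ (2 * q)\<close>, and \<open>t ^ 8\<close> beats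
    the numerical constants.\<close>
  define C where "C = 2 * B + 4"
  have "almost_all_sums (Fp_power p n) K \<epsilon> ((\<epsilon> / K) ^ (2 * C))"
    if K: "1 \<le> K" and \<epsilon>: "0 < \<epsilon>" "\<epsilon> < 1/2" for K \<epsilon> :: real and n
  proof -
    define t where "t = \<epsilon> / K"
    have "\<epsilon> \<le> \<epsilon> * K" using K \<epsilon> by simp
    then have t\<epsilon>: "t \<le> \<epsilon>" using K by (simp add: t_def divide_le_eq)
    have t: "0 < t" "t < 1/2" using K \<epsilon> t\<epsilon> by (auto simp: t_def)
    obtain l where l: "0 < l" "(1/2) ^ l \<le> t" "2 ^ l * t\<^sup>2 \<le> 1" by (rule power_scale[OF t])
    define q where "q = Q * l"
    define \<tau> where "\<tau> = t ^ C"
    have \<tau>0: "0 < \<tau>" using t by (simp add: \<tau>_def)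
    have "\<tau> \<le> t\<^sup>2" unfolding \<tau>_def C_def using t by (intro power_decreasing) auto
    also have "t\<^sup>2 \<le> t * (1/2)" unfolding power2_eq_square using t by (intro mult_left_mono) auto
    finally have \<tau>: "\<tau> \<le> t / 2" by simp
    have pq: "real p ^ q * t ^ (2 * B) \<le> 1"
    proof -
      have "real p ^ q \<le> (2 ^ B) ^ l" unfolding q_def power_mult using B by (intro power_mono) auto
      then have "real p ^ q * t ^ (2 * B) \<le> (2 ^ B) ^ l * t ^ (2 * B)" using t by (intro mult_right_mono) auto
      also have "\<dots> = (2 ^ l * t\<^sup>2) ^ B"
        by (simp add: power_mult[symmetric] power_mult_distrib mult.commute)
      also have "\<dots> \<le> 1" using l(3) t by (intro power_le_one) auto
      finally show ?thesis .
    qed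
    have t8: "t ^ j \<le> (1/2) ^ j" for j using t by (intro power_mono) auto
    have \<tau>2: "\<tau>\<^sup>2 = t ^ (2 * B) * (t ^ (2 * B) * t ^ 8)"
      by (simp add: \<tau>_def C_def power_mult[symmetric] power_add[symmetric])
    have q1: "4 * \<tau>\<^sup>2 * real p ^ (2 * q) < 1"
    proof -
      have "4 * \<tau>\<^sup>2 * real p ^ (2 * q) = (real p ^ q * t ^ (2 * B)) * (real p ^ q * t ^ (2 * B)) * (4 * t ^ 8)"
        by (simp add: \<tau>2 mult_2 power_add)
      also have "\<dots> \<le> 1 * 1 * (4 * t ^ 8)"
        using pq t by (intro mult_mono) auto
      also have "\<dots> < 1" using t8[of 8] by (simp add: power_one_over)
      finally show ?thesis .
    qed
    have q2: "12 * \<tau>\<^sup>2 * real p ^ q \<le> \<epsilon> / 4"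
    proof -
      have "12 * \<tau>\<^sup>2 * real p ^ q = (real p ^ q * t ^ (2 * B)) * (t ^ (2 * B) * (12 * (t ^ 7 * t)))"
        using power_add[of t 7 1] by (simp add: \<tau>2 mult_ac)
      also have "\<dots> \<le> 1 * (1 * (12 * ((1/2) ^ 7 * t)))"
        using pq t t8[of 7] by (intro mult_mono power_le_one) auto
      also have "\<dots> \<le> \<epsilon> / 4" using t\<epsilon> t by (simp add: power_one_over)
      finally show ?thesis .
    qed
    have q3: "36 * p\<^sup>2 / (p - \<rho>) * (p * (2 ^ 17 * K ^ 12)) * (\<rho> / p) ^ q \<le> \<epsilon> / 4"
    proof -
      have "r ^ q \<le> ((1/2) ^ (13 + b)) ^ l" unfolding q_def power_mult using Q r by (intro power_mono) auto
      also have "\<dots> = ((1/2) ^ l) ^ (13 + b)" by (simp add: power_mult[symmetric] mult.commute)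
      also have "\<dots> = ((1/2) ^ l) ^ 13 * ((1/2) ^ l) ^ b" by (simp add: power_add)
      also have "\<dots> \<le> t ^ 13 * (1/2) ^ b"
      proof (intro mult_mono power_mono l(2))
        show "(1/2 :: real) ^ l \<le> 1/2" using l(1) power_decreasing[of 1 l "1/2 :: real"] by simp
      qed (use t in auto)
      finally have "r ^ q \<le> t ^ 13 * (1/2) ^ b" .
      then have "c * K ^ 12 * r ^ q \<le> c * K ^ 12 * (t ^ 13 * (1/2) ^ b)"
        using c K by (intro mult_left_mono) auto
      also have "\<dots> = (c * (1/2) ^ b) * (K ^ 12 * t ^ 13)" by simp
      also have "\<dots> \<le> 1/4 * \<epsilon>"
      proof (rule mult_mono)
        show "c * (1/2) ^ b \<le> 1/4" using b by (simp add: power_divide divide_le_eq)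
        have "K * t = \<epsilon>" using K by (simp add: t_def)
        moreover have "K ^ 12 * t ^ 13 = (K * t) ^ 12 * t"
          using power_add[of t 12 1] by (simp add: power_mult_distrib)
        ultimately have "K ^ 12 * t ^ 13 = \<epsilon> ^ 12 * t" by simp
        also have "\<dots> \<le> 1 * \<epsilon>" using \<epsilon> t t\<epsilon> by (intro mult_mono power_le_one) auto
        finally show "K ^ 12 * t ^ 13 \<le> \<epsilon>" by simp
      qed (use K t \<epsilon> in auto)
      finally show ?thesis by (simp add: c_def r_def mult_ac)
    qed
    have "almost_all_sums (Fp_power p n) K \<epsilon> (\<tau>\<^sup>2)"
      by (rule almost_all_sums_Fp_power[OF p K \<epsilon>(1) \<tau>0 _ _ _ \<rho>(1) \<rho>p \<rho>(3)])
        (use \<tau> t t\<epsilon> q1 q2 q3 in auto)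
    then show ?thesis by (simp add: \<tau>_def t_def power_mult[symmetric] mult.commute)
  qed
  then show ?thesis by (intro exI[of _ "2 * C"]) (simp add: C_def)
qed

theorem theorem1p1:
  shows "(\<forall>K \<epsilon>. K \<ge> 1 \<longrightarrow> 0 < \<epsilon> \<longrightarrow> \<epsilon> < 1/2 \<longrightarrow>
            delta_sums K \<epsilon> > 0 \<and>
            (\<forall>G :: 'a monoid. comm_group G \<longrightarrow> almost_all_sums G K \<epsilon> (delta_sums K \<epsilon>)))
       \<and> (\<forall>p::nat. Factorial_Ring.prime p \<longrightarrow>
            (\<exists>C::real. C > 0 \<and>
              (\<forall>K \<epsilon>. K \<ge> 1 \<longrightarrow> 0 < \<epsilon> \<longrightarrow> \<epsilon> < 1/2 \<longrightarrow>
                (\<forall>n::nat. almost_all_sums (Fp_power p n) K \<epsilon> ((\<epsilon> / K) powr C)))))"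
proof (intro conjI allI impI)
  fix K \<epsilon> :: real
  assume K: "1 \<le> K" and \<epsilon>: "0 < \<epsilon>"
  \<comment> \<open>The removal argument at type \<open>nat\<close> shows that the choice in
    \<open>delta_sums\<close> is from a nonempty set of valid constants; the type \<open>'a\<close>
    is then reached through countable subgroups.\<close>
  have ex: "delta_sums K \<epsilon> > 0 \<and> (\<forall>G :: nat monoid. comm_group G \<longrightarrow> almost_all_sums G K \<epsilon> (delta_sums K \<epsilon>))"
    unfolding delta_sums_def by (rule someI_ex) (rule exists_delta_all_comm_groups[OF K \<epsilon>])
  then show "delta_sums K \<epsilon> > 0" by blast
  fix G :: "'a monoid"
  assume "comm_group G"
  then show "almost_all_sums G K \<epsilon> (delta_sums K \<epsilon>)"
  proof (rule comm_group.almost_all_sums_from_nat)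
    show "almost_all_sums H K \<epsilon> (delta_sums K \<epsilon>)" if "comm_group H" for H :: "nat monoid"
      using ex that by simp
  qed
next
  fix p :: nat
  assume "Factorial_Ring.prime p"
  from Fp_power_polynomial_bound[OF this] obtain C :: nat where C: "0 < C"
    "\<forall>K \<epsilon> n. 1 \<le> K \<longrightarrow> 0 < \<epsilon> \<longrightarrow> \<epsilon> < 1/2 \<longrightarrow> almost_all_sums (Fp_power p n) K \<epsilon> ((\<epsilon> / K) ^ C)"
    by (elim exE conjE)
  show "\<exists>C::real. C > 0 \<and> (\<forall>K \<epsilon>. K \<ge> 1 \<longrightarrow> 0 < \<epsilon> \<longrightarrow> \<epsilon> < 1/2 \<longrightarrow>
    (\<forall>n::nat. almost_all_sums (Fp_power p n) K \<epsilon> ((\<epsilon> / K) powr C)))"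
    using C by (intro exI[of _ "real C"]) (simp add: powr_realpow)
qed

end
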